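(* Let $1<p<\infty$ and $0<\tau,\vartheta<p-1$, and assume that $X=(X,d,\nu,\mu)$ is a geodesic two-measure space satisfying the following assumptions: (i) $X$ supports a $(p,p)$-Poincaré inequality with a constant $K_{p,p}>0$; (ii) $X$ satisfies a $(p-\tau)$-balance condition with a constant $C_b>0$; (iii) $X$ has the $(p-\vartheta)$-independence property; (iv) $\nu$ is an $A_\infty(\mu)$-weighted measure, with constants $c_{\nu,\mu},\delta>0$. Then there exists $0<\varepsilon_0<p-1$ such that $X$ supports a maximal $(p,p-\varepsilon)$-Poincaré inequality for every $0\le\varepsilon\le\varepsilon_0$.
   Context: **Metric two-measure space.** $X=(X,d,\nu,\mu)$ is a metric space $(X,d)$ with at least two points, equipped with two positive complete Borel measures $\nu,\mu$ such that $0<\nu(B)<\infty$ and $0<\mu(B)<\infty$ for all open balls $B=B(x,r)=\{y\in X: d(y,x)<r\}$, $x\in X$, $r>0$, and such that both measures are doubling: there are constants $c_\nu,c_\mu>1$ with $\nu(2B)\le c_\nu\nu(B)$ and $\mu(2B)\le c_\mu\mu(B)$ for all balls $B$. Balls come with a fixed centre and radius, and $tB=B(x,tr)$. **Geodesic.** A curve is a nonconstant, rectifiable, continuous map from a compact interval to $X$, parametrized by arc length. $X$ is a geodesic two-measure space if any two distinct points can be joined by a curve whose length equals their distance. **Averages, Lipschitz functions.** $u_{B;\nu}=\frac1{\nu(B)}\int_B u\,d\nu$. $\mathrm{Lip}(X)$ is the set of all functions $u:X\to\mathbb R$ that are $\kappa$-Lipschitz for some $0\le\kappa<\infty$. **Upper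 gradients.** For $1<t<\infty$, a $\mu$-measurable $g:X\to[0,\infty]$ is a $t$-weak upper gradient of $u:X\to\mathbb R$ if $|u(\gamma(0))-u(\gamma(\ell_\gamma))|\le\int_\gamma g\,ds$ for $t$-almost every curve $\gamma:[0,\ell_\gamma]\to X$; that is, there is a non-negative Borel function $\rho\in L^t_{\mathrm{loc}}(X;d\mu)$ such that $\int_\gamma\rho\,ds=\infty$ whenever the inequality fails or is not defined. ($L^t_{\mathrm{loc}}(X;d\mu)$: each point $x$ has some $r_x>0$ such that the function is in $L^t(B(x,r_x);d\mu)$.) For $u\in\mathrm{Lip}(X)$, $\mathcal D^t(u)$ is the set of all $t$-weak upper gradients $g\in L^t_{\mathrm{loc}}(X;d\mu)$ of $u$. The minimal $t$-weak upper gradient of $u$ is the ($\mu$-a.e. unique) $g_u\in\mathcal D^t(u)$ with $g_u\le g$ $\mu$-a.e. for every $g\in\mathcal D^t(u)$; it always exists. **Poincaré inequality.** For $1\le q<\infty$, $1<t<\infty$, $X$ supports a $(q,t)$-Poincaré inequality with constant $K_{q,t}>0$ if $$\Bigl(\frac1{\nu(B)}\int_B|u-u_{B;\nu}|^q\,d\nu\Bigr)^{1/q}\le K_{q,t}^{1/t}\,\mathrm{diam}(B)\Bigl(\frac1{\mu(B)}\int_B g^t\,d\mu\Bigr)^{1/t}$$ for every ball $B$ in $X$, every $u\in\mathrm{Lip}(X)$ and every $g\in\mathcal D^t(u)$. **Balance condition.** For $1\le t<\infty$, $X$ satisfies a $t$-balance condition with constant $C>0$ if $$\Bigl(\frac{\mathrm{diam}(B')}{\mathrm{diam}(B)}\Bigr)^t\frac{\nu(B')}{\nu(B)}\le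 C\,\frac{\mu(B')}{\mu(B)}$$ whenever $B$ and $B'=B(x',r')$ are balls in $X$ with $x'\in B$ and $0<r'\le\mathrm{diam}(B)$. **Independence property.** For $1<t<\infty$, $X$ has the $t$-independence property if for all $q\ge t$ and all $u\in\mathrm{Lip}(X)$ the minimal $q$-weak upper gradient of $u$ coincides $\mu$-a.e. with the minimal $t$-weak upper gradient of $u$. **$A_\infty(\mu)$-weighted measure.** $\nu$ is an $A_\infty(\mu)$-weighted measure, with constants $c_{\nu,\mu},\delta>0$, if $\frac{\nu(A)}{\nu(B)}\le c_{\nu,\mu}\bigl(\frac{\mu(A)}{\mu(B)}\bigr)^\delta$ for every ball $B\subset X$ and Borel set $A\subset B$. **Maximal Poincaré inequality.** For a nonempty family $\mathcal B$ of balls, $1\le q<\infty$ and $u\in\mathrm{Lip}(X)$, the sharp maximal function is $$M^{\nu,q}_{\mathcal B}u(x)=\sup_{B:\,x\in B\in\mathcal B}\Bigl(\frac1{\mathrm{diam}(B)^q}\,\frac1{\nu(B)}\int_B|u-u_{B;\nu}|^q\,d\nu\Bigr)^{1/q},\quad x\in X,$$ with value $0$ if no ball of $\mathcal B$ contains $x$. For a ball $B_0\subset X$ let $\mathcal B_0=\{B(x,r): B(x,2r)\subset B_0\}$. $X$ supports a maximal $(q,t)$-Poincaré inequality if there is $C>0$ such that for every ball $B_0\subset X$, every $u\in\mathrm{Lip}(X)$ and every $g\in\mathcal D^t(u)$, $$\int_{B_0}\bigl(M^{\nu,q}_{\mathcal B_0}u\bigr)^t\,d\mu\le C\int_{B_0}g^t\,d\mu.$$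 *)

theory Defs
  imports "HOL-Analysis.Analysis"
begin

text \<open>The metric space \<open>X\<close> is the whole type \<open>'a\<close>. A ball is represented by its centre and its
  radius; \<open>\<nu>\<close> governs oscillations and \<open>\<mu>\<close> governs gradients.\<close>

subsection \<open>Two-measure spaces\<close>

text \<open>A complete Borel measure is a measure on the Borel sets, extended to the completion of the
  Borel sigma-algebra.\<close>

definition complete_borel_measure :: "'a::metric_space measure \<Rightarrow> bool" where
  "complete_borel_measure M \<longleftrightarrow> (\<exists>N. sets N = sets borel \<and> M = completion N)"

definition positive_finite_on_balls :: "'a::metric_space measure \<Rightarrow> bool" where
  "positive_finite_on_balls M \<longleftrightarrow>
     (\<forall>x. \<forall>r>0. 0 < emeasure M (ball x r) \<and> emeasure M (ball x r) < \<infinity>)"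

definition doubling_measure :: "'a::metric_space measure \<Rightarrow> bool" where
  "doubling_measure M \<longleftrightarrow>
     (\<exists>c>1. \<forall>x. \<forall>r>0. measure M (ball x (2 * r)) \<le> c * measure M (ball x r))"

definition two_measure_space :: "'a::metric_space measure \<Rightarrow> 'a measure \<Rightarrow> bool" where
  "two_measure_space \<nu> \<mu> \<longleftrightarrow>
     (\<exists>x y :: 'a. x \<noteq> y) \<and>
     complete_borel_measure \<nu> \<and> complete_borel_measure \<mu> \<and>
     positive_finite_on_balls \<nu> \<and> positive_finite_on_balls \<mu> \<and>
     doubling_measure \<nu> \<and> doubling_measure \<mu>"

subsection \<open>Curves\<close>

definition curve_length :: "(real \<Rightarrow> 'a::metric_space) \<Rightarrow> real \<Rightarrow> real \<Rightarrow> ennreal" where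
  "curve_length \<gamma> a b =
     (SUP ts \<in> {ts. sorted ts \<and> set ts \<subseteq> {a..b}}.
        \<Sum>i<length ts - 1. ennreal (dist (\<gamma> (ts ! i)) (\<gamma> (ts ! Suc i))))"

text \<open>\<open>arc_length_curve l \<gamma>\<close>: the restriction of \<open>\<gamma>\<close> to \<open>{0..l}\<close> is a nonconstant rectifiable curve
  of length \<open>l\<close>, parametrized by arc length. Since the length of \<open>\<gamma>\<close> on \<open>{0..l}\<close> is \<open>l\<close>, being
  nonconstant amounts to \<open>0 < l\<close>.\<close>

definition arc_length_curve :: "real \<Rightarrow> (real \<Rightarrow> 'a::metric_space) \<Rightarrow> bool" where
  "arc_length_curve l \<gamma> \<longleftrightarrow>
     0 < l \<and> continuous_on {0..l} \<gamma> \<and> (\<forall>s\<in>{0..l}. curve_length \<gamma> 0 s = ennreal s)"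

definition geodesic_two_measure_space :: "'a::metric_space measure \<Rightarrow> 'a measure \<Rightarrow> bool" where
  "geodesic_two_measure_space \<nu> \<mu> \<longleftrightarrow>
     two_measure_space \<nu> \<mu> \<and>
     (\<forall>x y :: 'a. x \<noteq> y \<longrightarrow>
        (\<exists>l \<gamma>. arc_length_curve l \<gamma> \<and> \<gamma> 0 = x \<and> \<gamma> l = y \<and> l = dist x y))"

text \<open>The integral of \<open>g\<close> over a curve is defined iff \<open>g \<circ> \<gamma>\<close> is Lebesgue measurable on \<open>{0..l}\<close>.\<close>

definition curve_integral_defined :: "real \<Rightarrow> (real \<Rightarrow> 'a) \<Rightarrow> ('a \<Rightarrow> ennreal) \<Rightarrow> bool" where
  "curve_integral_defined l \<gamma> g \<longleftrightarrow> (\<lambda>s. g (\<gamma> s)) \<in> borel_measurable (lebesgue_on {0..l})"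

definition curve_integral :: "real \<Rightarrow> (real \<Rightarrow> 'a) \<Rightarrow> ('a \<Rightarrow> ennreal) \<Rightarrow> ennreal" where
  "curve_integral l \<gamma> g = (\<integral>\<^sup>+s. g (\<gamma> s) \<partial>lebesgue_on {0..l})"

subsection \<open>Lipschitz functions and weak upper gradients\<close>

definition Lip :: "('a::metric_space \<Rightarrow> real) set" where
  "Lip = {u. \<exists>\<kappa>. \<kappa>-lipschitz_on UNIV u}"

text \<open>Real powers on \<open>[0, \<infinity>]\<close>; only positive exponents are used.\<close>

definition ennreal_powr :: "ennreal \<Rightarrow> real \<Rightarrow> ennreal" where
  "ennreal_powr x t = (if x = \<infinity> then \<infinity> else ennreal (enn2real x powr t))"

definition Lloc :: "'a::metric_space measure \<Rightarrow> real \<Rightarrow> ('a \<Rightarrow> ennreal) set" where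
  "Lloc \<mu> t = {g \<in> borel_measurable \<mu>.
     \<forall>x. \<exists>r>0. (\<integral>\<^sup>+y\<in>ball x r. ennreal_powr (g y) t \<partial>\<mu>) < \<infinity>}"

definition weak_upper_gradient ::
    "'a::metric_space measure \<Rightarrow> real \<Rightarrow> ('a \<Rightarrow> real) \<Rightarrow> ('a \<Rightarrow> ennreal) \<Rightarrow> bool" where
  "weak_upper_gradient \<mu> t u g \<longleftrightarrow>
     g \<in> borel_measurable \<mu> \<and>
     (\<exists>\<rho>. \<rho> \<in> borel_measurable borel \<and> \<rho> \<in> Lloc \<mu> t \<and>
        (\<forall>l \<gamma>. arc_length_curve l \<gamma> \<and>
           \<not> (curve_integral_defined l \<gamma> g \<and>
              ennreal \<bar>u (\<gamma> 0) - u (\<gamma> l)\<bar> \<le> curve_integral l \<gamma> g) \<longrightarrow>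
           curve_integral l \<gamma> \<rho> = \<infinity>))"

definition upper_gradients ::
    "'a::metric_space measure \<Rightarrow> real \<Rightarrow> ('a \<Rightarrow> real) \<Rightarrow> ('a \<Rightarrow> ennreal) set" where
  "upper_gradients \<mu> t u = {g \<in> Lloc \<mu> t. weak_upper_gradient \<mu> t u g}"

definition minimal_upper_gradient ::
    "'a::metric_space measure \<Rightarrow> real \<Rightarrow> ('a \<Rightarrow> real) \<Rightarrow> ('a \<Rightarrow> ennreal) \<Rightarrow> bool" where
  "minimal_upper_gradient \<mu> t u g \<longleftrightarrow>
     g \<in> upper_gradients \<mu> t u \<and> (\<forall>h\<in>upper_gradients \<mu> t u. AE x in \<mu>. g x \<le> h x)"

subsection \<open>Poincare inequality, balance condition, independence property, weights\<close>

definition avg :: "'a measure \<Rightarrow> 'a set \<Rightarrow> ('a \<Rightarrow> real) \<Rightarrow> real" where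
  "avg \<nu> B u = (LINT y:B|\<nu>. u y) / measure \<nu> B"

text \<open>The right-hand side is taken in \<open>[0, \<infinity>]\<close>, because a function that is locally in \<open>L\<^sup>t\<close> need not
  be in \<open>L\<^sup>t\<close> on every ball.\<close>

definition poincare_inequality ::
    "'a::metric_space measure \<Rightarrow> 'a measure \<Rightarrow> real \<Rightarrow> real \<Rightarrow> real \<Rightarrow> bool" where
  "poincare_inequality \<nu> \<mu> q t K \<longleftrightarrow>
     (\<forall>x r. \<forall>u\<in>Lip. \<forall>g\<in>upper_gradients \<mu> t u. 0 < r \<longrightarrow>
        (let B = ball x r in
          ennreal (avg \<nu> B (\<lambda>y. \<bar>u y - avg \<nu> B u\<bar> powr q) powr (1 / q))
          \<le> ennreal (K powr (1 / t) * diameter B) *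
            ennreal_powr ((\<integral>\<^sup>+y\<in>B. ennreal_powr (g y) t \<partial>\<mu>) / emeasure \<mu> B) (1 / t)))"

definition balance_condition ::
    "'a::metric_space measure \<Rightarrow> 'a measure \<Rightarrow> real \<Rightarrow> real \<Rightarrow> bool" where
  "balance_condition \<nu> \<mu> t C \<longleftrightarrow>
     (\<forall>x r x' r'. 0 < r \<and> x' \<in> ball x r \<and> 0 < r' \<and> r' \<le> diameter (ball x r) \<longrightarrow>
        (diameter (ball x' r') / diameter (ball x r)) powr t *
          (measure \<nu> (ball x' r') / measure \<nu> (ball x r))
        \<le> C * (measure \<mu> (ball x' r') / measure \<mu> (ball x r)))"

definition independence_property :: "'a::metric_space measure \<Rightarrow> real \<Rightarrow> bool" where
  "independence_property \<mu> t \<longleftrightarrow>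
     (\<forall>q\<ge>t. \<forall>u\<in>Lip. \<forall>g h. minimal_upper_gradient \<mu> q u g \<and> minimal_upper_gradient \<mu> t u h \<longrightarrow>
        (AE x in \<mu>. g x = h x))"

definition A_infinity_weighted ::
    "'a::metric_space measure \<Rightarrow> 'a measure \<Rightarrow> real \<Rightarrow> real \<Rightarrow> bool" where
  "A_infinity_weighted \<nu> \<mu> c \<delta> \<longleftrightarrow>
     (\<forall>x r. \<forall>A\<in>sets borel. 0 < r \<and> A \<subseteq> ball x r \<longrightarrow>
        measure \<nu> A / measure \<nu> (ball x r) \<le> c * (measure \<mu> A / measure \<mu> (ball x r)) powr \<delta>)"

subsection \<open>Sharp maximal function and maximal Poincare inequality\<close>

text \<open>A family of balls is a set of pairs (centre, radius). The supremum over the empty set is the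
  bottom element \<open>0\<close> of \<open>[0, \<infinity>]\<close>.\<close>

definition sharp_maximal ::
    "'a::metric_space measure \<Rightarrow> real \<Rightarrow> ('a \<times> real) set \<Rightarrow> ('a \<Rightarrow> real) \<Rightarrow> 'a \<Rightarrow> ennreal" where
  "sharp_maximal \<nu> q \<B> u x =
     (SUP (z, r) \<in> {(z, r). (z, r) \<in> \<B> \<and> x \<in> ball z r}.
        let B = ball z r in
        ennreal ((1 / diameter B powr q * avg \<nu> B (\<lambda>y. \<bar>u y - avg \<nu> B u\<bar> powr q)) powr (1 / q)))"

definition inner_balls :: "'a::metric_space set \<Rightarrow> ('a \<times> real) set" where
  "inner_balls B\<^sub>0 = {(x, r). 0 < r \<and> ball x (2 * r) \<subseteq> B\<^sub>0}"

definition maximal_poincare_inequality ::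
    "'a::metric_space measure \<Rightarrow> 'a measure \<Rightarrow> real \<Rightarrow> real \<Rightarrow> bool" where
  "maximal_poincare_inequality \<nu> \<mu> q t \<longleftrightarrow>
     (\<exists>C>0. \<forall>x\<^sub>0 r\<^sub>0. \<forall>u\<in>Lip. \<forall>g\<in>upper_gradients \<mu> t u. 0 < r\<^sub>0 \<longrightarrow>
        (\<integral>\<^sup>+x\<in>ball x\<^sub>0 r\<^sub>0. ennreal_powr (sharp_maximal \<nu> q (inner_balls (ball x\<^sub>0 r\<^sub>0)) u x) t \<partial>\<mu>)
        \<le> ennreal C * (\<integral>\<^sup>+x\<in>ball x\<^sub>0 r\<^sub>0. ennreal_powr (g x) t \<partial>\<mu>))"

end

theory Submission
  imports Defs
begin

text \<open>Since the minimal upper gradients exist, the independence property reduces the claim to the minimal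
  \<open>p\<close>-weak upper gradient \<open>g\<close> of \<open>u\<close>. A good-lambda argument in the manner of Keith and Zhong bounds the
  measure of a superlevel set of the sharp maximal function: a ball on which \<open>u\<close> oscillates at
  level \<open>\<lambda>\<close> is essentially filled by the superlevel sets of the levels \<open>2^k \<lambda>\<close> and \<open>8^k \<lambda>\<close>, with weights
  slightly smaller than \<open>2^(k p)\<close> and \<open>8^(k p)\<close>, and by a superlevel set of \<open>g\<close>. Otherwise the mean of \<open>k\<close>
  Lipschitz truncations of \<open>u\<close> at dyadic levels between \<open>4^k \<lambda>\<close> and \<open>8^k \<lambda>\<close> is close to \<open>u\<close> in
  \<open>L\<^sup>p(\<nu>)\<close>, by the balance condition, and its energy is small, because the mean gains \<open>k^(1-p)\<close>; this
  contradicts the Poincare inequality. Multiplication by \<open>\<lambda>^(p-\<epsilon>-1)\<close> and summation over dyadic \<open>\<lambda>\<close>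
  absorb the superlevel sets of the maximal function for all small \<open>\<epsilon> \<ge> 0\<close>.\<close>

section \<open>Covering by balls in doubling spaces\<close>

text \<open>The constants are chosen in the order Q, \<eta>, n, k, \<epsilon>. All truncation levels
  exceed 2^k \<lambda>, so their bad sets lie in one superlevel set of tiny density, and every point
  of the ball is near the good set. Weak type bounds for these bad sets carry a constant free of k.
  The levels double, so at a point the sum of the gradients of the truncations is comparable to the
  largest of them; this is why the mean of k truncations beats that constant once k is large. The
  top level 8^k \<lambda> caps the energy: off its level set the minimal gradient is at most a
  multiple of that level. A second obstacle is localization: truncating on a ball requires its
  forty-fold enlargement inside \<open>B\<^sub>0\<close>, whereas the maximal function only requires
  the double. Chains of small balls compare the two families at the price of a fixed drop of the
  level; Q has to pay for it, and is therefore fixed before k. Absorption is legitimate because u is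
  Lipschitz: no level set beyond its Lipschitz constant is nonempty, so the weighted sum over the
  levels is finite.\<close>

lemma vitali_5r_covering:
  fixes F :: "('a::metric_space \<times> real) set"
  assumes bounds: "\<And>x r. (x, r) \<in> F \<Longrightarrow> 0 < r \<and> r \<le> R"
  obtains G where "G \<subseteq> F" "disjoint_family_on (\<lambda>(x, r). ball x r) G"
    "\<forall>(x, r)\<in>F. \<exists>(y, s)\<in>G. ball x r \<subseteq> ball y (5 * s)"
proof -
  let ?B = "\<lambda>b::'a \<times> real. ball (fst b) (snd b)"
  \<comment> \<open>The invariant is inherited by unions of chains, so Zorn's lemma applies without
    sorting the radii into dyadic classes.\<close>
  define admissible where "admissible G \<longleftrightarrow> G \<subseteq> F \<and> disjoint_family_on ?B G \<and>
     (\<forall>b\<in>F. (\<exists>c\<in>G. ?B b \<inter> ?B c \<noteq> {}) \<longrightarrow>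
            (\<exists>c\<in>G. ?B b \<inter> ?B c \<noteq> {} \<and> snd b \<le> 2 * snd c))" for G
  have "\<exists>G\<in>{G. admissible G}. \<forall>H\<in>{G. admissible G}. G \<subseteq> H \<longrightarrow> H = G"
  proof (rule subset_Zorn')
    fix C assume C: "subset.chain {G. admissible G} C"
    then have adm: "\<And>G. G \<in> C \<Longrightarrow> admissible G"
      and lin: "\<And>G H. G \<in> C \<Longrightarrow> H \<in> C \<Longrightarrow> G \<subseteq> H \<or> H \<subseteq> G"
      by (auto simp: subset.chain_def)
    have "disjoint_family_on ?B (\<Union>C)"
      unfolding disjoint_family_on_def
    proof (intro ballI impI)
      fix b c assume "b \<in> \<Union>C" "c \<in> \<Union>C" "b \<noteq> c"
      then obtain G where "G \<in> C" "b \<in> G" "c \<in> G" using lin by blast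
      then show "?B b \<inter> ?B c = {}"
        using adm \<open>b \<noteq> c\<close> unfolding admissible_def disjoint_family_on_def by blast
    qed
    moreover have "\<Union>C \<subseteq> F" using adm unfolding admissible_def by blast
    moreover have "\<exists>c\<in>\<Union>C. ?B b \<inter> ?B c \<noteq> {} \<and> snd b \<le> 2 * snd c"
      if "b \<in> F" "\<exists>c\<in>\<Union>C. ?B b \<inter> ?B c \<noteq> {}" for b
      using that adm unfolding admissible_def by blast
    ultimately show "\<Union>C \<in> {G. admissible G}" by (auto simp: admissible_def)
  qed
  then obtain G where G: "admissible G" and max: "\<And>H. admissible H \<Longrightarrow> G \<subseteq> H \<Longrightarrow> H = G"
    by blast
  have meets: "\<exists>c\<in>G. ?B b \<inter> ?B c \<noteq> {}" if "b \<in> F" for b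
  proof (rule ccontr)
    assume no: "\<not> ?thesis"
    \<comment> \<open>\<open>F'\<close> collects the balls of \<open>F\<close> that miss all of
      \<open>G\<close>. One whose radius exceeds half of the supremum over \<open>F'\<close> can be
      added to \<open>G\<close>, against maximality.\<close>
    define F' where "F' = {b \<in> F. \<forall>c\<in>G. ?B b \<inter> ?B c = {}}"
    have "b \<in> F'" using no that by (auto simp: F'_def)
    have bdd: "bdd_above (snd ` F')"
      by (rule bdd_aboveI[of _ R]) (use bounds in \<open>auto simp: F'_def\<close>)
    have "0 < snd b" using bounds[of "fst b" "snd b"] that by auto
    moreover have "snd b \<le> Sup (snd ` F')" using bdd \<open>b \<in> F'\<close> by (auto intro: cSup_upper)
    ultimately have "Sup (snd ` F') / 2 < Sup (snd ` F')" by linarith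
    then obtain a where a: "a \<in> F'" "Sup (snd ` F') / 2 < snd a"
      using less_cSup_iff[of "snd ` F'"] bdd \<open>b \<in> F'\<close> by (metis empty_iff image_iff)
    have large: "snd c \<le> 2 * snd a" if "c \<in> F'" for c
    proof -
      have "snd c \<le> Sup (snd ` F')" using bdd that by (auto intro: cSup_upper)
      with a show ?thesis by linarith
    qed
    have "a \<in> F" using a by (auto simp: F'_def)
    have "admissible (insert a G)"
      unfolding admissible_def
    proof (intro conjI ballI impI)
      show "insert a G \<subseteq> F" using G \<open>a \<in> F\<close> by (auto simp: admissible_def)
      show "disjoint_family_on ?B (insert a G)"
        using G a(1) by (auto simp: admissible_def disjoint_family_on_def F'_def)
      fix c assume c: "c \<in> F" "\<exists>d\<in>insert a G. ?B c \<inter> ?B d \<noteq> {}"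
      show "\<exists>d\<in>insert a G. ?B c \<inter> ?B d \<noteq> {} \<and> snd c \<le> 2 * snd d"
      proof (cases "c \<in> F'")
        case True
        then have "?B c \<inter> ?B a \<noteq> {}" using c(2) by (auto simp: F'_def)
        then show ?thesis using large[OF True] by blast
      next
        case False
        then have "\<exists>d\<in>G. ?B c \<inter> ?B d \<noteq> {}" using c(1) by (auto simp: F'_def)
        then show ?thesis using G c(1) unfolding admissible_def by blast
      qed
    qed
    then have "a \<in> G" using max by blast
    then have "?B a \<inter> ?B a = {}" using a(1) by (auto simp: F'_def)
    moreover have "fst a \<in> ?B a" using bounds[of "fst a" "snd a"] \<open>a \<in> F\<close> by auto
    ultimately show False by blast
  qed
  show thesis
  proof
    show "G \<subseteq> F" using G by (simp add: admissible_def)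
    show "disjoint_family_on (\<lambda>(x, r). ball x r) G"
      using G by (simp add: admissible_def case_prod_unfold)
    have "\<exists>(y, s)\<in>G. ball x r \<subseteq> ball y (5 * s)" if "(x, r) \<in> F" for x r
    proof -
      from that obtain c where c: "c \<in> G" "?B (x, r) \<inter> ?B c \<noteq> {}" "r \<le> 2 * snd c"
        using meets G unfolding admissible_def by fastforce
      then obtain z where z: "dist x z < r" "dist (fst c) z < snd c" by auto
      \<comment> \<open>The balls meet and \<open>r\<close> is at most twice the other radius, so a
        point of the first is less than \<open>snd c + 2 * r\<close>, hence less than
        \<open>5 * snd c\<close>, away from the other centre.\<close>
      have "ball x r \<subseteq> ball (fst c) (5 * snd c)"
      proof
        fix y assume "y \<in> ball x r"
        then have "dist x y < r" by simp
        have "dist (fst c) y \<le> dist (fst c) z + dist x z + dist x y"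
          using dist_triangle[of "fst c" y z] dist_triangle[of z y x] by (simp add: dist_commute)
        then show "y \<in> ball (fst c) (5 * snd c)" using z c(3) \<open>dist x y < r\<close> by simp
      qed
      then show ?thesis using c(1) by (metis case_prodI2 fst_conv snd_conv)
    qed
    then show "\<forall>(x, r)\<in>F. \<exists>(y, s)\<in>G. ball x r \<subseteq> ball y (5 * s)" by blast
  qed
qed

section \<open>Doubling measures: completion, comparison of balls, integrated covering lemma\<close>

locale doubling_space =
  fixes M :: "'a::metric_space measure" and D :: real
  assumes complete_borel: "complete_borel_measure M"
    and positive_finite: "positive_finite_on_balls M"
    and D_gt_1: "1 < D"
    and doubling: "0 < r \<Longrightarrow> measure M (ball x (2 * r)) \<le> D * measure M (ball x r)"
begin

lemma borel_completion:
  obtains N where "sets N = sets borel" "space N = UNIV" "M = completion N"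
proof -
  obtain N where N: "sets N = sets borel" "M = completion N"
    using complete_borel unfolding complete_borel_measure_def by blast
  from sets_eq_imp_space_eq[OF N(1)] have "space N = UNIV" by simp
  then show thesis using N that by blast
qed

lemma borel_imp_sets: "S \<in> sets borel \<Longrightarrow> S \<in> sets M"
  by (metis borel_completion sets_completionI_sets)

lemma space_M [simp]: "space M = UNIV"
  by (metis borel_completion space_completion)

lemma sets_ball [measurable]: "ball x r \<in> sets M"
  by (rule borel_imp_sets) simp

lemma borel_imp_measurable: "f \<in> borel_measurable borel \<Longrightarrow> f \<in> borel_measurable M"
  by (rule measurableI) (auto intro!: borel_imp_sets dest: measurable_sets)

text \<open>A function measurable for the completion agrees with a Borel function off a Borel null
  set; the value \<open>top\<close> on that set makes the Borel function dominate everywhere. The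
  pointwise bound matters because a curve may spend positive time in a null set.\<close>

lemma borel_majorant:
  fixes g :: "'a \<Rightarrow> ennreal"
  assumes "g \<in> borel_measurable M"
  obtains g' where "g' \<in> borel_measurable borel" "\<And>x. g x \<le> g' x" "AE x in M. g' x = g x"
proof -
  obtain N where N: "sets N = sets borel" "M = completion N" and [simp]: "space N = UNIV"
    by (rule borel_completion)
  obtain h where h: "h \<in> borel_measurable N" "AE x in N. g x = h x"
    using completion_ex_borel_measurable assms N by blast
  obtain Z where Z: "{x\<in>space N. g x \<noteq> h x} \<subseteq> Z" "Z \<in> null_sets N"
    using h(2) unfolding eventually_ae_filter by blast
  show thesis
  proof
    have "(\<lambda>x. if x \<in> Z then top else h x) \<in> borel_measurable N"
      using h(1) null_setsD2[OF Z(2)] by (intro measurable_If_set) simp_all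
    then show "(\<lambda>x. if x \<in> Z then top else h x) \<in> borel_measurable borel"
      by (simp add: measurable_cong_sets[OF N(1) refl])
    have "g x = h x" if "x \<notin> Z" for x using Z(1) that by auto
    then show "g x \<le> (if x \<in> Z then top else h x)" for x by simp
    have "AE x in N. (if x \<in> Z then top else h x) = g x"
      using Z by (intro AE_I'[of Z]) auto
    then show "AE x in M. (if x \<in> Z then top else h x) = g x"
      unfolding N(2) by (rule AE_completion)
  qed
qed

lemma measure_ball_pos: "0 < r \<Longrightarrow> 0 < measure M (ball x r)"
  and emeasure_ball_finite: "emeasure M (ball x r) < \<infinity>"
  and emeasure_ball: "emeasure M (ball x r) = ennreal (measure M (ball x r))"
proof -
  show fin: "emeasure M (ball x r) < \<infinity>" for r
    using positive_finite unfolding positive_finite_on_balls_def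
    by (cases "0 < r") (auto simp: not_less ball_empty)
  then show eq: "emeasure M (ball x r) = ennreal (measure M (ball x r))" for r
    by (simp add: emeasure_eq_ennreal_measure less_top)
  show "0 < measure M (ball x r)" if "0 < r"
    using positive_finite that eq[of r] unfolding positive_finite_on_balls_def
    by (metis ennreal_less_zero_iff)
qed

lemma measure_ball_pow: "0 < r \<Longrightarrow> measure M (ball x (2 ^ n * r)) \<le> D ^ n * measure M (ball x r)"
proof (induction n)
  case (Suc n)
  have "measure M (ball x (2 * (2 ^ n * r))) \<le> D * measure M (ball x (2 ^ n * r))"
    by (rule doubling) (use Suc in simp)
  also have "\<dots> \<le> D * (D ^ n * measure M (ball x r))"
    using Suc D_gt_1 by (intro mult_left_mono) auto
  finally show ?case by (simp add: mult.assoc)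
qed simp

lemma fmeasurable_ball: "ball x r \<in> fmeasurable M"
  using emeasure_ball_finite by (auto simp: fmeasurable_def)

lemma measure_mono_ball:
  "S \<in> sets M \<Longrightarrow> S \<subseteq> ball x r \<Longrightarrow> measure M S \<le> measure M (ball x r)"
  by (rule measure_mono_fmeasurable[OF _ _ fmeasurable_ball])

text \<open>Most later powers of \<open>D\<close> come from here: the exponent is the number of
  doublings of the small ball that swallow the large one.\<close>

lemma measure_ball_le:
  assumes "0 < s" "dist x y + r \<le> 2 ^ n * s"
  shows "measure M (ball x r) \<le> D ^ n * measure M (ball y s)"
proof -
  have "ball x r \<subseteq> ball y (2 ^ n * s)"
  proof
    fix z assume "z \<in> ball x r"
    then have "dist y z < 2 ^ n * s"
      using assms(2) dist_triangle[of y z x] by (simp add: dist_commute)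
    then show "z \<in> ball y (2 ^ n * s)" by simp
  qed
  then have "measure M (ball x r) \<le> measure M (ball y (2 ^ n * s))"
    by (intro measure_mono_ball) auto
  then show ?thesis using measure_ball_pow[OF assms(1), of y n] by linarith
qed

text \<open>Shrinking the radii to at most 1 keeps the balls with centre near \<open>o'\<close>
  inside one ball of finite measure, which has room for only finitely many disjoint sets of measure
  above a given bound.\<close>

lemma countable_disjoint_balls:
  fixes G :: "('a \<times> real) set"
  assumes disj: "disjoint_family_on (\<lambda>(x, r). ball x r) G" and pos: "\<And>x r. (x, r) \<in> G \<Longrightarrow> 0 < r"
  shows "countable G"
proof -
  obtain o' :: 'a where True by blast
  define B where "B b = ball (fst b) (min (snd b) 1)" for b :: "'a \<times> real"
  define H where "H n m = {b \<in> G. dist o' (fst b) < real n \<and> 1 / real (Suc m) < measure M (B b)}" for n m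
  have "finite (H n m)" for n m
  proof (rule finite_if_finite_subsets_card_bdd[THEN conjunct1])
    fix J assume J: "J \<subseteq> H n m" "finite J"
    have "disjoint_family_on B J"
      unfolding disjoint_family_on_def
    proof (intro ballI impI)
      fix b c assume "b \<in> J" "c \<in> J" "b \<noteq> c"
      then have "ball (fst b) (snd b) \<inter> ball (fst c) (snd c) = {}"
        using disj J(1) by (auto simp: disjoint_family_on_def H_def case_prod_unfold)
      moreover have "B b \<subseteq> ball (fst b) (snd b)" "B c \<subseteq> ball (fst c) (snd c)"
        unfolding B_def by (simp_all add: subset_ball)
      ultimately show "B b \<inter> B c = {}" by blast
    qed
    have sub: "(\<Union>b\<in>J. B b) \<subseteq> ball o' (real n + 1)"
    proof (intro UN_least subsetI)
      fix b x assume "b \<in> J" "x \<in> B b"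
      then have "dist o' (fst b) < real n" "dist (fst b) x < 1" using J(1) by (auto simp: B_def H_def)
      then show "x \<in> ball o' (real n + 1)" using dist_triangle[of o' x "fst b"] by simp
    qed
    have "real (card J) * (1 / real (Suc m)) \<le> (\<Sum>b\<in>J. measure M (B b))"
      using J(1) by (intro sum_bounded_below) (auto simp: H_def less_imp_le)
    also have "\<dots> = measure M (\<Union>b\<in>J. B b)"
    proof (rule measure_finite_Union[symmetric, OF J(2) _ \<open>disjoint_family_on B J\<close>])
      show "emeasure M (B b) \<noteq> \<infinity>" for b
        using emeasure_ball_finite less_irrefl unfolding B_def by metis
    qed (auto simp: B_def)
    also have "\<dots> \<le> measure M (ball o' (real n + 1))"
      using sub J(2) by (intro measure_mono_ball) (auto simp: B_def)
    finally have "real (card J) \<le> real (Suc m) * measure M (ball o' (real n + 1))"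
      by (simp add: field_simps)
    then show "card J \<le> nat \<lfloor>real (Suc m) * measure M (ball o' (real n + 1))\<rfloor>"
      by (rule le_nat_floor)
  qed
  then have "countable (\<Union>n m. H n m)"
    by (intro countable_UN countableI_type) (simp add: countable_finite)
  moreover have "G = (\<Union>n m. H n m)"
  proof (intro equalityI subsetI)
    fix b assume b: "b \<in> G"
    then have "0 < measure M (B b)"
      unfolding B_def using pos[of "fst b" "snd b"] by (intro measure_ball_pos) auto
    then obtain m where "1 / real (Suc m) < measure M (B b)" using nat_approx_posE by blast
    moreover obtain n where "dist o' (fst b) < real n" using reals_Archimedean2 by blast
    ultimately show "b \<in> (\<Union>n m. H n m)" using b by (auto simp: H_def)
  qed (auto simp: H_def)
  ultimately show ?thesis by argo
qed

text \<open>Turns an estimate on single balls into one on their union. Two measures are allowed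
  because errors with respect to \<open>\<nu>\<close> are later charged to \<open>\<mu>\<close>.
  Only the left integral sees the enlarged ball, so the disjoint selected balls can be added up on
  the right.\<close>

lemma vitali_nn_integral:
  fixes F :: "('a \<times> real) set"
  assumes f: "f \<in> borel_measurable M1" and h: "h \<in> borel_measurable M2"
    and sets: "sets borel \<subseteq> sets M1" "sets borel \<subseteq> sets M2"
    and F: "\<And>x r. (x, r) \<in> F \<Longrightarrow> 0 < r \<and> r \<le> R"
    and le: "\<And>x r. (x, r) \<in> F \<Longrightarrow>
       (\<integral>\<^sup>+y\<in>ball x (5 * r). f y \<partial>M1) \<le> (\<integral>\<^sup>+y\<in>ball x r. h y \<partial>M2)"
  shows "(\<integral>\<^sup>+y\<in>(\<Union>(x, r)\<in>F. ball x r). f y \<partial>M1) \<le> (\<integral>\<^sup>+y\<in>(\<Union>(x, r)\<in>F. ball x r). h y \<partial>M2)"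
proof -
  obtain G where G: "G \<subseteq> F" "disjoint_family_on (\<lambda>(x, r). ball x r) G"
    and cov: "\<forall>(x, r)\<in>F. \<exists>(y, s)\<in>G. ball x r \<subseteq> ball y (5 * s)"
    using F by (rule vitali_5r_covering[of F R])
  have "countable G" by (rule countable_disjoint_balls[OF G(2)]) (use G(1) F in auto)
  define e where "e = from_nat_into G"
  define I where "I = to_nat_on G ` G"
  have e_to: "e (to_nat_on G b) = b" if "b \<in> G" for b
    unfolding e_def using \<open>countable G\<close> that by (rule from_nat_into_to_nat_on)
  have e: "e i \<in> G" if "i \<in> I" for i
    using that e_to unfolding I_def by force
  have inj: "i = j" if "i \<in> I" "j \<in> I" "e i = e j" for i j
    using that e_to unfolding I_def by force
  have surj: "\<exists>i\<in>I. e i = b" if "b \<in> G" for b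
    using that e_to unfolding I_def by blast
  \<comment> \<open>Indices outside \<open>I\<close> get the empty set, so that a finite family also
    fits the sums over all natural numbers.\<close>
  define A where "A i = (if i \<in> I then ball (fst (e i)) (5 * snd (e i)) else {})" for i
  define B where "B i = (if i \<in> I then ball (fst (e i)) (snd (e i)) else {})" for i
  have meas: "A i \<in> sets M1" "B i \<in> sets M2" for i
    using sets by (auto simp: A_def B_def)
  have "(\<integral>\<^sup>+y\<in>(\<Union>(x, r)\<in>F. ball x r). f y \<partial>M1) \<le> (\<integral>\<^sup>+y\<in>(\<Union>i. A i). f y \<partial>M1)"
  proof (rule nn_set_integral_set_mono, rule subsetI)
    fix y assume "y \<in> (\<Union>(x, r)\<in>F. ball x r)"
    then obtain x r where "(x, r) \<in> F" "y \<in> ball x r" by auto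
    with cov obtain z s where zs: "(z, s) \<in> G" "y \<in> ball z (5 * s)" by blast
    from surj[OF zs(1)] obtain i where "i \<in> I" "e i = (z, s)" by blast
    then show "y \<in> (\<Union>i. A i)" using zs(2) by (intro UN_I[of i]) (auto simp: A_def)
  qed
  also have "\<dots> = emeasure (density M1 f) (\<Union>i. A i)"
    using f meas by (subst emeasure_density) auto
  also have "\<dots> \<le> (\<Sum>i. emeasure (density M1 f) (A i))"
    using meas by (intro emeasure_subadditive_countably) auto
  also have "\<dots> \<le> (\<Sum>i. emeasure (density M2 h) (B i))"
  proof (intro suminf_le)
    fix i
    show "emeasure (density M1 f) (A i) \<le> emeasure (density M2 h) (B i)"
    proof (cases "i \<in> I")
      case True
      then have "(fst (e i), snd (e i)) \<in> F" using e G(1) by auto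
      from le[OF this] True show ?thesis
        using f h meas[of i] by (simp add: emeasure_density A_def B_def)
    qed (simp add: A_def)
  qed auto
  also have "\<dots> = emeasure (density M2 h) (\<Union>i. B i)"
  proof (rule suminf_emeasure)
    show "disjoint_family B"
      unfolding disjoint_family_on_def
    proof (intro ballI impI)
      fix i j :: nat assume "i \<noteq> j"
      show "B i \<inter> B j = {}"
      proof (cases "i \<in> I \<and> j \<in> I")
        case True
        then have "e i \<noteq> e j" using inj \<open>i \<noteq> j\<close> by blast
        then show ?thesis
          using True e G(2) unfolding disjoint_family_on_def B_def by (auto simp: case_prod_unfold)
      qed (auto simp: B_def)
    qed
  qed (use meas in auto)
  also have "\<dots> = (\<integral>\<^sup>+y\<in>(\<Union>i. B i). h y \<partial>M2)"
    using h meas by (subst emeasure_density) auto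
  also have "\<dots> \<le> (\<integral>\<^sup>+y\<in>(\<Union>(x, r)\<in>F. ball x r). h y \<partial>M2)"
  proof (rule nn_set_integral_set_mono, rule subsetI)
    fix y assume "y \<in> (\<Union>i. B i)"
    then obtain i where "i \<in> I" "y \<in> ball (fst (e i)) (snd (e i))" by (auto simp: B_def split: if_splits)
    then show "y \<in> (\<Union>(x, r)\<in>F. ball x r)" using e G(1) by (intro UN_I[of "e i"]) (auto simp: case_prod_unfold)
  qed
  finally show ?thesis .
qed

text \<open>Separability of a doubling space in covering form. The radii are cut at 1 and divided by
  5 in advance, so the enlarged balls of the covering lemma still lie in the prescribed
  ones.\<close>

lemma lindelof:
  fixes r :: "'a \<Rightarrow> real"
  assumes "\<And>x. 0 < r x"
  obtains C where "countable C" "(\<Union>x\<in>C. ball x (r x)) = UNIV"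
proof -
  define F where "F = range (\<lambda>x. (x, min 1 (r x) / 5))"
  have F: "0 < s \<and> s \<le> 1" if "(x, s) \<in> F" for x s using that assms by (auto simp: F_def)
  obtain G where G: "G \<subseteq> F" "disjoint_family_on (\<lambda>(x, r). ball x r) G"
    and cov: "\<forall>(x, r)\<in>F. \<exists>(y, s)\<in>G. ball x r \<subseteq> ball y (5 * s)"
    using F by (rule vitali_5r_covering[of F 1])
  have "countable G" by (rule countable_disjoint_balls[OF G(2)]) (use G(1) F in auto)
  show thesis
  proof
    show "countable (fst ` G)" using \<open>countable G\<close> by simp
    have "x \<in> (\<Union>y\<in>fst ` G. ball y (r y))" for x
    proof -
      have "(x, min 1 (r x) / 5) \<in> F" by (auto simp: F_def)
      with cov obtain y s where ys: "(y, s) \<in> G" "ball x (min 1 (r x) / 5) \<subseteq> ball y (5 * s)"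
        by blast
      have "x \<in> ball x (min 1 (r x) / 5)" using assms[of x] by simp
      then have "x \<in> ball y (5 * s)" using ys(2) by blast
      moreover have "5 * s \<le> r y" using ys(1) G(1) by (auto simp: F_def)
      ultimately show ?thesis using ys(1) by (force intro!: rev_bexI[OF ys(1)])
    qed
    then show "(\<Union>x\<in>fst ` G. ball x (r x)) = UNIV" by blast
  qed
qed

lemma sigma_finite: "sigma_finite_measure M"
proof
  obtain o' :: 'a where True by blast
  show "\<exists>A. countable A \<and> A \<subseteq> sets M \<and> \<Union>A = space M \<and> (\<forall>a\<in>A. emeasure M a \<noteq> \<infinity>)"
  proof (intro exI[of _ "range (\<lambda>n::nat. ball o' (real n))"] conjI ballI)
    show "\<Union>(range (\<lambda>n::nat. ball o' (real n))) = space M"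
      using reals_Archimedean2 by auto
  qed (use emeasure_ball_finite in \<open>auto simp: less_top\<close>)
qed

end

section \<open>Curves parametrized by arc length\<close>

text \<open>A real-valued, recursive form of the sum in \<open>curve_length\<close>, made for
  induction on the list of points.\<close>

fun polygon_length :: "(real \<Rightarrow> 'a::metric_space) \<Rightarrow> real list \<Rightarrow> real" where
  "polygon_length \<gamma> (s # t # ts) = dist (\<gamma> s) (\<gamma> t) + polygon_length \<gamma> (t # ts)"
| "polygon_length \<gamma> _ = 0"

lemma polygon_length_nonneg: "0 \<le> polygon_length \<gamma> ts"
  by (induction \<gamma> ts rule: polygon_length.induct) auto

lemma sum_dist_eq_polygon_length:
  "(\<Sum>i<length ts - 1. ennreal (dist (\<gamma> (ts ! i)) (\<gamma> (ts ! Suc i)))) = ennreal (polygon_length \<gamma> ts)"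
proof (induction \<gamma> ts rule: polygon_length.induct)
  case (1 \<gamma> s t ts)
  have "(\<Sum>i<length (s # t # ts) - 1. ennreal (dist (\<gamma> ((s # t # ts) ! i)) (\<gamma> ((s # t # ts) ! Suc i)))) =
      (\<Sum>i<Suc (length ts). ennreal (dist (\<gamma> ((s # t # ts) ! i)) (\<gamma> ((s # t # ts) ! Suc i))))"
    by simp
  also have "\<dots> = ennreal (dist (\<gamma> s) (\<gamma> t)) +
      (\<Sum>i<length ts. ennreal (dist (\<gamma> ((t # ts) ! i)) (\<gamma> ((t # ts) ! Suc i))))"
    unfolding sum.lessThan_Suc_shift by simp
  also have "\<dots> = ennreal (dist (\<gamma> s) (\<gamma> t)) + ennreal (polygon_length \<gamma> (t # ts))"
    using 1 by simp
  also have "\<dots> = ennreal (polygon_length \<gamma> (s # t # ts))"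
    by (simp add: ennreal_plus polygon_length_nonneg)
  finally show ?case .
qed auto

lemma polygon_length_append:
  "polygon_length \<gamma> ss + polygon_length \<gamma> ts \<le> polygon_length \<gamma> (ss @ ts)"
proof (induction \<gamma> ss rule: polygon_length.induct)
  case ("2_2" \<gamma> s)
  then show ?case by (cases ts) auto
qed auto

lemma polygon_length_split:
  "polygon_length \<gamma> (ss @ ts) \<le> polygon_length \<gamma> (ss @ [a]) + polygon_length \<gamma> (a # ts)"
proof (induction \<gamma> ss rule: polygon_length.induct)
  case ("2_1" \<gamma>)
  then show ?case by (cases ts) auto
next
  case ("2_2" \<gamma> s)
  then show ?case by (cases ts) (auto simp: dist_triangle polygon_length_nonneg)
qed auto

lemma polygon_length_map:
  "polygon_length (\<lambda>s. \<gamma> (a + s)) ts = polygon_length \<gamma> (map ((+) a) ts)"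
  by (induction "\<lambda>s. \<gamma> (a + s)" ts rule: polygon_length.induct) auto

lemma curve_length_eq_SUP:
  "curve_length \<gamma> a b = (SUP ts \<in> {ts. sorted ts \<and> set ts \<subseteq> {a..b}}. ennreal (polygon_length \<gamma> ts))"
  unfolding curve_length_def sum_dist_eq_polygon_length ..

lemma polygon_length_le_curve_length:
  "sorted ts \<Longrightarrow> set ts \<subseteq> {a..b} \<Longrightarrow> ennreal (polygon_length \<gamma> ts) \<le> curve_length \<gamma> a b"
  unfolding curve_length_eq_SUP by (intro SUP_upper) auto

lemma curve_length_shift: "curve_length (\<lambda>s. \<gamma> (a + s)) 0 s = curve_length \<gamma> a (a + s)"
proof (rule antisym)
  show "curve_length (\<lambda>s. \<gamma> (a + s)) 0 s \<le> curve_length \<gamma> a (a + s)"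
    unfolding curve_length_eq_SUP[of "\<lambda>s. \<gamma> (a + s)"] polygon_length_map
  proof (intro SUP_least polygon_length_le_curve_length)
    fix ts assume "ts \<in> {ts. sorted ts \<and> set ts \<subseteq> {0..s}}"
    then show "sorted (map ((+) a) ts)" "set (map ((+) a) ts) \<subseteq> {a..a + s}"
      by (auto simp: sorted_map)
  qed
  show "curve_length \<gamma> a (a + s) \<le> curve_length (\<lambda>s. \<gamma> (a + s)) 0 s"
    unfolding curve_length_eq_SUP[of \<gamma>]
  proof (intro SUP_least)
    fix ts assume ts: "ts \<in> {ts. sorted ts \<and> set ts \<subseteq> {a..a + s}}"
    have "ennreal (polygon_length (\<lambda>s. \<gamma> (a + s)) (map (\<lambda>t. t - a) ts)) \<le> curve_length (\<lambda>s. \<gamma> (a + s)) 0 s"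
    proof (rule polygon_length_le_curve_length)
      show "sorted (map (\<lambda>t. t - a) ts)" using ts by (simp add: sorted_map)
      show "set (map (\<lambda>t. t - a) ts) \<subseteq> {0..s}" using ts by force
    qed
    then show "ennreal (polygon_length \<gamma> ts) \<le> curve_length (\<lambda>s. \<gamma> (a + s)) 0 s"
      unfolding polygon_length_map by (simp add: comp_def)
  qed
qed

text \<open>Length is additive: concatenating partitions of \<open>{0..a}\<close> and
  \<open>{a..b}\<close> gives one inequality, cutting a partition of \<open>{0..b}\<close> at
  \<open>a\<close> the other.\<close>

lemma arc_length_curve_sub_length:
  assumes "arc_length_curve l \<gamma>" "0 \<le> a" "a \<le> b" "b \<le> l"
  shows "curve_length \<gamma> a b = ennreal (b - a)"
proof (rule antisym)
  have len: "curve_length \<gamma> 0 s = ennreal s" if "0 \<le> s" "s \<le> l" for s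
    using assms(1) that by (auto simp: arc_length_curve_def)
  show "curve_length \<gamma> a b \<le> ennreal (b - a)"
    unfolding curve_length_eq_SUP
  proof (rule SUP_least)
    fix ss assume ss: "ss \<in> {ts. sorted ts \<and> set ts \<subseteq> {a..b}}"
    have "curve_length \<gamma> 0 a \<le> ennreal (b - polygon_length \<gamma> ss)"
      unfolding curve_length_eq_SUP
    proof (rule SUP_least)
      fix ts assume ts: "ts \<in> {ts. sorted ts \<and> set ts \<subseteq> {0..a}}"
      have "sorted (ts @ ss)" "set (ts @ ss) \<subseteq> {0..b}"
        using ss ts assms(2,3) by (auto simp: sorted_append subset_iff intro: order_trans)
      then have "ennreal (polygon_length \<gamma> (ts @ ss)) \<le> ennreal b"
        using polygon_length_le_curve_length[of "ts @ ss" 0 b \<gamma>] len[of b] assms by simp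
      then have "polygon_length \<gamma> (ts @ ss) \<le> b" using assms by simp
      then show "ennreal (polygon_length \<gamma> ts) \<le> ennreal (b - polygon_length \<gamma> ss)"
        using polygon_length_append[of \<gamma> ts ss] by (intro ennreal_leI) linarith
    qed
    then have "ennreal a \<le> ennreal (b - polygon_length \<gamma> ss)" using len[of a] assms by simp
    \<comment> \<open>\<open>ennreal\<close> sends negative numbers to 0, so the difference has to
      be known non-negative before the embedding can be cancelled.\<close>
    moreover have "polygon_length \<gamma> ss \<le> b"
    proof -
      have "sorted ss" "set ss \<subseteq> {0..b}" using ss assms(2) by auto
      then have "ennreal (polygon_length \<gamma> ss) \<le> ennreal b"
        using polygon_length_le_curve_length[of ss 0 b \<gamma>] len[of b] assms by simp
      then show ?thesis using assms by simp
    qed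
    ultimately have "a \<le> b - polygon_length \<gamma> ss" by simp
    then show "ennreal (polygon_length \<gamma> ss) \<le> ennreal (b - a)" by (intro ennreal_leI) linarith
  qed
  have "curve_length \<gamma> 0 b \<le> ennreal a + curve_length \<gamma> a b"
    unfolding curve_length_eq_SUP[of \<gamma> 0]
  proof (rule SUP_least)
    fix ts assume ts: "ts \<in> {ts. sorted ts \<and> set ts \<subseteq> {0..b}}"
    define ss where "ss = takeWhile (\<lambda>t. t \<le> a) ts"
    define us where "us = dropWhile (\<lambda>t. t \<le> a) ts"
    have split: "ts = ss @ us" by (simp add: ss_def us_def)
    then have sorted: "sorted ss" "sorted us" using ts by (auto simp: sorted_append)
    have ss_le: "\<forall>t\<in>set ss. t \<le> a" unfolding ss_def by (auto dest: set_takeWhileD)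
    have us_ge: "\<forall>t\<in>set us. a \<le> t"
    proof (cases us)
      case (Cons t us')
      then have "\<not> t \<le> a" unfolding us_def by (metis hd_dropWhile list.distinct(1) list.sel(1))
      then show ?thesis using sorted(2) Cons by auto
    qed simp
    have "set ss \<subseteq> {0..b}" "set us \<subseteq> {0..b}" using ts split by auto
    then have "ennreal (polygon_length \<gamma> (ss @ [a])) \<le> curve_length \<gamma> 0 a"
      using sorted ss_le assms(2) by (intro polygon_length_le_curve_length) (auto simp: sorted_append)
    moreover have "ennreal (polygon_length \<gamma> (a # us)) \<le> curve_length \<gamma> a b"
      using sorted us_ge assms(3) \<open>set us \<subseteq> {0..b}\<close>
      by (intro polygon_length_le_curve_length) auto
    moreover have "ennreal (polygon_length \<gamma> ts) \<le>
        ennreal (polygon_length \<gamma> (ss @ [a])) + ennreal (polygon_length \<gamma> (a # us))"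
      unfolding split using polygon_length_split[of \<gamma> ss us a]
      by (simp add: ennreal_leI polygon_length_nonneg flip: ennreal_plus)
    ultimately show "ennreal (polygon_length \<gamma> ts) \<le> ennreal a + curve_length \<gamma> a b"
      using len[OF assms(2)] assms(3,4) by (metis add_mono order_trans)
  qed
  then have "ennreal (a + (b - a)) \<le> ennreal a + curve_length \<gamma> a b" using len[of b] assms by simp
  then have "ennreal a + ennreal (b - a) \<le> ennreal a + curve_length \<gamma> a b"
    using assms by (subst (asm) ennreal_plus) auto
  then show "ennreal (b - a) \<le> curve_length \<gamma> a b"
    using ennreal_add_left_cancel_le[of "ennreal a"] by simp
qed

lemma arc_length_curve_dist:
  assumes "arc_length_curve l \<gamma>" "0 \<le> a" "a \<le> b" "b \<le> l"
  shows "dist (\<gamma> a) (\<gamma> b) \<le> b - a"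
  using polygon_length_le_curve_length[of "[a, b]" a b \<gamma>] arc_length_curve_sub_length[OF assms] assms
  by simp

lemma arc_length_curve_sub:
  assumes "arc_length_curve l \<gamma>" "0 \<le> a" "a < b" "b \<le> l"
  shows "arc_length_curve (b - a) (\<lambda>s. \<gamma> (a + s))"
  unfolding arc_length_curve_def
proof (intro conjI ballI)
  have "continuous_on {0..l} \<gamma>" using assms(1) by (simp add: arc_length_curve_def)
  then show "continuous_on {0..b - a} (\<lambda>s. \<gamma> (a + s))"
    by (rule continuous_on_compose2) (use assms in \<open>auto intro!: continuous_intros\<close>)
  fix s assume "s \<in> {0..b - a}"
  then show "curve_length (\<lambda>s. \<gamma> (a + s)) 0 s = ennreal s"
    unfolding curve_length_shift using assms by (subst arc_length_curve_sub_length[OF assms(1)]) auto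
qed (use assms in simp)

section \<open>Powers with values in [0, \<infinity>]\<close>

lemma ennreal_powr_mono: "x \<le> y \<Longrightarrow> 0 \<le> t \<Longrightarrow> ennreal_powr x t \<le> ennreal_powr y t"
  unfolding ennreal_powr_def
  by (auto intro!: ennreal_leI powr_mono2 enn2real_mono simp: less_top top_unique)

lemma ennreal_powr_ennreal [simp]: "0 \<le> x \<Longrightarrow> ennreal_powr (ennreal x) t = ennreal (x powr t)"
  by (simp add: ennreal_powr_def)

lemma ennreal_powr_top [simp]: "ennreal_powr top t = top"
  by (simp add: ennreal_powr_def)

lemma measurable_ennreal_powr [measurable]:
  assumes [measurable]: "f \<in> borel_measurable M"
  shows "(\<lambda>x. ennreal_powr (f x) t) \<in> borel_measurable M"
  unfolding ennreal_powr_def by measurable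

lemma ennreal_powr_cmult:
  "0 < c \<Longrightarrow> ennreal_powr (ennreal c * x) t = ennreal (c powr t) * ennreal_powr x t"
  by (cases x) (auto simp: powr_mult ennreal_mult_top simp flip: ennreal_mult)

lemma ennreal_powr_inverse: "0 < t \<Longrightarrow> ennreal_powr (ennreal_powr x t) (1 / t) = x"
  by (cases x) (auto simp: powr_powr)

text \<open>Each term is at most the power \<open>1 / t\<close> of the sum, hence so is the
  supremum. It allows countably many densities to be combined by a supremum, without Minkowski's
  inequality.\<close>

lemma ennreal_powr_SUP_le_suminf:
  fixes f :: "nat \<Rightarrow> ennreal"
  assumes "0 < t"
  shows "ennreal_powr (SUP n. f n) t \<le> (\<Sum>n. ennreal_powr (f n) t)"
proof -
  let ?S = "\<Sum>n. ennreal_powr (f n) t"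
  have "f n \<le> ennreal_powr ?S (1 / t)" for n
  proof -
    have "ennreal_powr (f n) t \<le> ?S"
      using sum_le_suminf[of "\<lambda>n. ennreal_powr (f n) t" "{n}"] by simp
    then have "ennreal_powr (ennreal_powr (f n) t) (1 / t) \<le> ennreal_powr ?S (1 / t)"
      using assms by (intro ennreal_powr_mono) auto
    then show ?thesis using assms by (simp add: ennreal_powr_inverse)
  qed
  then have "ennreal_powr (SUP n. f n) t \<le> ennreal_powr (ennreal_powr ?S (1 / t)) t"
    using assms by (intro ennreal_powr_mono SUP_least) auto
  also have "\<dots> = ?S" using ennreal_powr_inverse[of "1 / t" ?S] assms by simp
  finally show ?thesis .
qed

lemma ennreal_powr_add_le:
  assumes "0 < t"
  shows "ennreal_powr (x + y) t \<le> ennreal (2 powr t) * (ennreal_powr x t + ennreal_powr y t)"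
proof -
  have "x + y \<le> ennreal 2 * max x y"
    by (metis add_mono ennreal_numeral max.cobounded1 max.cobounded2 mult_2)
  then have "ennreal_powr (x + y) t \<le> ennreal_powr (ennreal 2 * max x y) t"
    using assms by (intro ennreal_powr_mono) auto
  also have "\<dots> = ennreal (2 powr t) * ennreal_powr (max x y) t"
    by (rule ennreal_powr_cmult) simp
  also have "\<dots> \<le> ennreal (2 powr t) * (ennreal_powr x t + ennreal_powr y t)"
    by (intro mult_left_mono) (auto simp: max_def)
  finally show ?thesis .
qed

section \<open>Gluing two upper gradient inequalities along an interval\<close>

lemma borel_measurable_times_interval:
  fixes G :: "real \<Rightarrow> ennreal"
  assumes "G \<in> borel_measurable lebesgue"
  shows "(\<lambda>s. G s * indicator {a..b} s) \<in> borel_measurable lebesgue"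
  using assms by (intro borel_measurable_times_ennreal borel_measurable_indicator) auto

lemma lebesgue_interval_nn_integral_split:
  fixes G :: "real \<Rightarrow> ennreal"
  assumes "G \<in> borel_measurable lebesgue" "a \<le> b" "b \<le> c"
  shows "(\<integral>\<^sup>+s\<in>{a..c}. G s \<partial>lebesgue) = (\<integral>\<^sup>+s\<in>{a..b}. G s \<partial>lebesgue) + (\<integral>\<^sup>+s\<in>{b..c}. G s \<partial>lebesgue)"
proof -
  have ne: "AE s in lebesgue. s \<noteq> b" by (rule AE_I'[of "{b}"]) auto
  have "(\<integral>\<^sup>+s\<in>{a..c}. G s \<partial>lebesgue) = (\<integral>\<^sup>+s. G s * indicator {a..b} s + G s * indicator {b..c} s \<partial>lebesgue)"
    by (rule nn_integral_cong_AE) (use ne assms in \<open>auto split: split_indicator elim!: eventually_mono\<close>)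
  also have "\<dots> = (\<integral>\<^sup>+s\<in>{a..b}. G s \<partial>lebesgue) + (\<integral>\<^sup>+s\<in>{b..c}. G s \<partial>lebesgue)"
    using assms(1) by (intro nn_integral_add borel_measurable_times_interval)
  finally show ?thesis .
qed

text \<open>Cut \<open>{0..l}\<close> into pieces of length at most \<open>h\<close>; on a piece meeting \<open>K\<close>, use \<open>G1\<close> between the
  first and the last point of \<open>K\<close> in it, where \<open>f\<close> and \<open>v\<close> agree.\<close>

lemma gluing_compact:
  fixes G1 G2 :: "real \<Rightarrow> ennreal" and f v :: "real \<Rightarrow> real"
  assumes G: "G1 \<in> borel_measurable lebesgue" "G2 \<in> borel_measurable lebesgue"
    and fin: "(\<integral>\<^sup>+s\<in>{0..l}. G1 s \<partial>lebesgue) < \<infinity>" "(\<integral>\<^sup>+s\<in>{0..l}. G2 s \<partial>lebesgue) < \<infinity>"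
    and K: "compact K" and eq: "\<And>s. s \<in> K \<Longrightarrow> f s = v s" and l: "0 < l"
    and f: "\<And>a b. 0 \<le> a \<Longrightarrow> a \<le> b \<Longrightarrow> b \<le> l \<Longrightarrow> ennreal \<bar>f b - f a\<bar> \<le> (\<integral>\<^sup>+s\<in>{a..b}. G1 s \<partial>lebesgue)"
    and v: "\<And>a b. 0 \<le> a \<Longrightarrow> a \<le> b \<Longrightarrow> b \<le> l \<Longrightarrow> ennreal \<bar>v b - v a\<bar> \<le> (\<integral>\<^sup>+s\<in>{a..b}. G2 s \<partial>lebesgue)"
  shows "ennreal \<bar>v l - v 0\<bar> \<le> (\<integral>\<^sup>+s\<in>{0..l}. G1 s * indicator K s + G2 s * indicator (- K) s \<partial>lebesgue)"
proof (cases "K = {}")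
  case True
  then show ?thesis using v[of 0 l] l by simp
next
  case False
  have "closed K" using K by (rule compact_imp_closed)
  define N where "N h = {s. infdist s K \<le> h}" for h
  have N_borel: "N h \<in> sets borel" for h
    unfolding N_def by (intro borel_closed closed_Collect_le continuous_intros)
  then have N_meas [measurable]: "N h \<in> sets lebesgue" for h by simp
  have K_meas [measurable]: "K \<in> sets lebesgue" using \<open>closed K\<close> by simp
  \<comment> \<open>A piece of length at most \<open>h\<close> that meets \<open>K\<close> lies in
    \<open>N h\<close>, so \<open>G1\<close> may be charged to \<open>N h\<close> instead of
    \<open>K\<close>; the closed set \<open>K\<close> is recovered as \<open>h\<close> tends to
    0.\<close>
  define H where "H h s = G1 s * indicator (N h) s + G2 s * indicator (- K) s" for h s
  have H_meas [measurable]: "H h \<in> borel_measurable lebesgue" for h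
    unfolding H_def using G Compl_in_sets_lebesgue[THEN iffD2, OF K_meas] by (intro borel_measurable_add borel_measurable_times_ennreal borel_measurable_indicator) auto
  have piece: "ennreal \<bar>v b - v a\<bar> \<le> (\<integral>\<^sup>+s\<in>{a..b}. H h s \<partial>lebesgue)"
    if ab: "0 \<le> a" "a \<le> b" "b \<le> l" "b - a \<le> h" for a b h
  proof (cases "K \<inter> {a..b} = {}")
    case True
    then have "(\<integral>\<^sup>+s\<in>{a..b}. G2 s \<partial>lebesgue) \<le> (\<integral>\<^sup>+s\<in>{a..b}. H h s \<partial>lebesgue)"
      by (intro nn_integral_mono) (auto simp: H_def split: split_indicator)
    with v[OF ab(1-3)] show ?thesis by (rule order_trans)
  next
    case False
    have comp: "compact (K \<inter> {a..b})" using K by (intro compact_Int_closed) auto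
    obtain a' where a': "a' \<in> K \<inter> {a..b}" "\<And>s. s \<in> K \<inter> {a..b} \<Longrightarrow> a' \<le> s"
      using compact_attains_inf[OF comp False] by blast
    obtain b' where b': "b' \<in> K \<inter> {a..b}" "\<And>s. s \<in> K \<inter> {a..b} \<Longrightarrow> s \<le> b'"
      using compact_attains_sup[OF comp False] by blast
    have "a' \<le> b'" using a'(2) b'(1) by blast
    \<comment> \<open>The end points \<open>a'\<close> and \<open>b'\<close> belong to
      \<open>K\<close>, but as single points they do not affect the integrals of
      \<open>G2\<close>.\<close>
    have ne: "AE s in lebesgue. s \<noteq> a' \<and> s \<noteq> b'" by (rule AE_I'[of "{a', b'}"]) auto
    have "\<bar>v b - v a\<bar> \<le> \<bar>v a' - v a\<bar> + \<bar>f b' - f a'\<bar> + \<bar>v b - v b'\<bar>"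
      using eq a'(1) b'(1) by auto
    then have "ennreal \<bar>v b - v a\<bar> \<le> ennreal \<bar>v a' - v a\<bar> + ennreal \<bar>f b' - f a'\<bar> + ennreal \<bar>v b - v b'\<bar>"
      by (simp flip: ennreal_plus add: ennreal_leI)
    also have "\<dots> \<le> (\<integral>\<^sup>+s\<in>{a..a'}. G2 s \<partial>lebesgue) + (\<integral>\<^sup>+s\<in>{a'..b'}. G1 s \<partial>lebesgue) + (\<integral>\<^sup>+s\<in>{b'..b}. G2 s \<partial>lebesgue)"
      using a'(1) b'(1) ab \<open>a' \<le> b'\<close> by (intro add_mono f v) auto
    also have "\<dots> \<le> (\<integral>\<^sup>+s\<in>{a..a'}. H h s \<partial>lebesgue) + (\<integral>\<^sup>+s\<in>{a'..b'}. H h s \<partial>lebesgue) + (\<integral>\<^sup>+s\<in>{b'..b}. H h s \<partial>lebesgue)"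
    proof (intro add_mono)
      show "(\<integral>\<^sup>+s\<in>{a..a'}. G2 s \<partial>lebesgue) \<le> (\<integral>\<^sup>+s\<in>{a..a'}. H h s \<partial>lebesgue)"
      proof (rule nn_integral_mono_AE, rule eventually_mono[OF ne])
        fix s assume s: "s \<noteq> a' \<and> s \<noteq> b'"
        have "s \<notin> K" if "s \<in> {a..a'}" using that s a'(2)[of s] a'(1) by force
        then show "G2 s * indicator {a..a'} s \<le> H h s * indicator {a..a'} s"
          by (auto simp: H_def split: split_indicator)
      qed
      show "(\<integral>\<^sup>+s\<in>{b'..b}. G2 s \<partial>lebesgue) \<le> (\<integral>\<^sup>+s\<in>{b'..b}. H h s \<partial>lebesgue)"
      proof (rule nn_integral_mono_AE, rule eventually_mono[OF ne])
        fix s assume s: "s \<noteq> a' \<and> s \<noteq> b'"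
        have "s \<notin> K" if "s \<in> {b'..b}" using that s b'(2)[of s] b'(1) by force
        then show "G2 s * indicator {b'..b} s \<le> H h s * indicator {b'..b} s"
          by (auto simp: H_def split: split_indicator)
      qed
      show "(\<integral>\<^sup>+s\<in>{a'..b'}. G1 s \<partial>lebesgue) \<le> (\<integral>\<^sup>+s\<in>{a'..b'}. H h s \<partial>lebesgue)"
      proof (rule nn_integral_mono)
        fix s
        have "s \<in> N h" if "s \<in> {a'..b'}"
        proof -
          have "infdist s K \<le> dist s a'" using a'(1) by (intro infdist_le) auto
          also have "\<dots> \<le> h" using that a'(1) b'(1) ab by (auto simp: dist_real_def)
          finally show ?thesis by (simp add: N_def)
        qed
        then show "G1 s * indicator {a'..b'} s \<le> H h s * indicator {a'..b'} s"
          by (auto simp: H_def split: split_indicator)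
      qed
    qed
    also have "\<dots> = (\<integral>\<^sup>+s\<in>{a..b}. H h s \<partial>lebesgue)"
      using a'(1) b'(1) \<open>a' \<le> b'\<close> lebesgue_interval_nn_integral_split[OF H_meas, of a a' b' h]
        lebesgue_interval_nn_integral_split[OF H_meas, of a b' b h] by simp
    finally show ?thesis .
  qed
  have total: "ennreal \<bar>v l - v 0\<bar> \<le> (\<integral>\<^sup>+s\<in>{0..l}. H (l / real (Suc n)) s \<partial>lebesgue)" for n
  proof -
    define h where "h = l / real (Suc n)"
    have h: "0 < h" "real (Suc n) * h = l" using l by (auto simp: h_def)
    have "ennreal \<bar>v (real j * h) - v 0\<bar> \<le> (\<integral>\<^sup>+s\<in>{0..real j * h}. H h s \<partial>lebesgue)" if "j \<le> Suc n" for j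
      using that
    proof (induction j)
      case (Suc j)
      have le: "real (Suc j) * h \<le> l" using Suc.prems h mult_right_mono[of "real (Suc j)" "real (Suc n)" h] by simp
      have step: "real (Suc j) * h = real j * h + h" by (simp add: distrib_right)
      have "ennreal \<bar>v (real (Suc j) * h) - v 0\<bar> \<le>
          ennreal (\<bar>v (real j * h) - v 0\<bar> + \<bar>v (real (Suc j) * h) - v (real j * h)\<bar>)"
        by (intro ennreal_leI) linarith
      also have "\<dots> = ennreal \<bar>v (real j * h) - v 0\<bar> + ennreal \<bar>v (real (Suc j) * h) - v (real j * h)\<bar>"
        by simp
      also have "\<dots> \<le> (\<integral>\<^sup>+s\<in>{0..real j * h}. H h s \<partial>lebesgue) + (\<integral>\<^sup>+s\<in>{real j * h..real (Suc j) * h}. H h s \<partial>lebesgue)"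
      proof (rule add_mono)
        show "ennreal \<bar>v (real j * h) - v 0\<bar> \<le> (\<integral>\<^sup>+s\<in>{0..real j * h}. H h s \<partial>lebesgue)"
          using Suc by simp
        show "ennreal \<bar>v (real (Suc j) * h) - v (real j * h)\<bar> \<le>
            (\<integral>\<^sup>+s\<in>{real j * h..real (Suc j) * h}. H h s \<partial>lebesgue)"
          using le h unfolding step by (intro piece) simp_all
      qed
      also have "\<dots> = (\<integral>\<^sup>+s\<in>{0..real (Suc j) * h}. H h s \<partial>lebesgue)"
        using h step by (intro lebesgue_interval_nn_integral_split[symmetric] H_meas) auto
      finally show ?case .
    qed simp
    from this[of "Suc n"] show ?thesis unfolding h by (simp add: h_def)
  qed
  \<comment> \<open>Decreasing limits pass through the integral because the integrals of
    \<open>G1\<close> and \<open>G2\<close> over \<open>{0..l}\<close> are finite.\<close>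
  have "(INF n. \<integral>\<^sup>+s. H (l / real (Suc n)) s * indicator {0..l} s \<partial>lebesgue) =
      (\<integral>\<^sup>+s. (INF n. H (l / real (Suc n)) s * indicator {0..l} s) \<partial>lebesgue)"
  proof (rule nn_integral_monotone_convergence_INF_decseq[symmetric])
    show "decseq (\<lambda>n s. H (l / real (Suc n)) s * indicator {0..l} s)"
    proof (intro antimonoI le_funI)
      fix m n :: nat and s :: real assume "m \<le> n"
      then have "l / real (Suc n) \<le> l / real (Suc m)" using l by (intro divide_left_mono) auto
      then have "N (l / real (Suc n)) \<subseteq> N (l / real (Suc m))" unfolding N_def by auto
      then show "H (l / real (Suc n)) s * indicator {0..l} s \<le> H (l / real (Suc m)) s * indicator {0..l} s"
        by (auto simp: H_def split: split_indicator)
    qed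
    show "(\<lambda>s. H (l / real (Suc n)) s * indicator {0..l} s) \<in> borel_measurable lebesgue" for n
      by (intro borel_measurable_times_ennreal borel_measurable_indicator H_meas) auto
    have "(\<integral>\<^sup>+s. H (l / real (Suc 0)) s * indicator {0..l} s \<partial>lebesgue) \<le>
        (\<integral>\<^sup>+s. G1 s * indicator {0..l} s + G2 s * indicator {0..l} s \<partial>lebesgue)"
      by (intro nn_integral_mono) (auto simp: H_def split: split_indicator)
    also have "\<dots> < \<infinity>"
      using fin by (subst nn_integral_add) (auto intro!: borel_measurable_times_interval G)
    finally show "(\<integral>\<^sup>+s. H (l / real (Suc 0)) s * indicator {0..l} s \<partial>lebesgue) < \<infinity>" .
  qed
  moreover have "(INF n. H (l / real (Suc n)) s * indicator {0..l} s) \<le>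
      (G1 s * indicator K s + G2 s * indicator (- K) s) * indicator {0..l} s" for s
  proof (cases "s \<in> K")
    case True
    then have "s \<in> N (l / real (Suc 0))" using l by (simp add: N_def)
    show ?thesis by (rule INF_lower2[of 0]) (use True in \<open>auto simp: H_def split: split_indicator\<close>)
  next
    case False
    then have "0 < infdist s K" using \<open>closed K\<close> \<open>K \<noteq> {}\<close> infdist_pos_not_in_closed by blast
    then have "0 < infdist s K / l" using l by simp
    then obtain n where "1 / real (Suc n) < infdist s K / l" using nat_approx_posE by blast
    then have "s \<notin> N (l / real (Suc n))" using l by (simp add: N_def field_simps)
    then show ?thesis by (intro INF_lower2[of n]) (use False in \<open>auto simp: H_def split: split_indicator\<close>)
  qed
  then have "(\<integral>\<^sup>+s. (INF n. H (l / real (Suc n)) s * indicator {0..l} s) \<partial>lebesgue) \<le>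
      (\<integral>\<^sup>+s\<in>{0..l}. G1 s * indicator K s + G2 s * indicator (- K) s \<partial>lebesgue)"
    by (intro nn_integral_mono)
  moreover have "ennreal \<bar>v l - v 0\<bar> \<le> (INF n. \<integral>\<^sup>+s. H (l / real (Suc n)) s * indicator {0..l} s \<partial>lebesgue)"
    by (intro INF_greatest total)
  ultimately show ?thesis by simp
qed

text \<open>Inner regularity reduces a measurable coincidence set to compact ones:
  \<open>K n\<close> increases to almost all of \<open>A\<close>, and the integral of
  \<open>G2\<close> over the rest \<open>A - K n\<close> tends to 0.\<close>

lemma gluing:
  fixes G1 G2 :: "real \<Rightarrow> ennreal" and f v :: "real \<Rightarrow> real"
  assumes G: "G1 \<in> borel_measurable lebesgue" "G2 \<in> borel_measurable lebesgue"
    and fin: "(\<integral>\<^sup>+s\<in>{0..l}. G1 s \<partial>lebesgue) < \<infinity>" "(\<integral>\<^sup>+s\<in>{0..l}. G2 s \<partial>lebesgue) < \<infinity>"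
    and A: "A \<in> sets lebesgue" "A \<subseteq> {0..l}" and eq: "\<And>s. s \<in> A \<Longrightarrow> f s = v s" and l: "0 < l"
    and f: "\<And>a b. 0 \<le> a \<Longrightarrow> a \<le> b \<Longrightarrow> b \<le> l \<Longrightarrow> ennreal \<bar>f b - f a\<bar> \<le> (\<integral>\<^sup>+s\<in>{a..b}. G1 s \<partial>lebesgue)"
    and v: "\<And>a b. 0 \<le> a \<Longrightarrow> a \<le> b \<Longrightarrow> b \<le> l \<Longrightarrow> ennreal \<bar>v b - v a\<bar> \<le> (\<integral>\<^sup>+s\<in>{a..b}. G2 s \<partial>lebesgue)"
  shows "ennreal \<bar>v l - v 0\<bar> \<le> (\<integral>\<^sup>+s\<in>{0..l}. (if s \<in> A then G1 s else G2 s) \<partial>lebesgue)"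
proof -
  have "\<exists>T. closed T \<and> T \<subseteq> A \<and> emeasure lebesgue (A - T) < ennreal (1 / real (Suc n))" for n
    using sets_lebesgue_inner_closed[OF A(1), of "1 / real (Suc n)"] by (metis of_nat_0_less_iff zero_less_Suc zero_less_divide_1_iff)
  then obtain T where T: "\<And>n. closed (T n)" "\<And>n. T n \<subseteq> A"
      "\<And>n. emeasure lebesgue (A - T n) < ennreal (1 / real (Suc n))"
    by metis
  define K where "K n = (\<Union>i\<le>n. T i)" for n :: nat
  have K: "compact (K n)" "K n \<subseteq> A" for n
  proof -
    show "K n \<subseteq> A" using T(2) by (auto simp: K_def)
    then have "bounded (K n)" using A(2) by (meson bounded_closed_interval bounded_subset order_trans)
    moreover have "closed (K n)" unfolding K_def using T(1) by (intro closed_UN) auto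
    ultimately show "compact (K n)" by (simp add: compact_eq_bounded_closed)
  qed
  have K_meas: "K n \<in> sets lebesgue" for n using compact_imp_closed[OF K(1)[of n]] by simp
  let ?R = "\<lambda>n s. G2 s * indicator (A - K n) s"
  have R_meas: "?R n \<in> borel_measurable lebesgue" for n
    using G A K_meas by (intro borel_measurable_times_ennreal borel_measurable_indicator) auto
  have bound: "ennreal \<bar>v l - v 0\<bar> \<le>
      (\<integral>\<^sup>+s\<in>{0..l}. (if s \<in> A then G1 s else G2 s) \<partial>lebesgue) + (\<integral>\<^sup>+s. ?R n s \<partial>lebesgue)" for n
  proof -
    have "ennreal \<bar>v l - v 0\<bar> \<le> (\<integral>\<^sup>+s\<in>{0..l}. G1 s * indicator (K n) s + G2 s * indicator (- K n) s \<partial>lebesgue)"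
      using K(2)[of n] by (intro gluing_compact[OF G fin K(1) _ l f v]) (auto intro: eq)
    also have "\<dots> \<le> (\<integral>\<^sup>+s. (if s \<in> A then G1 s else G2 s) * indicator {0..l} s + ?R n s \<partial>lebesgue)"
      using K(2)[of n] by (intro nn_integral_mono) (auto split: split_indicator)
    also have "\<dots> = (\<integral>\<^sup>+s\<in>{0..l}. (if s \<in> A then G1 s else G2 s) \<partial>lebesgue) + (\<integral>\<^sup>+s. ?R n s \<partial>lebesgue)"
      using G A R_meas by (intro nn_integral_add R_meas borel_measurable_times_ennreal measurable_If_set borel_measurable_indicator) auto
    finally show ?thesis .
  qed
  have "(INF n. \<integral>\<^sup>+s. ?R n s \<partial>lebesgue) = (\<integral>\<^sup>+s. (INF n. ?R n s) \<partial>lebesgue)"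
  proof (rule nn_integral_monotone_convergence_INF_decseq[symmetric])
    show "decseq ?R"
    proof (intro antimonoI le_funI)
      fix m n :: nat and s :: real assume "m \<le> n"
      then have "K m \<subseteq> K n" by (force simp: K_def)
      then show "?R n s \<le> ?R m s" by (auto split: split_indicator)
    qed
    have "(\<integral>\<^sup>+s. ?R 0 s \<partial>lebesgue) \<le> (\<integral>\<^sup>+s\<in>{0..l}. G2 s \<partial>lebesgue)"
      using A(2) by (intro nn_integral_mono) (auto split: split_indicator)
    then show "(\<integral>\<^sup>+s. ?R 0 s \<partial>lebesgue) < \<infinity>" using fin(2) by simp
  qed (rule R_meas)
  also have "\<dots> = 0"
  proof -
    have sub: "(\<Inter>n. A - K n) \<subseteq> A - T n" for n by (force simp: K_def)
    have meas: "(\<Inter>n. A - K n) \<in> sets lebesgue" using A K_meas by (intro sets.countable_INT) auto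
    have "emeasure lebesgue (\<Inter>n. A - K n) \<le> ennreal (1 / real (Suc n))" for n
    proof -
      have "emeasure lebesgue (\<Inter>n. A - K n) \<le> emeasure lebesgue (A - T n)"
        using A T(1) by (intro emeasure_mono sub) auto
      then show ?thesis using T(3)[of n] by simp
    qed
    then have "emeasure lebesgue (\<Inter>n. A - K n) \<le> 0 + ennreal e" if "0 < e" for e
      using nat_approx_posE[OF that] by (metis add_0 ennreal_leI less_imp_le order_trans)
    then have "emeasure lebesgue (\<Inter>n. A - K n) = 0"
      using ennreal_le_epsilon[of 0] by (metis le_zero_eq)
    then have "(\<Inter>n. A - K n) \<in> null_sets lebesgue" using meas by auto
    then have "AE s in lebesgue. s \<notin> (\<Inter>n. A - K n)" by (rule AE_not_in)
    then have "AE s in lebesgue. (INF n. ?R n s) = 0"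
    proof (rule eventually_mono)
      fix s assume "s \<notin> (\<Inter>n. A - K n)"
      then obtain n where "s \<notin> A - K n" by blast
      then have "(INF n. ?R n s) \<le> 0" by (intro INF_lower2[of n]) auto
      then show "(INF n. ?R n s) = 0" by simp
    qed
    then have "(\<integral>\<^sup>+s. (INF n. ?R n s) \<partial>lebesgue) = (\<integral>\<^sup>+s. (\<lambda>_::real. 0) s \<partial>lebesgue)" by (rule nn_integral_cong_AE)
    then show ?thesis by simp
  qed
  finally have R0: "(INF n. \<integral>\<^sup>+s. ?R n s \<partial>lebesgue) = 0" .
  show ?thesis
  proof (rule ennreal_le_epsilon)
    fix e :: real assume "0 < e"
    then have "(INF n. \<integral>\<^sup>+s. ?R n s \<partial>lebesgue) < ennreal e" by (simp add: R0)
    then obtain n where "(\<integral>\<^sup>+s. ?R n s \<partial>lebesgue) < ennreal e" unfolding INF_less_iff by blast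
    then show "ennreal \<bar>v l - v 0\<bar> \<le>
        (\<integral>\<^sup>+s\<in>{0..l}. (if s \<in> A then G1 s else G2 s) \<partial>lebesgue) + ennreal e"
      using bound[of n] by (meson add_left_mono less_imp_le order_trans)
  qed
qed

section \<open>Weak upper gradients\<close>

lemma measurable_lebesgue_on_if_borel:
  assumes "f \<in> measurable (restrict_space borel S) N" "S \<in> sets borel"
  shows "f \<in> measurable (lebesgue_on S) N"
proof (rule measurableI)
  fix A assume "A \<in> sets N"
  then have "f -` A \<inter> S \<in> sets (restrict_space borel S)"
    using measurable_sets[OF assms(1)] assms(2) by (simp add: space_restrict_space)
  then have "f -` A \<inter> S \<in> sets borel" using assms(2) by (simp add: sets_restrict_space_iff)
  then show "f -` A \<inter> space (lebesgue_on S) \<in> sets (lebesgue_on S)"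
    using assms(2) by (auto simp: sets_restrict_space_iff space_restrict_space)
qed (use measurable_space[OF assms(1)] assms(2) in \<open>auto simp: space_restrict_space\<close>)

lemma arc_length_curve_measurable:
  assumes "arc_length_curve l \<gamma>"
  shows "\<gamma> \<in> borel_measurable (restrict_space borel {0..l})"
  using assms unfolding arc_length_curve_def by (intro borel_measurable_continuous_on_restrict) auto

lemma arc_length_curve_vimage_borel:
  assumes "arc_length_curve l \<gamma>" "E \<in> sets borel"
  shows "{s \<in> {0..l}. \<gamma> s \<in> E} \<in> sets lebesgue"
proof -
  have "\<gamma> -` E \<inter> {0..l} \<in> sets (restrict_space borel {0..l})"
    using measurable_sets[OF arc_length_curve_measurable[OF assms(1)] assms(2)] by (simp add: space_restrict_space)
  then have "\<gamma> -` E \<inter> {0..l} \<in> sets borel" by (simp add: sets_restrict_space_iff)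
  moreover have "{s \<in> {0..l}. \<gamma> s \<in> E} = \<gamma> -` E \<inter> {0..l}" by auto
  ultimately show ?thesis by simp
qed

lemma curve_integral_defined_borel:
  assumes "arc_length_curve l \<gamma>" "\<rho> \<in> borel_measurable borel"
  shows "curve_integral_defined l \<gamma> \<rho>"
  unfolding curve_integral_defined_def
  using measurable_compose[OF arc_length_curve_measurable[OF assms(1)] assms(2)]
  by (intro measurable_lebesgue_on_if_borel) auto

lemma curve_integral_defined_iff:
  "curve_integral_defined l \<gamma> g \<longleftrightarrow> (\<lambda>s. g (\<gamma> s) * indicator {0..l} s) \<in> borel_measurable lebesgue"
  unfolding curve_integral_defined_def by (subst borel_measurable_restrict_space_iff_ennreal) auto

lemma curve_integral_eq: "curve_integral l \<gamma> g = (\<integral>\<^sup>+s\<in>{0..l}. g (\<gamma> s) \<partial>lebesgue)"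
  unfolding curve_integral_def by (subst nn_integral_restrict_space) auto

lemma curve_integral_mono: "(\<And>x. g x \<le> h x) \<Longrightarrow> curve_integral l \<gamma> g \<le> curve_integral l \<gamma> h"
  unfolding curve_integral_def by (intro nn_integral_mono)

lemma curve_integral_sub:
  assumes "curve_integral_defined l \<gamma> g" "0 \<le> a" "a \<le> b" "b \<le> l"
  shows "curve_integral (b - a) (\<lambda>s. \<gamma> (a + s)) g = (\<integral>\<^sup>+s\<in>{a..b}. g (\<gamma> s) \<partial>lebesgue)"
proof -
  let ?G = "\<lambda>s. g (\<gamma> s) * indicator {0..l} s"
  have G: "(\<lambda>s. ?G s * indicator {a..b} s) \<in> borel_measurable lebesgue"
    using assms(1) unfolding curve_integral_defined_iff by (rule borel_measurable_times_interval)
  have "(\<integral>\<^sup>+s\<in>{a..b}. g (\<gamma> s) \<partial>lebesgue) = (\<integral>\<^sup>+s. ?G s * indicator {a..b} s \<partial>lebesgue)"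
    using assms by (intro nn_integral_cong) (auto split: split_indicator)
  also have "\<dots> = (\<integral>\<^sup>+s. ?G (a + 1 * s) * indicator {a..b} (a + 1 * s) \<partial>lebesgue)"
    using nn_integral_real_affine_lebesgue[OF G, of 1 a] by simp
  also have "\<dots> = (\<integral>\<^sup>+s\<in>{0..b - a}. g (\<gamma> (a + s)) \<partial>lebesgue)"
    using assms by (intro nn_integral_cong) (auto split: split_indicator)
  finally show ?thesis by (simp add: curve_integral_eq)
qed

text \<open>Families of curves of zero \<open>t\<close>-modulus. The witness has finite integral
  over the whole space, not just locally, so that countably many witnesses can be combined; being
  Borel, it has a well-defined integral along every curve.\<close>

definition exceptional ::
    "'a::metric_space measure \<Rightarrow> real \<Rightarrow> (real \<Rightarrow> (real \<Rightarrow> 'a) \<Rightarrow> bool) \<Rightarrow> bool" where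
  "exceptional M t P \<longleftrightarrow>
     (\<exists>\<rho>\<in>borel_measurable borel. (\<integral>\<^sup>+x. ennreal_powr (\<rho> x) t \<partial>M) < \<infinity> \<and>
        (\<forall>l \<gamma>. arc_length_curve l \<gamma> \<and> P l \<gamma> \<longrightarrow> curve_integral l \<gamma> \<rho> = \<infinity>))"

lemma exceptional_mono:
  "exceptional M t P \<Longrightarrow> (\<And>l \<gamma>. arc_length_curve l \<gamma> \<Longrightarrow> Q l \<gamma> \<Longrightarrow> P l \<gamma>) \<Longrightarrow> exceptional M t Q"
  unfolding exceptional_def by blast

lemma exceptional_contr:
  "exceptional M t P \<Longrightarrow>
    (\<And>l \<gamma>. arc_length_curve l \<gamma> \<Longrightarrow> Q l \<gamma> \<Longrightarrow> \<not> P l \<gamma> \<Longrightarrow> False) \<Longrightarrow> exceptional M t Q"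
  unfolding exceptional_def by blast

text \<open>The same density works: an infinite integral over a subcurve forces an infinite integral
  over the whole curve.\<close>

lemma exceptional_sub:
  assumes "exceptional M t P"
  shows "exceptional M t (\<lambda>l \<gamma>. \<exists>a b. 0 \<le> a \<and> a < b \<and> b \<le> l \<and> P (b - a) (\<lambda>s. \<gamma> (a + s)))"
proof -
  obtain \<rho> where \<rho>: "\<rho> \<in> borel_measurable borel" "(\<integral>\<^sup>+x. ennreal_powr (\<rho> x) t \<partial>M) < \<infinity>"
    "\<And>l \<gamma>. arc_length_curve l \<gamma> \<Longrightarrow> P l \<gamma> \<Longrightarrow> curve_integral l \<gamma> \<rho> = \<infinity>"
    using assms unfolding exceptional_def by blast
  show ?thesis
    unfolding exceptional_def
  proof (intro bexI[of _ \<rho>] conjI allI impI)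
    fix l \<gamma> assume *: "arc_length_curve l \<gamma> \<and> (\<exists>a b. 0 \<le> a \<and> a < b \<and> b \<le> l \<and> P (b - a) (\<lambda>s. \<gamma> (a + s)))"
    then obtain a b where ab: "0 \<le> a" "a < b" "b \<le> l" "P (b - a) (\<lambda>s. \<gamma> (a + s))" by blast
    have "curve_integral (b - a) (\<lambda>s. \<gamma> (a + s)) \<rho> = \<infinity>"
      using ab * by (intro \<rho>(3) arc_length_curve_sub[of l]) auto
    then have "(\<integral>\<^sup>+s\<in>{a..b}. \<rho> (\<gamma> s) \<partial>lebesgue) = \<infinity>"
      using ab * \<rho>(1) by (subst (asm) curve_integral_sub[of l]) (auto intro: curve_integral_defined_borel)
    moreover have "(\<integral>\<^sup>+s\<in>{a..b}. \<rho> (\<gamma> s) \<partial>lebesgue) \<le> (\<integral>\<^sup>+s\<in>{0..l}. \<rho> (\<gamma> s) \<partial>lebesgue)"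
      using ab by (intro nn_set_integral_set_mono) auto
    ultimately show "curve_integral l \<gamma> \<rho> = \<infinity>"
      unfolding curve_integral_eq by (simp add: top_unique)
  qed (use \<rho> in auto)
qed

section \<open>Calculus of exceptional families of curves\<close>

context doubling_space
begin

lemma exceptional_UN_nat:
  assumes t: "0 < t" and P: "\<And>n::nat. exceptional M t (P n)"
  shows "exceptional M t (\<lambda>l \<gamma>. \<exists>n. P n l \<gamma>)"
proof -
  have "\<forall>n. \<exists>\<rho>. \<rho> \<in> borel_measurable borel \<and> (\<integral>\<^sup>+x. ennreal_powr (\<rho> x) t \<partial>M) < \<infinity> \<and>
      (\<forall>l \<gamma>. arc_length_curve l \<gamma> \<and> P n l \<gamma> \<longrightarrow> curve_integral l \<gamma> \<rho> = \<infinity>)"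
    using P unfolding exceptional_def by blast
  then obtain \<rho> where \<rho>: "\<And>n. \<rho> n \<in> borel_measurable borel"
    "\<And>n. (\<integral>\<^sup>+x. ennreal_powr (\<rho> n x) t \<partial>M) < \<infinity>"
    "\<And>n l \<gamma>. arc_length_curve l \<gamma> \<Longrightarrow> P n l \<gamma> \<Longrightarrow> curve_integral l \<gamma> (\<rho> n) = \<infinity>"
    by metis
  define I where "I n = enn2real (\<integral>\<^sup>+x. ennreal_powr (\<rho> n x) t \<partial>M)" for n
  have I: "(\<integral>\<^sup>+x. ennreal_powr (\<rho> n x) t \<partial>M) = ennreal (I n)" "0 \<le> I n" for n
    using \<rho>(2)[of n] by (auto simp: I_def)
  \<comment> \<open>Scaled so that the \<open>t\<close>-th power of the \<open>n\<close>-th density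
    has integral at most \<open>(1 / 2) ^ n\<close>; the summand 1 avoids division by zero.\<close>
  define a where "a n = ((1 / 2) ^ n / (1 + I n)) powr (1 / t)" for n
  have a: "0 < a n" "a n powr t = (1 / 2) ^ n / (1 + I n)" for n
  proof -
    have "0 < (1 / 2) ^ n / (1 + I n)" using I(2)[of n] by (intro divide_pos_pos) auto
    then show "0 < a n" "a n powr t = (1 / 2) ^ n / (1 + I n)" using t I(2)[of n] by (auto simp: a_def powr_powr)
  qed
  \<comment> \<open>The supremum dominates every density up to a positive factor, so its integral is
    infinite along each curve of the union.\<close>
  define \<sigma> where "\<sigma> x = (SUP n. ennreal (a n) * \<rho> n x)" for x
  have \<rho>_M: "\<rho> n \<in> borel_measurable M" for n by (rule borel_imp_measurable[OF \<rho>(1)])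
  have "(\<integral>\<^sup>+x. ennreal_powr (\<sigma> x) t \<partial>M) \<le> (\<integral>\<^sup>+x. (\<Sum>n. ennreal_powr (ennreal (a n) * \<rho> n x) t) \<partial>M)"
    unfolding \<sigma>_def by (intro nn_integral_mono ennreal_powr_SUP_le_suminf t)
  also have "\<dots> = (\<Sum>n. \<integral>\<^sup>+x. ennreal_powr (ennreal (a n) * \<rho> n x) t \<partial>M)"
    using \<rho>_M by (intro nn_integral_suminf measurable_ennreal_powr) auto
  also have "\<dots> \<le> (\<Sum>n. ennreal ((1 / 2) ^ n))"
  proof (intro suminf_le)
    fix n
    have "(\<integral>\<^sup>+x. ennreal_powr (ennreal (a n) * \<rho> n x) t \<partial>M) = ennreal (a n powr t) * ennreal (I n)"
      using a(1)[of n] \<rho>_M[of n] I by (simp add: ennreal_powr_cmult nn_integral_cmult measurable_ennreal_powr)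
    also have "\<dots> = ennreal (a n powr t * I n)" using I by (simp add: ennreal_mult)
    also have "\<dots> \<le> ennreal ((1 / 2) ^ n)"
    proof (rule ennreal_leI)
      have "(1 / 2) ^ n * (I n / (1 + I n)) \<le> (1 / 2) ^ n * (1::real)"
        using I(2)[of n] by (intro mult_left_mono) auto
      then show "a n powr t * I n \<le> (1 / 2) ^ n" unfolding a(2) by simp
    qed
    finally show "(\<integral>\<^sup>+x. ennreal_powr (ennreal (a n) * \<rho> n x) t \<partial>M) \<le> ennreal ((1 / 2) ^ n)" .
  qed auto
  also have "\<dots> < \<infinity>"
    by (subst suminf_ennreal2) (auto intro: summable_geometric)
  finally have fin: "(\<integral>\<^sup>+x. ennreal_powr (\<sigma> x) t \<partial>M) < \<infinity>" .
  show ?thesis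
    unfolding exceptional_def
  proof (intro bexI[of _ \<sigma>] conjI allI impI fin)
    show "\<sigma> \<in> borel_measurable borel" unfolding \<sigma>_def using \<rho>(1) by measurable
    fix l \<gamma> assume *: "arc_length_curve l \<gamma> \<and> (\<exists>n. P n l \<gamma>)"
    then obtain n where n: "P n l \<gamma>" by blast
    have "(\<lambda>s. \<rho> n (\<gamma> s)) \<in> borel_measurable (lebesgue_on {0..l})"
      using curve_integral_defined_borel[OF _ \<rho>(1)] * unfolding curve_integral_defined_def by blast
    then have "curve_integral l \<gamma> (\<lambda>x. ennreal (a n) * \<rho> n x) = ennreal (a n) * curve_integral l \<gamma> (\<rho> n)"
      unfolding curve_integral_def by (rule nn_integral_cmult)
    also have "\<dots> = \<infinity>" using \<rho>(3)[of l \<gamma> n] n * a(1)[of n] by (simp add: ennreal_mult_top)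
    finally have "curve_integral l \<gamma> (\<lambda>x. ennreal (a n) * \<rho> n x) = \<infinity>" .
    moreover have "curve_integral l \<gamma> (\<lambda>x. ennreal (a n) * \<rho> n x) \<le> curve_integral l \<gamma> \<sigma>"
      unfolding \<sigma>_def by (intro curve_integral_mono SUP_upper) auto
    ultimately show "curve_integral l \<gamma> \<sigma> = \<infinity>" by (simp add: top_unique)
  qed
qed

lemma exceptional_UN:
  assumes "0 < t" "countable C" "\<And>c. c \<in> C \<Longrightarrow> exceptional M t (P c)"
  shows "exceptional M t (\<lambda>l \<gamma>. \<exists>c\<in>C. P c l \<gamma>)"
proof (cases "C = {}")
  case True
  have "exceptional M t (\<lambda>l \<gamma>. False)"
    unfolding exceptional_def
    by (intro bexI[of _ "\<lambda>_. 0"]) (auto simp: ennreal_powr_def)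
  then show ?thesis using True by simp
next
  case False
  have "exceptional M t (\<lambda>l \<gamma>. \<exists>n. P (from_nat_into C n) l \<gamma>)"
    using assms(3) from_nat_into[OF False] by (intro exceptional_UN_nat assms(1)) blast
  then show ?thesis
    by (rule exceptional_mono) (metis False assms(2) from_nat_into_surj)
qed

lemma exceptional_disj:
  assumes "0 < t" "exceptional M t P" "exceptional M t Q"
  shows "exceptional M t (\<lambda>l \<gamma>. P l \<gamma> \<or> Q l \<gamma>)"
proof -
  have "exceptional M t (\<lambda>l \<gamma>. \<exists>b\<in>UNIV. (if b then P else Q) l \<gamma>)"
    using assms by (intro exceptional_UN) auto
  then show ?thesis by (rule exceptional_mono) (auto intro: exI[of _ True] exI[of _ False])
qed

text \<open>Curves are compact, so a function in \<open>L\<^sup>t\<^sub>l\<^sub>o\<^sub>c\<close> can be cut into countably many functions in \<open>L\<^sup>t\<close>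
  such that one of them has infinite integral over each curve over which it has.\<close>

lemma exceptional_Lloc:
  assumes t: "0 < t" and \<rho>: "\<rho> \<in> borel_measurable borel" "\<rho> \<in> Lloc M t"
  shows "exceptional M t (\<lambda>l \<gamma>. curve_integral l \<gamma> \<rho> = \<infinity>)"
proof -
  obtain r where r: "\<And>x. 0 < r x" "\<And>x. (\<integral>\<^sup>+y\<in>ball x (r x). ennreal_powr (\<rho> y) t \<partial>M) < \<infinity>"
    using \<rho>(2) unfolding Lloc_def by (auto, metis)
  obtain C where C: "countable C" "(\<Union>x\<in>C. ball x (r x)) = UNIV"
    by (rule lindelof[of r]) (use r in auto)
  define \<sigma> where "\<sigma> c x = \<rho> x * indicator (ball c (r c)) x" for c x
  have \<sigma>_meas: "\<sigma> c \<in> borel_measurable borel" for c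
    unfolding \<sigma>_def using \<rho>(1) by (intro borel_measurable_times_ennreal borel_measurable_indicator) auto
  have "exceptional M t (\<lambda>l \<gamma>. \<exists>c\<in>C. curve_integral l \<gamma> (\<sigma> c) = \<infinity>)"
  proof (rule exceptional_UN[OF t C(1)])
    fix c
    have "(\<integral>\<^sup>+x. ennreal_powr (\<sigma> c x) t \<partial>M) = (\<integral>\<^sup>+y\<in>ball c (r c). ennreal_powr (\<rho> y) t \<partial>M)"
      using t by (intro nn_integral_cong) (auto simp: \<sigma>_def ennreal_powr_def split: split_indicator)
    then show "exceptional M t (\<lambda>l \<gamma>. curve_integral l \<gamma> (\<sigma> c) = \<infinity>)"
      unfolding exceptional_def using r(2)[of c] \<sigma>_meas[of c] by (intro bexI[of _ "\<sigma> c"]) auto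
  qed
  then show ?thesis
  proof (rule exceptional_mono)
    fix l \<gamma> assume arc: "arc_length_curve l \<gamma>" and inf: "curve_integral l \<gamma> \<rho> = \<infinity>"
    have "compact (\<gamma> ` {0..l})"
      using arc unfolding arc_length_curve_def by (intro compact_continuous_image) auto
    moreover have "\<gamma> ` {0..l} \<subseteq> (\<Union>x\<in>C. ball x (r x))" using C(2) by simp
    ultimately obtain F where F: "F \<subseteq> C" "finite F" "\<gamma> ` {0..l} \<subseteq> (\<Union>x\<in>F. ball x (r x))"
      using compactE_image[of "\<gamma> ` {0..l}" C "\<lambda>x. ball x (r x)"] by (metis open_ball)
    have "curve_integral l \<gamma> \<rho> \<le> (\<integral>\<^sup>+s. (\<Sum>c\<in>F. \<sigma> c (\<gamma> s)) \<partial>lebesgue_on {0..l})"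
      unfolding curve_integral_def
    proof (rule nn_integral_mono)
      fix s assume "s \<in> space (lebesgue_on {0..l})"
      then have "\<gamma> s \<in> \<gamma> ` {0..l}" by (simp add: space_restrict_space)
      then obtain c where c: "c \<in> F" "\<gamma> s \<in> ball c (r c)" using F(3) by blast
      then have "\<rho> (\<gamma> s) = \<sigma> c (\<gamma> s)" by (simp add: \<sigma>_def)
      also have "\<dots> \<le> (\<Sum>c\<in>F. \<sigma> c (\<gamma> s))" using c F(2) by (intro member_le_sum) auto
      finally show "\<rho> (\<gamma> s) \<le> (\<Sum>c\<in>F. \<sigma> c (\<gamma> s))" .
    qed
    also have "\<dots> = (\<Sum>c\<in>F. curve_integral l \<gamma> (\<sigma> c))"
      unfolding curve_integral_def using curve_integral_defined_borel[OF arc \<sigma>_meas]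
      by (intro nn_integral_sum) (simp add: curve_integral_defined_def)
    finally have "(\<Sum>c\<in>F. curve_integral l \<gamma> (\<sigma> c)) = \<infinity>" using inf by (simp add: top_unique)
    then have "\<exists>c\<in>F. curve_integral l \<gamma> (\<sigma> c) = \<infinity>" using F(2) by (simp add: ennreal_sum_eq_top)
    then show "\<exists>c\<in>C. curve_integral l \<gamma> (\<sigma> c) = \<infinity>" using F(1) by blast
  qed
qed

text \<open>Passes from the locally integrable density of the definition to a globally integrable
  one, by \<open>exceptional_Lloc\<close>; conversely, a globally integrable density is locally
  integrable on balls of radius 1.\<close>

lemma weak_upper_gradient_iff:
  assumes "0 < t"
  shows "weak_upper_gradient M t u g \<longleftrightarrow> g \<in> borel_measurable M \<and>
    exceptional M t (\<lambda>l \<gamma>. \<not> (curve_integral_defined l \<gamma> g \<and> ennreal \<bar>u (\<gamma> 0) - u (\<gamma> l)\<bar> \<le> curve_integral l \<gamma> g))"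
    (is "?L \<longleftrightarrow> _ \<and> exceptional M t ?P")
proof (intro iffI conjI)
  assume L: ?L
  then show "g \<in> borel_measurable M" by (simp add: weak_upper_gradient_def)
  from L obtain \<rho> where "\<rho> \<in> borel_measurable borel" "\<rho> \<in> Lloc M t"
      and \<rho>: "\<And>l \<gamma>. arc_length_curve l \<gamma> \<Longrightarrow> ?P l \<gamma> \<Longrightarrow> curve_integral l \<gamma> \<rho> = \<infinity>"
    unfolding weak_upper_gradient_def by blast
  then have "exceptional M t (\<lambda>l \<gamma>. curve_integral l \<gamma> \<rho> = \<infinity>)" using assms by (intro exceptional_Lloc)
  then show "exceptional M t ?P" by (rule exceptional_mono) (rule \<rho>)
next
  assume R: "g \<in> borel_measurable M \<and> exceptional M t ?P"
  then obtain \<rho> where \<rho>: "\<rho> \<in> borel_measurable borel" "(\<integral>\<^sup>+x. ennreal_powr (\<rho> x) t \<partial>M) < \<infinity>"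
      "\<And>l \<gamma>. arc_length_curve l \<gamma> \<Longrightarrow> ?P l \<gamma> \<Longrightarrow> curve_integral l \<gamma> \<rho> = \<infinity>"
    unfolding exceptional_def by blast
  have "(\<integral>\<^sup>+y\<in>ball x 1. ennreal_powr (\<rho> y) t \<partial>M) < \<infinity>" for x
  proof -
    have "(\<integral>\<^sup>+y\<in>ball x 1. ennreal_powr (\<rho> y) t \<partial>M) \<le> (\<integral>\<^sup>+y. ennreal_powr (\<rho> y) t \<partial>M)"
      by (intro nn_integral_mono) (auto split: split_indicator)
    with \<rho>(2) show ?thesis by simp
  qed
  then have "\<rho> \<in> Lloc M t"
    using borel_imp_measurable[OF \<rho>(1)] unfolding Lloc_def by (auto intro!: exI[of _ 1])
  then show ?L using R \<rho> unfolding weak_upper_gradient_def by blast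
qed

lemma upper_gradientsI:
  assumes "0 < t" "g \<in> Lloc M t"
    "exceptional M t (\<lambda>l \<gamma>. \<not> (curve_integral_defined l \<gamma> g \<and> ennreal \<bar>u (\<gamma> 0) - u (\<gamma> l)\<bar> \<le> curve_integral l \<gamma> g))"
  shows "g \<in> upper_gradients M t u"
  using assms by (simp add: upper_gradients_def weak_upper_gradient_iff Lloc_def)

text \<open>A Borel majorant equal to \<open>g\<close> almost everywhere has the same integrals over
  balls; since it dominates everywhere, its curve integrals are at least those of
  \<open>g\<close>.\<close>

lemma exceptional_infinite_integral:
  assumes t: "0 < t" and g: "g \<in> Lloc M t"
  shows "exceptional M t (\<lambda>l \<gamma>. curve_integral l \<gamma> g = \<infinity>)"
proof -
  obtain g' where g': "g' \<in> borel_measurable borel" "\<And>x. g x \<le> g' x" "AE x in M. g' x = g x"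
    by (rule borel_majorant[of g]) (use g in \<open>auto simp: Lloc_def\<close>)
  have "(\<integral>\<^sup>+y\<in>ball x r. ennreal_powr (g' y) t \<partial>M) = (\<integral>\<^sup>+y\<in>ball x r. ennreal_powr (g y) t \<partial>M)" for x r
    using g'(3) by (intro nn_integral_cong_AE) (auto elim!: eventually_mono)
  then have "g' \<in> Lloc M t" using g borel_imp_measurable[OF g'(1)] by (simp add: Lloc_def)
  then have "exceptional M t (\<lambda>l \<gamma>. curve_integral l \<gamma> g' = \<infinity>)" by (rule exceptional_Lloc[OF t g'(1)])
  then show ?thesis
    by (rule exceptional_mono) (use curve_integral_mono[of g g'] g'(2) in \<open>metis infinity_ennreal_def top_unique\<close>)
qed

end

text \<open>Gluing needs a finite integral and the inequality on every subcurve, while an upper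
  gradient is only tested between the end points of a curve. Almost every curve has the stronger
  property.\<close>

definition good_curve :: "('a::metric_space \<Rightarrow> real) \<Rightarrow> ('a \<Rightarrow> ennreal) \<Rightarrow> real \<Rightarrow> (real \<Rightarrow> 'a) \<Rightarrow> bool" where
  "good_curve u g l \<gamma> \<longleftrightarrow> curve_integral_defined l \<gamma> g \<and> curve_integral l \<gamma> g < \<infinity> \<and>
     (\<forall>a b. 0 \<le> a \<and> a \<le> b \<and> b \<le> l \<longrightarrow> ennreal \<bar>u (\<gamma> b) - u (\<gamma> a)\<bar> \<le> (\<integral>\<^sup>+s\<in>{a..b}. g (\<gamma> s) \<partial>lebesgue))"

lemma good_curveD:
  assumes "good_curve u g l \<gamma>" "arc_length_curve l \<gamma>"
  shows "curve_integral_defined l \<gamma> g" "ennreal \<bar>u (\<gamma> 0) - u (\<gamma> l)\<bar> \<le> curve_integral l \<gamma> g"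
  using assms abs_minus_commute[of "u (\<gamma> 0)"]
  by (auto simp: good_curve_def curve_integral_eq arc_length_curve_def)

text \<open>An instance of \<open>gluing\<close> for the compositions with \<open>\<gamma>\<close>.
  Measurability of the preimage of \<open>E\<close> is a hypothesis because \<open>E\<close> need
  not be Borel.\<close>

lemma good_curve_glue:
  assumes arc: "arc_length_curve l \<gamma>" and g: "good_curve u g1 l \<gamma>" "good_curve v g2 l \<gamma>"
    and E: "{s \<in> {0..l}. \<gamma> s \<in> E} \<in> sets lebesgue" and eq: "\<And>x. x \<in> E \<Longrightarrow> u x = v x"
  shows "curve_integral_defined l \<gamma> (\<lambda>x. if x \<in> E then g1 x else g2 x)"
    "ennreal \<bar>v (\<gamma> 0) - v (\<gamma> l)\<bar> \<le> curve_integral l \<gamma> (\<lambda>x. if x \<in> E then g1 x else g2 x)"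
proof -
  let ?A = "{s \<in> {0..l}. \<gamma> s \<in> E}"
  let ?G1 = "\<lambda>s. g1 (\<gamma> s) * indicator {0..l} s" and ?G2 = "\<lambda>s. g2 (\<gamma> s) * indicator {0..l} s"
  have G: "?G1 \<in> borel_measurable lebesgue" "?G2 \<in> borel_measurable lebesgue"
    using g by (auto simp: good_curve_def curve_integral_defined_iff)
  have eq_if: "(if \<gamma> s \<in> E then g1 (\<gamma> s) else g2 (\<gamma> s)) * indicator {0..l} s = (if s \<in> ?A then ?G1 s else ?G2 s)" for s
    by (auto split: split_indicator)
  show "curve_integral_defined l \<gamma> (\<lambda>x. if x \<in> E then g1 x else g2 x)"
    unfolding curve_integral_defined_iff eq_if using G E by (intro measurable_If_set) auto
  have sub: "(\<integral>\<^sup>+s\<in>{a..b}. h s * indicator {0..l} s \<partial>lebesgue) = (\<integral>\<^sup>+s\<in>{a..b}. h s \<partial>lebesgue)"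
    if "0 \<le> a" "b \<le> l" for a b and h :: "real \<Rightarrow> ennreal"
    using that by (intro nn_integral_cong) (auto split: split_indicator)
  have l: "0 < l" using arc by (simp add: arc_length_curve_def)
  have "ennreal \<bar>v (\<gamma> l) - v (\<gamma> 0)\<bar> \<le> (\<integral>\<^sup>+s\<in>{0..l}. (if s \<in> ?A then ?G1 s else ?G2 s) \<partial>lebesgue)"
  proof (rule gluing[OF G, where v = "\<lambda>s. v (\<gamma> s)" and f = "\<lambda>s. u (\<gamma> s)"])
    show "(\<integral>\<^sup>+s\<in>{0..l}. ?G1 s \<partial>lebesgue) < \<infinity>" "(\<integral>\<^sup>+s\<in>{0..l}. ?G2 s \<partial>lebesgue) < \<infinity>"
      using g unfolding good_curve_def curve_integral_eq by (simp_all add: sub)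
    show "ennreal \<bar>u (\<gamma> b) - u (\<gamma> a)\<bar> \<le> (\<integral>\<^sup>+s\<in>{a..b}. ?G1 s \<partial>lebesgue)"
      "ennreal \<bar>v (\<gamma> b) - v (\<gamma> a)\<bar> \<le> (\<integral>\<^sup>+s\<in>{a..b}. ?G2 s \<partial>lebesgue)"
      if "0 \<le> a" "a \<le> b" "b \<le> l" for a b
      using g that unfolding good_curve_def by (simp_all add: sub)
  qed (use E l eq in auto)
  also have "\<dots> = (\<integral>\<^sup>+s\<in>{0..l}. (if \<gamma> s \<in> E then g1 (\<gamma> s) else g2 (\<gamma> s)) \<partial>lebesgue)"
    by (intro nn_integral_cong) (auto split: split_indicator)
  finally show "ennreal \<bar>v (\<gamma> 0) - v (\<gamma> l)\<bar> \<le> curve_integral l \<gamma> (\<lambda>x. if x \<in> E then g1 x else g2 x)"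
    unfolding curve_integral_eq by (simp add: abs_minus_commute)
qed

section \<open>Operations on upper gradients, and the minimal one\<close>

context doubling_space
begin

text \<open>Besides infinite integrals and failures on the curve itself, the failures on subcurves
  are removed through \<open>exceptional_sub\<close>.\<close>

lemma exceptional_not_good_curve:
  assumes t: "0 < t" and g: "g \<in> upper_gradients M t u"
  shows "exceptional M t (\<lambda>l \<gamma>. \<not> good_curve u g l \<gamma>)"
proof -
  let ?P = "\<lambda>l \<gamma>. \<not> (curve_integral_defined l \<gamma> g \<and> ennreal \<bar>u (\<gamma> 0) - u (\<gamma> l)\<bar> \<le> curve_integral l \<gamma> g)"
  have gL: "g \<in> Lloc M t" and P: "exceptional M t ?P"
    using g weak_upper_gradient_iff[OF t] by (auto simp: upper_gradients_def)
  have "exceptional M t (\<lambda>l \<gamma>. curve_integral l \<gamma> g = \<infinity> \<or> ?P l \<gamma> \<or>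
      (\<exists>a b. 0 \<le> a \<and> a < b \<and> b \<le> l \<and> ?P (b - a) (\<lambda>s. \<gamma> (a + s))))"
    by (intro exceptional_disj t P exceptional_infinite_integral[OF t gL] exceptional_sub)
  then show ?thesis
  proof (rule exceptional_contr)
    fix l \<gamma> assume arc: "arc_length_curve l \<gamma>" and bad: "\<not> good_curve u g l \<gamma>"
      and no: "\<not> (curve_integral l \<gamma> g = \<infinity> \<or> ?P l \<gamma> \<or>
          (\<exists>a b. 0 \<le> a \<and> a < b \<and> b \<le> l \<and> ?P (b - a) (\<lambda>s. \<gamma> (a + s))))"
    then have def: "curve_integral_defined l \<gamma> g" by blast
    have "ennreal \<bar>u (\<gamma> b) - u (\<gamma> a)\<bar> \<le> (\<integral>\<^sup>+s\<in>{a..b}. g (\<gamma> s) \<partial>lebesgue)"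
      if "0 \<le> a" "a \<le> b" "b \<le> l" for a b
    proof (cases "a = b")
      case False
      then have "ennreal \<bar>u (\<gamma> (a + 0)) - u (\<gamma> (a + (b - a)))\<bar> \<le> curve_integral (b - a) (\<lambda>s. \<gamma> (a + s)) g"
        using no that by (meson order_le_less)
      then show ?thesis using curve_integral_sub[OF def that] by (simp add: abs_minus_commute)
    qed simp
    then show False using bad no def by (auto simp: good_curve_def less_top)
  qed
qed

lemma upper_gradients_measurable: "g \<in> upper_gradients M t u \<Longrightarrow> g \<in> borel_measurable M"
  by (simp add: upper_gradients_def Lloc_def)

lemma Lloc_mono:
  assumes t: "0 \<le> t" and "g \<in> Lloc M t" "h \<in> borel_measurable M" "\<And>x. h x \<le> g x"
  shows "h \<in> Lloc M t"
proof -
  have "(\<integral>\<^sup>+y\<in>ball x r. ennreal_powr (h y) t \<partial>M) \<le> (\<integral>\<^sup>+y\<in>ball x r. ennreal_powr (g y) t \<partial>M)" for x r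
    using t assms(4) by (intro nn_integral_mono mult_right_mono ennreal_powr_mono) auto
  then show ?thesis using assms(2,3) unfolding Lloc_def mem_Collect_eq by (meson le_less_trans)
qed

lemma Lloc_add:
  assumes t: "0 < t" and "g \<in> Lloc M t" "h \<in> Lloc M t"
  shows "(\<lambda>x. g x + h x) \<in> Lloc M t"
  unfolding Lloc_def
proof (intro CollectI conjI allI)
  have meas: "g \<in> borel_measurable M" "h \<in> borel_measurable M" using assms by (auto simp: Lloc_def)
  then show "(\<lambda>x. g x + h x) \<in> borel_measurable M" by simp
  fix x
  obtain r s where r: "0 < r" "(\<integral>\<^sup>+y\<in>ball x r. ennreal_powr (g y) t \<partial>M) < \<infinity>"
    and s: "0 < s" "(\<integral>\<^sup>+y\<in>ball x s. ennreal_powr (h y) t \<partial>M) < \<infinity>"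
    using assms(2,3) unfolding Lloc_def by blast
  let ?I = "\<lambda>r g. \<integral>\<^sup>+y\<in>ball x r. ennreal_powr (g y) t \<partial>M"
  have "?I (min r s) (\<lambda>y. g y + h y) \<le> (\<integral>\<^sup>+y. ennreal (2 powr t) *
      (ennreal_powr (g y) t * indicator (ball x r) y + ennreal_powr (h y) t * indicator (ball x s) y) \<partial>M)"
    using ennreal_powr_add_le[OF t]
    by (intro nn_integral_mono) (auto split: split_indicator)
  also have "\<dots> = ennreal (2 powr t) * (?I r g + ?I s h)"
    using meas by (subst nn_integral_cmult; (subst nn_integral_add)?)
      (auto intro!: borel_measurable_times_ennreal measurable_ennreal_powr borel_measurable_add)
  also have "\<dots> < \<infinity>" using r s by (simp add: ennreal_mult_less_top)
  finally show "\<exists>r>0. ?I r (\<lambda>y. g y + h y) < \<infinity>" using r(1) s(1) by (intro exI[of _ "min r s"]) auto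
qed

lemma Lloc_const:
  assumes "0 \<le> k"
  shows "(\<lambda>_. ennreal k) \<in> Lloc M t"
proof -
  have "(\<integral>\<^sup>+y\<in>ball x 1. ennreal_powr (ennreal k) t \<partial>M) < \<infinity>" for x
    using assms emeasure_ball_finite[of x 1] by (simp add: nn_integral_cmult_indicator ennreal_mult_less_top)
  then show ?thesis unfolding Lloc_def by (auto intro!: exI[of _ 1])
qed

text \<open>Locality: where \<open>v\<close> agrees with \<open>u\<close>, an upper gradient of
  \<open>u\<close> may be used for \<open>v\<close>. This will bound the energy of a Lipschitz
  truncation and, with the roles exchanged, the minimal gradient itself.\<close>

lemma upper_gradients_glue:
  assumes t: "0 < t" and g: "g1 \<in> upper_gradients M t u" "g2 \<in> upper_gradients M t v"
    and E: "E \<in> sets M" "exceptional M t (\<lambda>l \<gamma>. {s \<in> {0..l}. \<gamma> s \<in> E} \<notin> sets lebesgue)"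
    and eq: "\<And>x. x \<in> E \<Longrightarrow> u x = v x"
  shows "(\<lambda>x. if x \<in> E then g1 x else g2 x) \<in> upper_gradients M t v"
proof (rule upper_gradientsI[OF t])
  have "(\<lambda>x. g1 x + g2 x) \<in> Lloc M t"
    using g by (intro Lloc_add t) (auto simp: upper_gradients_def)
  moreover have "(\<lambda>x. if x \<in> E then g1 x else g2 x) \<in> borel_measurable M"
    using g E(1) upper_gradients_measurable by (intro measurable_If_set) auto
  ultimately show "(\<lambda>x. if x \<in> E then g1 x else g2 x) \<in> Lloc M t"
    using t by (elim Lloc_mono[rotated]) auto
  have "exceptional M t (\<lambda>l \<gamma>. {s \<in> {0..l}. \<gamma> s \<in> E} \<notin> sets lebesgue \<or> \<not> good_curve u g1 l \<gamma> \<or> \<not> good_curve v g2 l \<gamma>)"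
    using t g E(2) by (intro exceptional_disj exceptional_not_good_curve)
  then show "exceptional M t (\<lambda>l \<gamma>. \<not> (curve_integral_defined l \<gamma> (\<lambda>x. if x \<in> E then g1 x else g2 x) \<and>
      ennreal \<bar>v (\<gamma> 0) - v (\<gamma> l)\<bar> \<le> curve_integral l \<gamma> (\<lambda>x. if x \<in> E then g1 x else g2 x)))"
    by (rule exceptional_mono) (use good_curve_glue[of _ _ u g1 v g2 E] eq in blast)
qed

lemma upper_gradients_glue_borel:
  assumes "0 < t" "g1 \<in> upper_gradients M t u" "g2 \<in> upper_gradients M t v"
    and E: "E \<in> sets borel" and "\<And>x. x \<in> E \<Longrightarrow> u x = v x"
  shows "(\<lambda>x. if x \<in> E then g1 x else g2 x) \<in> upper_gradients M t v"
proof (rule upper_gradients_glue[OF assms(1-3) borel_imp_sets[OF E] _ assms(5)])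
  have "exceptional M t (\<lambda>l \<gamma>. \<exists>c\<in>{}. False)" using assms(1) by (intro exceptional_UN) auto
  then show "exceptional M t (\<lambda>l \<gamma>. {s \<in> {0..l}. \<gamma> s \<in> E} \<notin> sets lebesgue)"
  proof (rule exceptional_contr)
    fix l :: real and \<gamma> :: "real \<Rightarrow> 'a"
    assume "arc_length_curve l \<gamma>" "{s \<in> {0..l}. \<gamma> s \<in> E} \<notin> sets lebesgue"
    then show False using arc_length_curve_vimage_borel[OF _ E] by metis
  qed
qed

text \<open>Gluing with \<open>u = v\<close> on the set where \<open>g1\<close> is the smaller one.
  This set is only known to be \<open>M\<close>-measurable, but its preimage under a good curve is
  measurable because \<open>g1\<close> and \<open>g2\<close> are measurable along it.\<close>

lemma upper_gradients_min:
  assumes t: "0 < t" and g: "g1 \<in> upper_gradients M t u" "g2 \<in> upper_gradients M t u"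
  shows "(\<lambda>x. min (g1 x) (g2 x)) \<in> upper_gradients M t u"
proof -
  have [measurable]: "g1 \<in> borel_measurable M" "g2 \<in> borel_measurable M"
    using g by (auto dest: upper_gradients_measurable)
  have "{x \<in> space M. g1 x \<le> g2 x} \<in> sets M" by measurable
  then have E: "{x. g1 x \<le> g2 x} \<in> sets M" by simp
  have "exceptional M t (\<lambda>l \<gamma>. \<not> good_curve u g1 l \<gamma> \<or> \<not> good_curve u g2 l \<gamma>)"
    using t g by (intro exceptional_disj exceptional_not_good_curve)
  then have "exceptional M t (\<lambda>l \<gamma>. {s \<in> {0..l}. \<gamma> s \<in> {x. g1 x \<le> g2 x}} \<notin> sets lebesgue)"
  proof (rule exceptional_contr)
    fix l \<gamma> assume non: "{s \<in> {0..l}. \<gamma> s \<in> {x. g1 x \<le> g2 x}} \<notin> sets lebesgue"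
      and "\<not> (\<not> good_curve u g1 l \<gamma> \<or> \<not> good_curve u g2 l \<gamma>)"
    then have [measurable]: "(\<lambda>s. g1 (\<gamma> s)) \<in> borel_measurable (lebesgue_on {0..l})"
      "(\<lambda>s. g2 (\<gamma> s)) \<in> borel_measurable (lebesgue_on {0..l})"
      by (auto simp: good_curve_def curve_integral_defined_def)
    have "{s \<in> space (lebesgue_on {0..l}). g1 (\<gamma> s) \<le> g2 (\<gamma> s)} \<in> sets (lebesgue_on {0..l})" by measurable
    then have "{s \<in> {0..l}. g1 (\<gamma> s) \<le> g2 (\<gamma> s)} \<in> sets lebesgue"
      by (auto simp: sets_restrict_space_iff space_restrict_space)
    with non show False by simp
  qed
  then have "(\<lambda>x. if x \<in> {x. g1 x \<le> g2 x} then g1 x else g2 x) \<in> upper_gradients M t u"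
    by (rule upper_gradients_glue[OF t g E]) simp
  then show ?thesis by (simp add: min_def)
qed

text \<open>Finite minima decrease to the infimum. Along a curve that is good for all of them the
  first has a finite integral, so decreasing convergence preserves the inequality.\<close>

lemma upper_gradients_INF:
  assumes t: "0 < t" and g: "\<And>n::nat. g n \<in> upper_gradients M t u"
  shows "(\<lambda>x. INF n. g n x) \<in> upper_gradients M t u"
proof -
  define h where "h n x = (INF i\<in>{..n}. g i x)" for n x
  have h_Suc: "h (Suc n) x = min (h n x) (g (Suc n) x)" for n x
    by (simp add: h_def atMost_Suc INF_insert inf_min min.commute)
  have h: "h n \<in> upper_gradients M t u" for n
  proof (induction n)
    case (Suc n)
    have "h (Suc n) = (\<lambda>x. min (h n x) (g (Suc n) x))" using h_Suc by blast
    then show ?case using upper_gradients_min[OF t Suc g] by simp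
  qed (use g[of 0] in \<open>simp add: h_def\<close>)
  have dec: "h n x \<le> h m x" if "m \<le> n" for m n x
    unfolding h_def using that by (intro INF_superset_mono) auto
  have Inf_eq: "(INF n. g n x) = (INF n. h n x)" for x
  proof (rule antisym)
    show "(INF n. g n x) \<le> (INF n. h n x)"
      unfolding h_def by (intro INF_greatest INF_lower) auto
    show "(INF n. h n x) \<le> (INF n. g n x)"
      by (intro INF_greatest INF_lower2[OF UNIV_I]) (auto simp: h_def intro: INF_lower)
  qed
  show ?thesis
    unfolding Inf_eq
  proof (rule upper_gradientsI[OF t])
    have hL: "h 0 \<in> Lloc M t" using h by (simp add: upper_gradients_def)
    have "(\<lambda>x. INF n. h n x) \<in> borel_measurable M"
      using h upper_gradients_measurable by (intro borel_measurable_INF) auto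
    then show "(\<lambda>x. INF n. h n x) \<in> Lloc M t"
      using t by (intro Lloc_mono[OF _ hL]) (auto intro: INF_lower)
    have "exceptional M t (\<lambda>l \<gamma>. \<exists>n. \<not> good_curve u (h n) l \<gamma>)"
      by (intro exceptional_UN_nat t exceptional_not_good_curve h)
    then show "exceptional M t (\<lambda>l \<gamma>. \<not> (curve_integral_defined l \<gamma> (\<lambda>x. INF n. h n x) \<and>
        ennreal \<bar>u (\<gamma> 0) - u (\<gamma> l)\<bar> \<le> curve_integral l \<gamma> (\<lambda>x. INF n. h n x)))"
    proof (rule exceptional_contr)
      fix l \<gamma> assume arc: "arc_length_curve l \<gamma>"
        and bad: "\<not> (curve_integral_defined l \<gamma> (\<lambda>x. INF n. h n x) \<and>
          ennreal \<bar>u (\<gamma> 0) - u (\<gamma> l)\<bar> \<le> curve_integral l \<gamma> (\<lambda>x. INF n. h n x))"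
        and "\<not> (\<exists>n. \<not> good_curve u (h n) l \<gamma>)"
      then have good: "good_curve u (h n) l \<gamma>" for n by blast
      have meas: "(\<lambda>s. h n (\<gamma> s)) \<in> borel_measurable (lebesgue_on {0..l})" for n
        using good[of n] by (simp add: good_curve_def curve_integral_defined_def)
      then have "curve_integral_defined l \<gamma> (\<lambda>x. INF n. h n x)"
        unfolding curve_integral_defined_def by (intro borel_measurable_INF) auto
      moreover have "curve_integral l \<gamma> (\<lambda>x. INF n. h n x) = (INF n. curve_integral l \<gamma> (h n))"
        unfolding curve_integral_def
      proof (rule nn_integral_monotone_convergence_INF_decseq)
        show "decseq (\<lambda>n s. h n (\<gamma> s))" by (intro antimonoI le_funI dec)
        show "(\<integral>\<^sup>+s. h 0 (\<gamma> s) \<partial>lebesgue_on {0..l}) < \<infinity>"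
          using good[of 0] by (simp add: good_curve_def curve_integral_def)
      qed (rule meas)
      moreover have "ennreal \<bar>u (\<gamma> 0) - u (\<gamma> l)\<bar> \<le> (INF n. curve_integral l \<gamma> (h n))"
        by (intro INF_greatest good_curveD(2)[OF good arc])
      ultimately show False using bad by simp
    qed
  qed
qed

lemma upper_gradients_Lipschitz:
  assumes t: "0 < t" and u: "\<kappa>-lipschitz_on UNIV u"
  shows "(\<lambda>_. ennreal \<kappa>) \<in> upper_gradients M t u"
proof (rule upper_gradientsI[OF t])
  have \<kappa>: "0 \<le> \<kappa>" using u by (rule lipschitz_on_nonneg)
  then show "(\<lambda>_. ennreal \<kappa>) \<in> Lloc M t" by (rule Lloc_const)
  \<comment> \<open>A union over no indices shows that the empty family is exceptional; arc length
    curves are 1-Lipschitz, so no curve violates the inequality.\<close>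
  have "exceptional M t (\<lambda>l \<gamma>. \<exists>c\<in>{}. False)" using t by (intro exceptional_UN) auto
  then show "exceptional M t (\<lambda>l \<gamma>. \<not> (curve_integral_defined l \<gamma> (\<lambda>_. ennreal \<kappa>) \<and>
      ennreal \<bar>u (\<gamma> 0) - u (\<gamma> l)\<bar> \<le> curve_integral l \<gamma> (\<lambda>_. ennreal \<kappa>)))"
  proof (rule exceptional_mono)
    fix l \<gamma> assume arc: "arc_length_curve l \<gamma>"
      and bad: "\<not> (curve_integral_defined l \<gamma> (\<lambda>_. ennreal \<kappa>) \<and>
      ennreal \<bar>u (\<gamma> 0) - u (\<gamma> l)\<bar> \<le> curve_integral l \<gamma> (\<lambda>_. ennreal \<kappa>))"
    have l: "0 < l" using arc by (simp add: arc_length_curve_def)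
    have "\<bar>u (\<gamma> 0) - u (\<gamma> l)\<bar> \<le> \<kappa> * dist (\<gamma> 0) (\<gamma> l)"
      using lipschitz_onD[OF u, of "\<gamma> 0" "\<gamma> l"] by (simp add: dist_real_def)
    also have "\<dots> \<le> \<kappa> * l"
      using arc_length_curve_dist[OF arc, of 0 l] l \<kappa> by (intro mult_left_mono) auto
    finally have "ennreal \<bar>u (\<gamma> 0) - u (\<gamma> l)\<bar> \<le> ennreal (\<kappa> * l)" by (rule ennreal_leI)
    also have "\<dots> = curve_integral l \<gamma> (\<lambda>_. ennreal \<kappa>)"
      unfolding curve_integral_eq using \<kappa> l by (simp add: nn_integral_cmult_indicator ennreal_mult)
    finally show "\<exists>c\<in>{}. False" using bad by (simp add: curve_integral_defined_def)
  qed
qed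

lemma upper_gradients_add:
  assumes t: "0 < t" and g: "g1 \<in> upper_gradients M t u1" "g2 \<in> upper_gradients M t u2"
  shows "(\<lambda>x. g1 x + g2 x) \<in> upper_gradients M t (\<lambda>x. u1 x + u2 x)"
proof (rule upper_gradientsI[OF t])
  show "(\<lambda>x. g1 x + g2 x) \<in> Lloc M t"
    using g by (intro Lloc_add t) (auto simp: upper_gradients_def)
  have "exceptional M t (\<lambda>l \<gamma>. \<not> good_curve u1 g1 l \<gamma> \<or> \<not> good_curve u2 g2 l \<gamma>)"
    using t g by (intro exceptional_disj exceptional_not_good_curve)
  then show "exceptional M t (\<lambda>l \<gamma>. \<not> (curve_integral_defined l \<gamma> (\<lambda>x. g1 x + g2 x) \<and>
      ennreal \<bar>u1 (\<gamma> 0) + u2 (\<gamma> 0) - (u1 (\<gamma> l) + u2 (\<gamma> l))\<bar> \<le> curve_integral l \<gamma> (\<lambda>x. g1 x + g2 x)))"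
  proof (rule exceptional_contr)
    fix l \<gamma> assume arc: "arc_length_curve l \<gamma>"
      and bad: "\<not> (curve_integral_defined l \<gamma> (\<lambda>x. g1 x + g2 x) \<and>
      ennreal \<bar>u1 (\<gamma> 0) + u2 (\<gamma> 0) - (u1 (\<gamma> l) + u2 (\<gamma> l))\<bar> \<le> curve_integral l \<gamma> (\<lambda>x. g1 x + g2 x))"
      and "\<not> (\<not> good_curve u1 g1 l \<gamma> \<or> \<not> good_curve u2 g2 l \<gamma>)"
    then have good: "good_curve u1 g1 l \<gamma>" "good_curve u2 g2 l \<gamma>" by blast+
    then have meas: "(\<lambda>s. g1 (\<gamma> s)) \<in> borel_measurable (lebesgue_on {0..l})"
      "(\<lambda>s. g2 (\<gamma> s)) \<in> borel_measurable (lebesgue_on {0..l})"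
      by (auto simp: good_curve_def curve_integral_defined_def)
    have "ennreal \<bar>u1 (\<gamma> 0) + u2 (\<gamma> 0) - (u1 (\<gamma> l) + u2 (\<gamma> l))\<bar> \<le>
        ennreal (\<bar>u1 (\<gamma> 0) - u1 (\<gamma> l)\<bar> + \<bar>u2 (\<gamma> 0) - u2 (\<gamma> l)\<bar>)"
      by (intro ennreal_leI) linarith
    also have "\<dots> = ennreal \<bar>u1 (\<gamma> 0) - u1 (\<gamma> l)\<bar> + ennreal \<bar>u2 (\<gamma> 0) - u2 (\<gamma> l)\<bar>"
      by simp
    also have "\<dots> \<le> curve_integral l \<gamma> g1 + curve_integral l \<gamma> g2"
      by (intro add_mono good_curveD(2)[OF _ arc] good)
    also have "\<dots> = curve_integral l \<gamma> (\<lambda>x. g1 x + g2 x)"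
      unfolding curve_integral_def using meas by (simp add: nn_integral_add)
    finally show False using bad meas by (simp add: curve_integral_defined_def)
  qed
qed

lemma upper_gradients_cmult:
  assumes t: "0 < t" and c: "0 < c" and g: "g \<in> upper_gradients M t u"
  shows "(\<lambda>x. ennreal c * g x) \<in> upper_gradients M t (\<lambda>x. c * u x)"
proof (rule upper_gradientsI[OF t])
  have gL: "g \<in> Lloc M t" using g by (simp add: upper_gradients_def)
  have meas: "g \<in> borel_measurable M" using gL by (simp add: Lloc_def)
  have "(\<integral>\<^sup>+y\<in>ball x r. ennreal_powr (ennreal c * g y) t \<partial>M) =
      ennreal (c powr t) * (\<integral>\<^sup>+y\<in>ball x r. ennreal_powr (g y) t \<partial>M)" for x r
    using meas by (simp add: ennreal_powr_cmult[OF c] mult.assoc nn_integral_cmult measurable_ennreal_powr)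
  then have scale: "(\<integral>\<^sup>+y\<in>ball x r. ennreal_powr (ennreal c * g y) t \<partial>M) < \<infinity>"
    if "(\<integral>\<^sup>+y\<in>ball x r. ennreal_powr (g y) t \<partial>M) < \<infinity>" for x r
    using that by (simp add: ennreal_mult_less_top)
  then show "(\<lambda>x. ennreal c * g x) \<in> Lloc M t"
  proof -
    have "(\<lambda>x. ennreal c * g x) \<in> borel_measurable M" using meas by simp
    then show ?thesis using gL scale unfolding Lloc_def mem_Collect_eq by meson
  qed
  show "exceptional M t (\<lambda>l \<gamma>. \<not> (curve_integral_defined l \<gamma> (\<lambda>x. ennreal c * g x) \<and>
      ennreal \<bar>c * u (\<gamma> 0) - c * u (\<gamma> l)\<bar> \<le> curve_integral l \<gamma> (\<lambda>x. ennreal c * g x)))"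
  proof (rule exceptional_contr[OF exceptional_not_good_curve[OF t g]])
    fix l \<gamma> assume arc: "arc_length_curve l \<gamma>"
      and bad: "\<not> (curve_integral_defined l \<gamma> (\<lambda>x. ennreal c * g x) \<and>
      ennreal \<bar>c * u (\<gamma> 0) - c * u (\<gamma> l)\<bar> \<le> curve_integral l \<gamma> (\<lambda>x. ennreal c * g x))"
      and "\<not> \<not> good_curve u g l \<gamma>"
    then have good: "good_curve u g l \<gamma>" by blast
    then have meas: "(\<lambda>s. g (\<gamma> s)) \<in> borel_measurable (lebesgue_on {0..l})"
      by (simp add: good_curve_def curve_integral_defined_def)
    have "\<bar>c * u (\<gamma> 0) - c * u (\<gamma> l)\<bar> = c * \<bar>u (\<gamma> 0) - u (\<gamma> l)\<bar>"
      using c by (simp add: abs_mult flip: right_diff_distrib)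
    then have "ennreal \<bar>c * u (\<gamma> 0) - c * u (\<gamma> l)\<bar> = ennreal c * ennreal \<bar>u (\<gamma> 0) - u (\<gamma> l)\<bar>"
      using c by (simp add: ennreal_mult)
    also have "\<dots> \<le> ennreal c * curve_integral l \<gamma> g"
      by (intro mult_left_mono good_curveD(2)[OF good arc]) simp
    also have "\<dots> = curve_integral l \<gamma> (\<lambda>x. ennreal c * g x)"
      unfolding curve_integral_def using meas by (simp add: nn_integral_cmult)
    finally show False using bad meas by (simp add: curve_integral_defined_def)
  qed
qed

lemma upper_gradients_sum:
  assumes t: "0 < t" and "finite I" "\<And>i. i \<in> I \<Longrightarrow> g i \<in> upper_gradients M t (u i)"
  shows "(\<lambda>x. \<Sum>i\<in>I. g i x) \<in> upper_gradients M t (\<lambda>x. \<Sum>i\<in>I. u i x)"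
  using assms(2,3)
proof (induction I rule: finite_induct)
  case empty
  have "0-lipschitz_on UNIV (\<lambda>x::'a. 0::real)" by (auto intro: lipschitz_onI)
  from upper_gradients_Lipschitz[OF t this] show ?case by simp
next
  case (insert i I)
  then show ?case using upper_gradients_add[OF t, of "g i" "u i"] by simp
qed

text \<open>Minimize a weighted integral over all upper gradients. Cutting off at the Lipschitz
  constant and using a positive weight of finite integral keep the functional finite; if the
  minimizer exceeded some \<open>k\<close> on a set of positive measure, the minimum of both would
  do better.\<close>

lemma minimal_upper_gradient_exists:
  assumes t: "0 < t" and u: "u \<in> Lip"
  obtains g where "minimal_upper_gradient M t u g"
proof -
  obtain \<kappa> where \<kappa>: "\<kappa>-lipschitz_on UNIV u" using u by (auto simp: Lip_def)
  interpret sigma_finite_measure M by (rule sigma_finite)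
  obtain w where w: "w \<in> borel_measurable M" "integral\<^sup>N M w \<noteq> \<infinity>" "\<And>x. 0 < w x \<and> w x < \<infinity>"
    using Ex_finite_integrable_function by auto
  define trunc where "trunc g = (\<lambda>x. min (g x) (ennreal \<kappa>))" for g :: "'a \<Rightarrow> ennreal"
  define J where "J g = (\<integral>\<^sup>+x. trunc g x * w x \<partial>M)" for g
  have trunc: "trunc g \<in> upper_gradients M t u" if "g \<in> upper_gradients M t u" for g
    unfolding trunc_def by (intro upper_gradients_min t that upper_gradients_Lipschitz \<kappa>)
  have J_fin: "J g < \<infinity>" for g
  proof -
    have "J g \<le> (\<integral>\<^sup>+x. ennreal \<kappa> * w x \<partial>M)"
      unfolding J_def trunc_def by (intro nn_integral_mono mult_right_mono) auto
    also have "\<dots> < \<infinity>" using w by (simp add: nn_integral_cmult ennreal_mult_less_top less_top)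
    finally show ?thesis .
  qed
  have "J ` upper_gradients M t u \<noteq> {}" using upper_gradients_Lipschitz[OF t \<kappa>] by blast
  from ennreal_Inf_countable_INF[OF this] obtain f where
    f0: "decseq f \<and> range f \<subseteq> J ` upper_gradients M t u \<and> Inf (J ` upper_gradients M t u) = (INF n. f n)"
    by (elim exE)
  note f = f0[THEN conjunct2, THEN conjunct1] f0[THEN conjunct2, THEN conjunct2]
  have "f n \<in> J ` upper_gradients M t u" for n using f(1) by (rule subsetD) (rule rangeI)
  then have "\<exists>g. g \<in> upper_gradients M t u \<and> f n = J g" for n unfolding image_iff by metis
  then obtain g where g: "\<And>n. g n \<in> upper_gradients M t u" "\<And>n. f n = J (g n)" by metis
  define h where "h x = (INF n. trunc (g n) x)" for x
  have h: "h \<in> upper_gradients M t u"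
    unfolding h_def by (intro upper_gradients_INF t trunc g)
  have h_le: "h x \<le> ennreal \<kappa>" for x
    unfolding h_def by (rule INF_lower2[of 0]) (auto simp: trunc_def)
  have J_min: "J h \<le> J k" if "k \<in> upper_gradients M t u" for k
  proof -
    have "J h \<le> f n" for n
      unfolding g(2) J_def
    proof (intro nn_integral_mono mult_right_mono)
      fix x
      have "h x \<le> trunc (g n) x" unfolding h_def by (rule INF_lower) simp
      then show "trunc h x \<le> trunc (g n) x" by (auto simp: trunc_def min.coboundedI1)
    qed simp
    then have "J h \<le> Inf (J ` upper_gradients M t u)" unfolding f(2) by (rule INF_greatest)
    also have "\<dots> \<le> J k" using that by (intro Inf_lower) auto
    finally show ?thesis .
  qed
  show thesis
  proof (rule that, unfold minimal_upper_gradient_def, intro conjI ballI)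
    show "h \<in> upper_gradients M t u" by (rule h)
    fix k assume k: "k \<in> upper_gradients M t u"
    let ?m = "\<lambda>x. min (h x) (k x)"
    have m: "?m \<in> upper_gradients M t u" by (intro upper_gradients_min t h k)
    have eq: "trunc h = h" "trunc ?m = ?m" using h_le by (simp_all add: trunc_def fun_eq_iff min.absorb1 min.coboundedI1)
    have meas: "(\<lambda>x. h x * w x) \<in> borel_measurable M" "(\<lambda>x. ?m x * w x) \<in> borel_measurable M"
      using h m w(1) by (auto intro!: borel_measurable_times_ennreal dest: upper_gradients_measurable)
    have fin: "(\<integral>\<^sup>+x. h x * w x \<partial>M) < \<infinity>" "(\<integral>\<^sup>+x. ?m x * w x \<partial>M) < \<infinity>"
      using J_fin[of h] J_fin[of ?m] by (simp_all add: J_def eq)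
    have "(\<integral>\<^sup>+x. h x * w x - ?m x * w x \<partial>M) = (\<integral>\<^sup>+x. h x * w x \<partial>M) - (\<integral>\<^sup>+x. ?m x * w x \<partial>M)"
      using meas fin by (intro nn_integral_diff) (auto intro!: AE_I2 mult_right_mono simp: less_top)
    also have "\<dots> = 0"
      using J_min[OF m] fin by (simp add: J_def eq diff_eq_0_iff_ennreal)
    finally have "AE x in M. h x * w x - ?m x * w x = 0"
      using meas by (subst (asm) nn_integral_0_iff_AE) (auto intro!: borel_measurable_minus_ennreal)
    then show "AE x in M. h x \<le> k x"
    proof (rule eventually_mono)
      fix x assume "h x * w x - ?m x * w x = 0"
      then have "w x * h x \<le> w x * ?m x" by (simp add: diff_eq_0_iff_ennreal mult.commute)
      then have "h x \<le> ?m x" using w(3)[of x] by (subst (asm) ennreal_mult_le_mult_iff) auto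
      then show "h x \<le> k x" by simp
    qed
  qed
qed

end

section \<open>Oscillations at a fixed level\<close>

lemma powr_abs_add_le:
  fixes a b :: real
  assumes "0 < p"
  shows "\<bar>a + b\<bar> powr p \<le> 2 powr p * (\<bar>a\<bar> powr p + \<bar>b\<bar> powr p)"
proof -
  have "\<bar>a + b\<bar> powr p \<le> (2 * max \<bar>a\<bar> \<bar>b\<bar>) powr p"
    using assms by (intro powr_mono2) auto
  also have "\<dots> = 2 powr p * max \<bar>a\<bar> \<bar>b\<bar> powr p" by (simp add: powr_mult)
  also have "\<dots> \<le> 2 powr p * (\<bar>a\<bar> powr p + \<bar>b\<bar> powr p)"
    by (intro mult_left_mono) (auto simp: max_def)
  finally show ?thesis .
qed

lemma le_powr_self: "1 \<le> a \<Longrightarrow> 1 \<le> p \<Longrightarrow> a \<le> a powr p" for a p :: real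
  using powr_mono[of 1 p a] by simp

lemma le_of_le_add_geometric:
  fixes a b C :: real
  assumes "\<And>n. a \<le> b + C / 2 ^ n"
  shows "a \<le> b"
proof (rule LIMSEQ_le_const)
  have "(\<lambda>n. b + C * (1 / 2) ^ n) \<longlonglongrightarrow> b + C * 0"
    by (intro tendsto_intros LIMSEQ_realpow_zero) auto
  then show "(\<lambda>n. b + C / 2 ^ n) \<longlonglongrightarrow> b" by (simp add: power_divide)
  show "\<exists>N. \<forall>n\<ge>N. a \<le> b + C / 2 ^ n" using assms by blast
qed

text \<open>The extension is the infimum of \<open>u y + L * dist x y\<close> over \<open>y\<close>
  in \<open>E\<close>; comparison with one point \<open>e\<close> of \<open>E\<close> bounds it
  below.\<close>

lemma mcshane_extension:
  fixes u :: "'a::metric_space \<Rightarrow> real"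
  assumes L: "0 \<le> L" and u: "\<And>x y. x \<in> E \<Longrightarrow> y \<in> E \<Longrightarrow> \<bar>u x - u y\<bar> \<le> L * dist x y"
  obtains w where "L-lipschitz_on UNIV w" "\<And>x. x \<in> E \<Longrightarrow> w x = u x"
proof (cases "E = {}")
  case True
  show thesis by (rule that[of "\<lambda>_. 0"]) (use True L in \<open>auto intro!: lipschitz_onI\<close>)
next
  case False
  then obtain e where e: "e \<in> E" by blast
  define w where "w x = (INF y\<in>E. u y + L * dist x y)" for x
  have lower: "u e - L * dist x e \<le> u y + L * dist x y" if "y \<in> E" for x y
  proof -
    have "L * dist e y \<le> L * (dist x e + dist x y)"
      using dist_triangle3[of e y x] L by (intro mult_left_mono) auto
    then show ?thesis using u[OF e that] by (simp add: distrib_left)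
  qed
  have bdd: "bdd_below ((\<lambda>y. u y + L * dist x y) ` E)" for x
    by (rule bdd_belowI2[of _ "u e - L * dist x e"]) (rule lower)
  have half: "w x \<le> w y + L * dist x y" for x y
  proof -
    have "w x - L * dist x y \<le> u v + L * dist y v" if "v \<in> E" for v
    proof -
      have "w x \<le> u v + L * dist x v" unfolding w_def using bdd that by (rule cINF_lower)
      moreover have "L * dist x v \<le> L * (dist x y + dist y v)"
        using L by (intro mult_left_mono dist_triangle)
      ultimately show ?thesis by (simp add: distrib_left)
    qed
    then have "w x - L * dist x y \<le> w y" unfolding w_def[of y] using False by (intro cINF_greatest)
    then show ?thesis by simp
  qed
  show thesis
  proof (rule that)
    show "L-lipschitz_on UNIV w"
    proof (rule lipschitz_onI)
      fix x y
      show "dist (w x) (w y) \<le> L * dist x y"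
        using half[of x y] half[of y x] by (auto simp: dist_real_def abs_le_iff dist_commute)
    qed (rule L)
    fix x assume x: "x \<in> E"
    show "w x = u x"
    proof (rule antisym)
      show "w x \<le> u x" using cINF_lower[OF bdd x, of x] by (simp add: w_def)
      show "u x \<le> w x"
        unfolding w_def
      proof (rule cINF_greatest[OF False])
        fix y assume "y \<in> E"
        then show "u x \<le> u y + L * dist x y" using u[OF x, of y] by linarith
      qed
    qed
  qed
qed

lemma Lip_borel_measurable: "u \<in> Lip \<Longrightarrow> u \<in> borel_measurable borel"
  unfolding Lip_def by (blast intro: borel_measurable_continuous_onI lipschitz_on_continuous_on)

lemma diameter_ball_le:
  fixes x :: "'a::metric_space"
  assumes "0 < r"
  shows "diameter (ball x r) \<le> 2 * r"
proof -
  have "dist a b \<le> 2 * r" if "a \<in> ball x r" "b \<in> ball x r" for a b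
    using that dist_triangle[of a b x] by (auto simp: dist_commute)
  then show ?thesis
    unfolding diameter_def using assms by (auto intro!: cSUP_least)
qed

text \<open>Both measures share one doubling constant \<open>D\<close>. The gap
  \<open>\<tau>\<close> between \<open>p\<close> and the balance exponent is the source of the gain
  in truncation errors.\<close>

locale geodesic_space_pair =
  nu: doubling_space \<nu> D + mu: doubling_space \<mu> D
  for \<nu> \<mu> :: "'a::metric_space measure" and D :: real +
  fixes p \<tau> C\<^sub>b K :: real
  assumes two_points: "\<exists>x y :: 'a. x \<noteq> y"
    and geodesic: "(x::'a) \<noteq> y \<Longrightarrow> \<exists>l \<gamma>. arc_length_curve l \<gamma> \<and> \<gamma> 0 = x \<and> \<gamma> l = y \<and> l = dist x y"
    and p: "1 < p" and \<tau>: "0 < \<tau>" "\<tau> < p"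
    and C\<^sub>b: "0 < C\<^sub>b" and balance: "balance_condition \<nu> \<mu> (p - \<tau>) C\<^sub>b"
    and K: "0 < K" and poincare: "poincare_inequality \<nu> \<mu> p p K"
begin

text \<open>The curve is 1-Lipschitz, so the distances from its point at parameter \<open>d\<close>
  to both ends are at most the lengths of the two parts, and the triangle inequality forces
  equality.\<close>

lemma geodesic_point:
  assumes "0 \<le> d" "d \<le> dist x y"
  obtains z :: 'a where "dist x z = d" "dist z y = dist x y - d"
proof (cases "x = y")
  case True
  then show thesis using that[of x] assms by simp
next
  case False
  from geodesic[OF False] obtain \<gamma> where \<gamma>: "arc_length_curve (dist x y) \<gamma>" "\<gamma> 0 = x" "\<gamma> (dist x y) = y"
    by metis
  have "dist x (\<gamma> d) \<le> d" using arc_length_curve_dist[OF \<gamma>(1), of 0 d] assms \<gamma>(2) by simp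
  moreover have "dist (\<gamma> d) y \<le> dist x y - d"
    using arc_length_curve_dist[OF \<gamma>(1), of d "dist x y"] assms \<gamma>(3) by simp
  ultimately have "dist x (\<gamma> d) = d" "dist (\<gamma> d) y = dist x y - d"
    using dist_triangle[of x y "\<gamma> d"] by linarith+
  then show thesis by (rule that)
qed

text \<open>In a bounded space the radius of a ball can be much larger than its diameter; fitting radii
  exclude this.\<close>

definition fits :: "real \<Rightarrow> bool" where
  "fits r \<longleftrightarrow> (\<exists>a b :: 'a. r \<le> 4 * dist a b)"

lemma fits_mono: "fits r \<Longrightarrow> s \<le> r \<Longrightarrow> fits s"
  unfolding fits_def by (meson order_trans)

text \<open>Two points at distance at least \<open>r / 4\<close> cannot both be closer than
  \<open>r / 8\<close> to \<open>x\<close>, and a geodesic from \<open>x\<close> to the farther one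
  contains a point at distance exactly \<open>r / 8\<close>.\<close>

lemma fits_diameter:
  assumes "fits r" "0 < r"
  shows "r / 8 \<le> diameter (ball (x::'a) r)"
proof -
  obtain a b :: 'a where "r \<le> 4 * dist a b" using assms(1) by (auto simp: fits_def)
  then have "r / 8 \<le> dist x a \<or> r / 8 \<le> dist x b" using dist_triangle3[of a b x] by linarith
  then obtain y where "r / 8 \<le> dist x y" by blast
  then obtain z where z: "dist x z = r / 8" using geodesic_point[of "r / 8" x y] assms(2) by (metis divide_nonneg_pos less_imp_le zero_less_numeral)
  then show ?thesis
    using diameter_bounded_bound[OF bounded_ball[of x r], of x z] assms(2) by simp
qed

text \<open>If \<open>r\<close> does not fit, the space is bounded. Four times a distance that
  exceeds half the diameter of the space is then a fitting radius, smaller than \<open>r\<close>,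
  whose ball is still the whole space.\<close>

lemma fits_shrink:
  assumes "0 < r"
  obtains s where "0 < s" "s \<le> r" "fits s" "ball (z::'a) s = ball z r"
proof (cases "fits r")
  case True
  then show thesis using that assms by blast
next
  case False
  then have all: "4 * dist a b < r" for a b :: 'a by (auto simp: fits_def not_le)
  define d where "d = (SUP (a, b)\<in>(UNIV :: ('a \<times> 'a) set). dist a b)"
  have bdd: "bdd_above ((\<lambda>(a::'a, b). dist a b) ` UNIV)"
    by (rule bdd_aboveI2[of _ _ "r / 4"]) (use all in \<open>auto simp: less_imp_le field_simps\<close>)
  have le: "dist a b \<le> d" for a b :: 'a
    unfolding d_def using cSUP_upper[OF UNIV_I bdd, of "(a, b)"] by simp
  obtain x0 y0 :: 'a where "x0 \<noteq> y0" using two_points by blast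
  then have "0 < d" using le[of x0 y0] zero_less_dist_iff[of x0 y0] by linarith
  then have "d / 2 < d" by simp
  then obtain a b :: 'a where ab: "d / 2 < dist a b"
    unfolding d_def using less_cSUP_iff[OF _ bdd, of "d / 2"] by (auto simp: d_def)
  show thesis
  proof (rule that[of "4 * dist a b"])
    show "0 < 4 * dist a b" using ab \<open>0 < d\<close> by linarith
    show "4 * dist a b \<le> r" using all[of a b] by simp
    show "fits (4 * dist a b)" by (auto simp: fits_def)
    have "dist z y < 4 * dist a b" "dist z y < r" for y
      using le[of z y] ab all[of a b] zero_le_dist[of z y] by linarith+
    then show "ball z (4 * dist a b) = ball z r" by auto
  qed
qed

text \<open>Compared with the sharp maximal function, \<open>controlled\<close> uses the best constant instead of the
  average and the radius instead of the diameter.\<close>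

definition osc :: "('a \<Rightarrow> real) \<Rightarrow> 'a \<Rightarrow> real \<Rightarrow> real \<Rightarrow> ennreal" where
  "osc u x r c = (\<integral>\<^sup>+y\<in>ball x r. ennreal (\<bar>u y - c\<bar> powr p) \<partial>\<nu>)"

definition controlled :: "('a \<Rightarrow> real) \<Rightarrow> 'a \<Rightarrow> real \<Rightarrow> real \<Rightarrow> bool" where
  "controlled u x r s \<longleftrightarrow> (\<exists>c. osc u x r c \<le> ennreal ((s * r) powr p * measure \<nu> (ball x r)))"

section \<open>Oscillation estimates on controlled balls\<close>

lemma nu_pos: "0 < r \<Longrightarrow> 0 < measure \<nu> (ball x r)" and mu_pos: "0 < r \<Longrightarrow> 0 < measure \<mu> (ball x r)"
  by (rule nu.measure_ball_pos mu.measure_ball_pos; assumption)+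

lemma osc_mono:
  assumes "ball x r \<subseteq> ball y s"
  shows "osc u x r c \<le> osc u y s c"
  unfolding osc_def by (rule nn_set_integral_set_mono[OF assms])

lemma osc_le_const:
  assumes "\<And>y. y \<in> ball x r \<Longrightarrow> \<bar>u y - c\<bar> \<le> b"
  shows "osc u x r c \<le> ennreal (b powr p * measure \<nu> (ball x r))"
proof -
  have "osc u x r c \<le> (\<integral>\<^sup>+y\<in>ball x r. ennreal (b powr p) \<partial>\<nu>)"
    unfolding osc_def using p assms
    by (intro nn_integral_mono) (auto split: split_indicator intro!: ennreal_leI powr_mono2)
  also have "\<dots> = ennreal (b powr p * measure \<nu> (ball x r))"
    by (simp add: nn_integral_cmult_indicator nu.emeasure_ball ennreal_mult)
  finally show ?thesis .
qed

lemma nn_integral_powr_triangle: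
  assumes "u \<in> Lip" "v \<in> Lip" "w \<in> Lip"
  shows "(\<integral>\<^sup>+y\<in>ball x r. ennreal (\<bar>u y - v y\<bar> powr p) \<partial>\<nu>) \<le>
    ennreal (2 powr p) * ((\<integral>\<^sup>+y\<in>ball x r. ennreal (\<bar>u y - w y\<bar> powr p) \<partial>\<nu>) +
      (\<integral>\<^sup>+y\<in>ball x r. ennreal (\<bar>w y - v y\<bar> powr p) \<partial>\<nu>))"
proof -
  have [measurable]: "u \<in> borel_measurable \<nu>" "v \<in> borel_measurable \<nu>" "w \<in> borel_measurable \<nu>"
    using assms by (auto intro: nu.borel_imp_measurable Lip_borel_measurable)
  have pt: "ennreal (\<bar>u y - v y\<bar> powr p) \<le>
      ennreal (2 powr p) * (ennreal (\<bar>u y - w y\<bar> powr p) + ennreal (\<bar>w y - v y\<bar> powr p))" for y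
    using powr_abs_add_le[of p "u y - w y" "w y - v y"] p
    by (simp flip: ennreal_plus ennreal_mult add: ennreal_leI)
  have "(\<integral>\<^sup>+y\<in>ball x r. ennreal (\<bar>u y - v y\<bar> powr p) \<partial>\<nu>) \<le>
    (\<integral>\<^sup>+y. ennreal (2 powr p) * (ennreal (\<bar>u y - w y\<bar> powr p) * indicator (ball x r) y +
      ennreal (\<bar>w y - v y\<bar> powr p) * indicator (ball x r) y) \<partial>\<nu>)"
    using pt by (intro nn_integral_mono) (auto split: split_indicator)
  also have "\<dots> = ennreal (2 powr p) * ((\<integral>\<^sup>+y\<in>ball x r. ennreal (\<bar>u y - w y\<bar> powr p) \<partial>\<nu>) +
      (\<integral>\<^sup>+y\<in>ball x r. ennreal (\<bar>w y - v y\<bar> powr p) \<partial>\<nu>))"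
    by (subst nn_integral_cmult, measurable, subst nn_integral_add, measurable)
  finally show ?thesis .
qed

lemma const_Lip: "(\<lambda>_. c) \<in> Lip"
  unfolding Lip_def by (auto intro!: exI[of _ 0] lipschitz_onI)

text \<open>Both constants are close to \<open>u\<close> in the mean, hence to each other; the
  factor 4 arises from \<open>2 powr p * 2 \<le> 4 powr p\<close>.\<close>

lemma osc_const_diff:
  assumes u: "u \<in> Lip" and r: "0 < r" and \<sigma>: "0 < \<sigma>"
    and c: "osc u x r c \<le> ennreal (\<sigma> powr p * measure \<nu> (ball x r))"
    and d: "osc u x r d \<le> ennreal (\<sigma> powr p * measure \<nu> (ball x r))"
  shows "\<bar>c - d\<bar> \<le> 4 * \<sigma>"
proof -
  let ?m = "measure \<nu> (ball x r)"
  have "ennreal (\<bar>c - d\<bar> powr p * ?m) = (\<integral>\<^sup>+y\<in>ball x r. ennreal (\<bar>c - d\<bar> powr p) \<partial>\<nu>)"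
    by (simp add: nn_integral_cmult_indicator nu.emeasure_ball ennreal_mult)
  also have "\<dots> \<le> ennreal (2 powr p) * (osc u x r c + osc u x r d)"
    using nn_integral_powr_triangle[of "\<lambda>_. c" "\<lambda>_. d" u x r, OF const_Lip const_Lip u]
    by (simp add: osc_def abs_minus_commute)
  also have "\<dots> \<le> ennreal (2 powr p) * (ennreal (\<sigma> powr p * ?m) + ennreal (\<sigma> powr p * ?m))"
    by (intro mult_left_mono add_mono c d) simp
  also have "\<dots> = ennreal (2 powr p * 2 * \<sigma> powr p * ?m)"
    by (simp flip: ennreal_plus ennreal_mult add: algebra_simps)
  finally have "\<bar>c - d\<bar> powr p * ?m \<le> 2 powr p * 2 * \<sigma> powr p * ?m" by simp
  then have "\<bar>c - d\<bar> powr p \<le> 2 powr p * 2 * \<sigma> powr p" using nu_pos[OF r, of x] by simp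
  also have "\<dots> \<le> 2 powr p * 2 powr p * \<sigma> powr p"
    using le_powr_self[of 2 p] p by (intro mult_right_mono mult_left_mono) auto
  also have "\<dots> = (4 * \<sigma>) powr p" using \<sigma> by (simp flip: powr_mult)
  finally show ?thesis
    using \<sigma> p powr_less_mono2[of p "4 * \<sigma>" "\<bar>c - d\<bar>"] by (meson less_imp_le linorder_not_le mult_pos_pos not_less zero_less_numeral less_trans zero_less_one)
qed

lemma controlled_mono:
  assumes "controlled u x r s" "0 \<le> s" "s \<le> t" "0 \<le> r"
  shows "controlled u x r t"
proof -
  have "(s * r) powr p * measure \<nu> (ball x r) \<le> (t * r) powr p * measure \<nu> (ball x r)"
    using assms p by (intro mult_right_mono powr_mono2) auto
  then show ?thesis using assms(1) unfolding controlled_def by (meson ennreal_leI order_trans)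
qed

text \<open>A doubling factor \<open>D ^ n\<close> of the measure is thereby absorbed into the
  \<open>p\<close>-th power, where it becomes a factor \<open>D ^ n\<close> of the level.\<close>

lemma D_powr: "D ^ n \<le> (D ^ n) powr p"
  using nu.D_gt_1 p by (intro le_powr_self one_le_power) auto

text \<open>Good constants on successive concentric balls differ by the terms of a geometric
  sequence, and they converge to \<open>u x\<close>.\<close>

lemma telescoping:
  assumes u: "u \<in> Lip" and \<rho>: "0 < \<rho>" and s: "0 < s"
    and ctrl: "\<And>n. controlled u x (\<rho> / 2 ^ n) s"
    and c: "osc u x \<rho> c \<le> ennreal ((s * \<rho>) powr p * measure \<nu> (ball x \<rho>))"
  shows "\<bar>u x - c\<bar> \<le> 8 * D * s * \<rho>"
proof -
  note D = nu.D_gt_1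
  obtain \<kappa> where \<kappa>: "\<kappa>-lipschitz_on UNIV u" using u by (auto simp: Lip_def)
  then have "0 \<le> \<kappa>" by (rule lipschitz_on_nonneg)
  define \<rho>' where "\<rho>' n = \<rho> / 2 ^ n" for n
  have \<rho>': "0 < \<rho>' n" "\<rho>' n = 2 * \<rho>' (Suc n)" for n using \<rho> by (auto simp: \<rho>'_def)
  have "\<exists>c'. osc u x (\<rho>' n) c' \<le> ennreal ((s * \<rho>' n) powr p * measure \<nu> (ball x (\<rho>' n))) \<and>
      (n = 0 \<longrightarrow> c' = c)" for n
    using ctrl[of n] c unfolding controlled_def \<rho>'_def by (cases n) auto
  then obtain f where f: "\<And>n. osc u x (\<rho>' n) (f n) \<le> ennreal ((s * \<rho>' n) powr p * measure \<nu> (ball x (\<rho>' n)))"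
    and f0: "f 0 = c" by metis
  have step: "\<bar>f (Suc n) - f n\<bar> \<le> 4 * (D * s * \<rho>' n)" for n
  proof (rule osc_const_diff[OF u \<rho>'(1)[of "Suc n"]])
    show "0 < D * s * \<rho>' n" using D s \<rho>'(1) by simp
    have "(s * \<rho>' (Suc n)) powr p \<le> (D * s * \<rho>' n) powr p"
    proof (rule powr_mono2)
      have "\<rho>' (Suc n) \<le> \<rho>' n" using \<rho>'(1)[of "Suc n"] \<rho>'(2)[of n] by linarith
      then have "s * \<rho>' (Suc n) \<le> s * \<rho>' n" using s by (intro mult_left_mono) auto
      also have "\<dots> \<le> D * (s * \<rho>' n)" using D s \<rho>'(1)[of n] by simp
      finally show "s * \<rho>' (Suc n) \<le> D * s * \<rho>' n" by simp
    qed (use p s \<rho>'(1)[of "Suc n"] in auto)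
    then show "osc u x (\<rho>' (Suc n)) (f (Suc n)) \<le>
        ennreal ((D * s * \<rho>' n) powr p * measure \<nu> (ball x (\<rho>' (Suc n))))"
      by (intro order_trans[OF f] ennreal_leI mult_right_mono) auto
    have "osc u x (\<rho>' (Suc n)) (f n) \<le> osc u x (\<rho>' n) (f n)"
      using \<rho>'(1)[of "Suc n"] \<rho>'(2)[of n] by (intro osc_mono subset_ball) simp
    also have "\<dots> \<le> ennreal ((s * \<rho>' n) powr p * measure \<nu> (ball x (\<rho>' n)))" by (rule f)
    also have "\<dots> \<le> ennreal ((D * s * \<rho>' n) powr p * measure \<nu> (ball x (\<rho>' (Suc n))))"
    proof (rule ennreal_leI)
      have "(s * \<rho>' n) powr p * measure \<nu> (ball x (\<rho>' n)) \<le>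
          (s * \<rho>' n) powr p * (D * measure \<nu> (ball x (\<rho>' (Suc n))))"
        unfolding \<rho>'(2)[of n] using nu.doubling[OF \<rho>'(1)[of "Suc n"]] by (intro mult_left_mono) auto
      also have "\<dots> \<le> (s * \<rho>' n) powr p * (D powr p * measure \<nu> (ball x (\<rho>' (Suc n))))"
        using D_powr[of 1] by (intro mult_left_mono mult_right_mono) auto
      also have "\<dots> = (D * s * \<rho>' n) powr p * measure \<nu> (ball x (\<rho>' (Suc n)))"
        using D s \<rho>'(1)[of n] by (simp add: powr_mult)
      finally show "(s * \<rho>' n) powr p * measure \<nu> (ball x (\<rho>' n)) \<le>
        (D * s * \<rho>' n) powr p * measure \<nu> (ball x (\<rho>' (Suc n)))" .
    qed
    finally show "osc u x (\<rho>' (Suc n)) (f n) \<le>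
        ennreal ((D * s * \<rho>' n) powr p * measure \<nu> (ball x (\<rho>' (Suc n))))" .
  qed
  \<comment> \<open>The subtracted term makes the induction close: it is the part of the geometric
    series not yet used.\<close>
  have sum: "\<bar>f n - c\<bar> \<le> 8 * D * s * \<rho> - 8 * D * s * \<rho>' n" for n
  proof (induction n)
    case 0
    then show ?case by (simp add: f0 \<rho>'_def)
  next
    case (Suc n)
    have "8 * D * s * \<rho>' n = 8 * D * s * \<rho>' (Suc n) + 4 * (D * s * \<rho>' n)"
      using \<rho>'(2)[of n] by simp
    then show ?case using Suc step[of n] by linarith
  qed
  \<comment> \<open>The Lipschitz constant enters only here, in a term that vanishes as
    \<open>n\<close> grows, so the final bound does not depend on it.\<close>
  have close: "\<bar>u x - f n\<bar> \<le> 4 * ((\<kappa> + s) * \<rho>' n)" for n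
  proof (rule osc_const_diff[OF u \<rho>'(1)[of n], where x = x])
    show "0 < (\<kappa> + s) * \<rho>' n" using \<open>0 \<le> \<kappa>\<close> s \<rho>'(1) by simp
    have "(s * \<rho>' n) powr p \<le> ((\<kappa> + s) * \<rho>' n) powr p"
      using \<open>0 \<le> \<kappa>\<close> s \<rho>'(1)[of n] p by (intro powr_mono2 mult_right_mono) auto
    then show "osc u x (\<rho>' n) (f n) \<le> ennreal (((\<kappa> + s) * \<rho>' n) powr p * measure \<nu> (ball x (\<rho>' n)))"
      by (intro order_trans[OF f] ennreal_leI mult_right_mono) auto
    show "osc u x (\<rho>' n) (u x) \<le> ennreal (((\<kappa> + s) * \<rho>' n) powr p * measure \<nu> (ball x (\<rho>' n)))"
    proof (rule osc_le_const)
      fix y assume "y \<in> ball x (\<rho>' n)"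
      then have "\<kappa> * dist y x \<le> (\<kappa> + s) * \<rho>' n"
        using \<open>0 \<le> \<kappa>\<close> s \<rho>'(1)[of n] by (intro mult_mono) (auto simp: dist_commute)
      then show "\<bar>u y - u x\<bar> \<le> (\<kappa> + s) * \<rho>' n"
        using lipschitz_onD[OF \<kappa>, of y x] by (simp add: dist_real_def)
    qed
  qed
  have "\<bar>u x - c\<bar> \<le> 8 * D * s * \<rho> + (4 * ((\<kappa> + s) * \<rho>)) / 2 ^ n" for n
  proof -
    have "\<bar>u x - c\<bar> \<le> 8 * D * s * \<rho> + 4 * ((\<kappa> + s) * \<rho>' n)"
    proof -
      have "0 \<le> 8 * D * s * \<rho>' n" using D s \<rho>'(1)[of n] by simp
      then show ?thesis using sum[of n] close[of n] by linarith
    qed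
    then show ?thesis by (simp add: \<rho>'_def)
  qed
  then show ?thesis by (rule le_of_le_add_geometric)
qed

text \<open>Joins \<open>x\<close> and \<open>y\<close> through good constants on
  \<open>ball x (2 * dist x y)\<close> and on the smaller \<open>ball y (dist x y)\<close> inside
  it. The three differences contribute \<open>16 * D\<close>, \<open>8 * D\<close> and
  \<open>8 * D\<^sup>2\<close>.\<close>

lemma lipschitz_of_controlled:
  assumes u: "u \<in> Lip" and s: "0 < s" and xy: "x \<noteq> y"
    and x: "\<And>n. controlled u x (2 * dist x y / 2 ^ n) s"
    and y: "\<And>n. controlled u y (dist x y / 2 ^ n) s"
  shows "\<bar>u x - u y\<bar> \<le> 32 * D\<^sup>2 * s * dist x y"
proof -
  note D = nu.D_gt_1
  define \<rho> where "\<rho> = dist x y"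
  have \<rho>: "0 < \<rho>" using xy by (simp add: \<rho>_def)
  obtain c where c: "osc u x (2 * \<rho>) c \<le> ennreal ((s * (2 * \<rho>)) powr p * measure \<nu> (ball x (2 * \<rho>)))"
    using x[of 0] by (auto simp: controlled_def \<rho>_def)
  obtain d where d: "osc u y \<rho> d \<le> ennreal ((s * \<rho>) powr p * measure \<nu> (ball y \<rho>))"
    using y[of 0] by (auto simp: controlled_def \<rho>_def)
  have "\<bar>u x - c\<bar> \<le> 8 * D * s * (2 * \<rho>)"
    using \<rho> x by (intro telescoping[OF u _ s _ c]) (auto simp: \<rho>_def)
  moreover have "\<bar>u y - d\<bar> \<le> 8 * D * s * \<rho>"
    using \<rho> y by (intro telescoping[OF u _ s _ d]) (auto simp: \<rho>_def)
  moreover have "\<bar>c - d\<bar> \<le> 4 * (D\<^sup>2 * (s * (2 * \<rho>)))"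
  proof (rule osc_const_diff[OF u \<rho>, where x = y])
    have D2: "1 \<le> D\<^sup>2" using D by (simp add: one_le_power)
    show "0 < D\<^sup>2 * (s * (2 * \<rho>))" using D s \<rho> by simp
    have "s * \<rho> \<le> 1 * (s * (2 * \<rho>))" using s \<rho> by simp
    also have "\<dots> \<le> D\<^sup>2 * (s * (2 * \<rho>))" using D2 s \<rho> by (intro mult_right_mono) auto
    finally have "(s * \<rho>) powr p \<le> (D\<^sup>2 * (s * (2 * \<rho>))) powr p" using s \<rho> p by (intro powr_mono2) auto
    then show "osc u y \<rho> d \<le> ennreal ((D\<^sup>2 * (s * (2 * \<rho>))) powr p * measure \<nu> (ball y \<rho>))"
      by (intro order_trans[OF d] ennreal_leI mult_right_mono) auto
    have "osc u y \<rho> c \<le> osc u x (2 * \<rho>) c"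
    proof (rule osc_mono, rule subsetI)
      fix v assume "v \<in> ball y \<rho>"
      then show "v \<in> ball x (2 * \<rho>)" using dist_triangle[of x v y] by (simp add: \<rho>_def)
    qed
    also note c
    also have "ennreal ((s * (2 * \<rho>)) powr p * measure \<nu> (ball x (2 * \<rho>))) \<le>
        ennreal ((D\<^sup>2 * (s * (2 * \<rho>))) powr p * measure \<nu> (ball y \<rho>))"
    proof (rule ennreal_leI)
      have "measure \<nu> (ball x (2 * \<rho>)) \<le> D\<^sup>2 * measure \<nu> (ball y \<rho>)"
        using \<rho> by (intro nu.measure_ball_le) (auto simp: \<rho>_def)
      also have "\<dots> \<le> D\<^sup>2 powr p * measure \<nu> (ball y \<rho>)"
        using D_powr[of 2] by (intro mult_right_mono) auto
      finally have "(s * (2 * \<rho>)) powr p * measure \<nu> (ball x (2 * \<rho>)) \<le>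
          (s * (2 * \<rho>)) powr p * (D\<^sup>2 powr p * measure \<nu> (ball y \<rho>))" by (rule mult_left_mono) simp
      then show "(s * (2 * \<rho>)) powr p * measure \<nu> (ball x (2 * \<rho>)) \<le>
          (D\<^sup>2 * (s * (2 * \<rho>))) powr p * measure \<nu> (ball y \<rho>)"
        using s \<rho> by (simp add: powr_mult mult_ac)
    qed
    finally show "osc u y \<rho> c \<le> ennreal ((D\<^sup>2 * (s * (2 * \<rho>))) powr p * measure \<nu> (ball y \<rho>))" .
  qed
  ultimately have "\<bar>u x - u y\<bar> \<le> 24 * (D * (s * \<rho>)) + 8 * (D\<^sup>2 * (s * \<rho>))" by (simp add: algebra_simps)
  moreover have "D * (s * \<rho>) \<le> D\<^sup>2 * (s * \<rho>)"
    using D s \<rho> by (intro mult_right_mono self_le_power) auto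
  ultimately show ?thesis by (simp add: \<rho>_def mult.assoc)
qed

text \<open>A superlevel set in the manner of the sharp maximal function. \<open>N\<close> tells how
  far the balls stay inside \<open>B\<^sub>0\<close>: \<open>N = 2\<close> matches
  \<open>inner_balls\<close>, \<open>N = 40\<close> leaves room for truncations.\<close>

definition level_set :: "'a set \<Rightarrow> real \<Rightarrow> ('a \<Rightarrow> real) \<Rightarrow> real \<Rightarrow> 'a set" where
  "level_set B\<^sub>0 N u s = (\<Union>(z, r)\<in>{(z, r). 0 < r \<and> ball z (N * r) \<subseteq> B\<^sub>0 \<and> \<not> controlled u z r s}. ball z r)"

text \<open>Shrinking the radius without changing the ball makes \<open>controlled\<close> stronger,
  so an uncontrolled ball remains uncontrolled with a fitting radius.\<close>

lemma level_setE:
  assumes "x \<in> level_set B\<^sub>0 N u s" "0 \<le> s" "0 \<le> N"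
  obtains z r where "0 < r" "fits r" "ball z (N * r) \<subseteq> B\<^sub>0" "x \<in> ball z r" "\<not> controlled u z r s"
proof -
  obtain z r where zr: "0 < r" "ball z (N * r) \<subseteq> B\<^sub>0" "\<not> controlled u z r s" "x \<in> ball z r"
    using assms(1) by (auto simp: level_set_def)
  obtain r' where r': "0 < r'" "r' \<le> r" "fits r'" "ball z r' = ball z r"
    using fits_shrink[OF zr(1)] by metis
  have "N * r' \<le> N * r" using r'(2) assms(3) by (rule mult_left_mono)
  then have "ball z (N * r') \<subseteq> B\<^sub>0" using zr(2) subset_ball by blast
  moreover have "\<not> controlled u z r' s"
  proof
    assume "controlled u z r' s"
    then obtain c where "osc u z r' c \<le> ennreal ((s * r') powr p * measure \<nu> (ball z r'))"
      by (auto simp: controlled_def)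
    also have "\<dots> \<le> ennreal ((s * r) powr p * measure \<nu> (ball z r))"
      unfolding r'(4) using r' assms(2) p by (intro ennreal_leI mult_right_mono powr_mono2 mult_left_mono) auto
    finally have "osc u z r c \<le> ennreal ((s * r) powr p * measure \<nu> (ball z r))"
      by (simp add: osc_def r'(4))
    then show False using zr(3) by (auto simp: controlled_def)
  qed
  ultimately show thesis using that r' zr by blast
qed

lemma level_set_open: "open (level_set B\<^sub>0 N u s)"
  unfolding level_set_def by (intro open_UN) auto

lemma level_setI:
  "0 < r \<Longrightarrow> ball z (N * r) \<subseteq> B\<^sub>0 \<Longrightarrow> x \<in> ball z r \<Longrightarrow> \<not> controlled u z r s \<Longrightarrow> x \<in> level_set B\<^sub>0 N u s"
  unfolding level_set_def by blast

lemma level_set_subset: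
  assumes "1 \<le> N"
  shows "level_set B\<^sub>0 N u s \<subseteq> B\<^sub>0"
proof
  fix x assume "x \<in> level_set B\<^sub>0 N u s"
  then obtain z r where zr: "0 < r" "ball z (N * r) \<subseteq> B\<^sub>0" "x \<in> ball z r" by (auto simp: level_set_def)
  have "r \<le> N * r" using assms zr(1) by simp
  then show "x \<in> B\<^sub>0" using zr subset_ball by blast
qed

lemma level_set_antimono:
  assumes "0 \<le> s" "s \<le> t"
  shows "level_set B\<^sub>0 N u t \<subseteq> level_set B\<^sub>0 N u s"
  unfolding level_set_def using controlled_mono[OF _ assms] by fastforce

lemma controlled_off_level_set:
  assumes "x \<notin> level_set B\<^sub>0 2 u s" "0 < r" "ball x (2 * r) \<subseteq> B\<^sub>0"
  shows "controlled u x (r / 2 ^ n) s"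
proof (rule ccontr)
  assume no: "\<not> controlled u x (r / 2 ^ n) s"
  have "r / 2 ^ n \<le> r / 1" using assms(2) by (intro divide_left_mono) auto
  then have "ball x (2 * (r / 2 ^ n)) \<subseteq> B\<^sub>0"
    using assms(3) subset_ball[of "2 * (r / 2 ^ n)" "2 * r" x] by auto
  then have "x \<in> level_set B\<^sub>0 2 u s" using assms(2) no by (intro level_setI[of "r / 2 ^ n" x]) auto
  then show False using assms(1) by simp
qed

text \<open>The balance condition in terms of radii. It is applied to \<open>ball x (d / 8)\<close>,
  because \<open>d / 8\<close> is certain not to exceed the diameter of
  \<open>ball y \<rho>\<close>; \<open>D ^ 3\<close> pays for the return to \<open>d\<close>, and
  128 for replacing diameters by radii.\<close>

lemma balance_ratio:
  assumes "fits \<rho>" "0 < \<rho>" "x \<in> ball y \<rho>" "0 < d" "d \<le> \<rho>"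
  shows "(d / \<rho>) powr (p - \<tau>) * (measure \<nu> (ball x d) / measure \<nu> (ball y \<rho>)) \<le>
    C\<^sub>b * D ^ 3 * 128 powr (p - \<tau>) * (measure \<mu> (ball x d) / measure \<mu> (ball y \<rho>))"
proof -
  let ?n = "\<lambda>x r. measure \<nu> (ball x r)" and ?m = "\<lambda>x r. measure \<mu> (ball x r)"
  have pos: "0 < ?n y \<rho>" "0 < ?m y \<rho>" using assms(2) by (auto intro: nu_pos mu_pos)
  have diam: "\<rho> / 8 \<le> diameter (ball y \<rho>)" "diameter (ball y \<rho>) \<le> 2 * \<rho>"
    "d / 64 \<le> diameter (ball x (d / 8))"
    using assms fits_diameter[of \<rho> y] diameter_ball_le[of \<rho> y]
      fits_diameter[of "d / 8" x] fits_mono[of \<rho> "d / 8"] by auto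
  have "(diameter (ball x (d / 8)) / diameter (ball y \<rho>)) powr (p - \<tau>) * (?n x (d / 8) / ?n y \<rho>)
      \<le> C\<^sub>b * (?m x (d / 8) / ?m y \<rho>)"
    using balance assms diam unfolding balance_condition_def by auto
  moreover have "(d / \<rho> / 128) powr (p - \<tau>) * (?n x (d / 8) / ?n y \<rho>) \<le>
      (diameter (ball x (d / 8)) / diameter (ball y \<rho>)) powr (p - \<tau>) * (?n x (d / 8) / ?n y \<rho>)"
  proof (intro mult_right_mono powr_mono2)
    have "d / \<rho> / 128 = (d / 64) / (2 * \<rho>)" by simp
    also have "\<dots> \<le> diameter (ball x (d / 8)) / diameter (ball y \<rho>)"
      using diam assms by (intro frac_le) auto
    finally show "d / \<rho> / 128 \<le> diameter (ball x (d / 8)) / diameter (ball y \<rho>)" .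
  qed (use \<tau> assms pos in auto)
  moreover have "C\<^sub>b * (?m x (d / 8) / ?m y \<rho>) \<le> C\<^sub>b * (?m x d / ?m y \<rho>)"
  proof -
    have "?m x (d / 8) \<le> ?m x d" using assms by (intro mu.measure_mono_ball subset_ball) auto
    then show ?thesis using C\<^sub>b pos by (intro mult_left_mono divide_right_mono) auto
  qed
  ultimately have "(d / \<rho> / 128) powr (p - \<tau>) * (?n x (d / 8) / ?n y \<rho>) \<le> C\<^sub>b * (?m x d / ?m y \<rho>)"
    by linarith
  then have "128 powr (p - \<tau>) * ((d / \<rho> / 128) powr (p - \<tau>) * (?n x (d / 8) / ?n y \<rho>)) \<le>
      128 powr (p - \<tau>) * (C\<^sub>b * (?m x d / ?m y \<rho>))" by (rule mult_left_mono) simp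
  moreover have "(d / \<rho>) powr (p - \<tau>) = 128 powr (p - \<tau>) * (d / \<rho> / 128) powr (p - \<tau>)"
    using assms by (simp add: powr_mult[symmetric])
  ultimately have main: "(d / \<rho>) powr (p - \<tau>) * (?n x (d / 8) / ?n y \<rho>) \<le>
      C\<^sub>b * 128 powr (p - \<tau>) * (?m x d / ?m y \<rho>)" by (simp add: mult_ac)
  have "?n x d \<le> D ^ 3 * ?n x (d / 8)" using assms by (intro nu.measure_ball_le) auto
  then have "(d / \<rho>) powr (p - \<tau>) * (?n x d / ?n y \<rho>) \<le>
      (d / \<rho>) powr (p - \<tau>) * (D ^ 3 * ?n x (d / 8) / ?n y \<rho>)"
    using pos by (intro mult_left_mono divide_right_mono) auto
  also have "\<dots> = D ^ 3 * ((d / \<rho>) powr (p - \<tau>) * (?n x (d / 8) / ?n y \<rho>))" by simp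
  also have "\<dots> \<le> D ^ 3 * (C\<^sub>b * 128 powr (p - \<tau>) * (?m x d / ?m y \<rho>))"
    using main nu.D_gt_1 by (intro mult_left_mono) auto
  finally show ?thesis by (simp add: mult_ac)
qed

lemma nn_integral_eq_avg:
  assumes "u \<in> Lip"
  shows "osc u x r c = ennreal (avg \<nu> (ball x r) (\<lambda>y. \<bar>u y - c\<bar> powr p) * measure \<nu> (ball x r))"
proof (cases "0 < r")
  case True
  obtain \<kappa> where \<kappa>: "\<kappa>-lipschitz_on UNIV u" using assms by (auto simp: Lip_def)
  have [measurable]: "u \<in> borel_measurable \<nu>"
    using assms by (intro nu.borel_imp_measurable Lip_borel_measurable)
  let ?f = "\<lambda>y. indicator (ball x r) y *\<^sub>R \<bar>u y - c\<bar> powr p"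
  have "integrable \<nu> ?f"
  proof (rule integrableI_bounded_set[where A = "ball x r" and B = "(\<kappa> * r + \<bar>u x - c\<bar>) powr p"])
    show "AE y in \<nu>. y \<in> ball x r \<longrightarrow> norm (?f y) \<le> (\<kappa> * r + \<bar>u x - c\<bar>) powr p"
    proof (intro AE_I2 impI)
      fix y assume y: "y \<in> ball x r"
      have "\<bar>u y - u x\<bar> \<le> \<kappa> * dist y x" using lipschitz_onD[OF \<kappa>, of y x] by (simp add: dist_real_def)
      also have "\<dots> \<le> \<kappa> * r" using y lipschitz_on_nonneg[OF \<kappa>] by (intro mult_left_mono) (auto simp: dist_commute)
      finally have "\<bar>u y - c\<bar> powr p \<le> (\<kappa> * r + \<bar>u x - c\<bar>) powr p" using p by (intro powr_mono2) auto
      then show "norm (?f y) \<le> (\<kappa> * r + \<bar>u x - c\<bar>) powr p" using y by simp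
    qed
  qed (use nu.emeasure_ball_finite in \<open>auto simp: measurable_If\<close>)
  then have "ennreal (\<integral>y. ?f y \<partial>\<nu>) = (\<integral>\<^sup>+y. ennreal (?f y) \<partial>\<nu>)"
    by (subst nn_integral_eq_integral) auto
  also have "\<dots> = osc u x r c"
    unfolding osc_def by (intro nn_integral_cong) (auto split: split_indicator)
  finally show ?thesis
    using nu_pos[OF True, of x] by (simp add: avg_def set_lebesgue_integral_def)
qed (simp add: osc_def ball_empty)

text \<open>The constant is the average, and diameters are bounded by \<open>2 * r\<close>. An
  infinite energy is harmless because its coefficient is positive.\<close>

lemma poincare_osc:
  assumes u: "u \<in> Lip" and g: "g \<in> upper_gradients \<mu> p u" and r: "0 < r"
  obtains c where "osc u x r c \<le>
    ennreal (K * (2 * r) powr p * (measure \<nu> (ball x r) / measure \<mu> (ball x r))) *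
      (\<integral>\<^sup>+y\<in>ball x r. ennreal_powr (g y) p \<partial>\<mu>)"
proof -
  define c where "c = avg \<nu> (ball x r) u"
  define A where "A = avg \<nu> (ball x r) (\<lambda>y. \<bar>u y - c\<bar> powr p)"
  define I where "I = (\<integral>\<^sup>+y\<in>ball x r. ennreal_powr (g y) p \<partial>\<mu>)"
  let ?n = "measure \<nu> (ball x r)" and ?m = "measure \<mu> (ball x r)"
  have pos: "0 < ?n" "0 < ?m" using r by (auto intro: nu_pos mu_pos)
  have A0: "0 \<le> A"
    unfolding A_def avg_def set_lebesgue_integral_def
    by (intro divide_nonneg_nonneg Bochner_Integration.integral_nonneg) auto
  have "ennreal (A powr (1 / p)) \<le> ennreal (K powr (1 / p) * diameter (ball x r)) *
      ennreal_powr (I / emeasure \<mu> (ball x r)) (1 / p)"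
    using poincare u g r unfolding poincare_inequality_def A_def I_def c_def Let_def by blast
  also have "\<dots> \<le> ennreal (K powr (1 / p) * (2 * r)) * ennreal_powr (I / emeasure \<mu> (ball x r)) (1 / p)"
    using diameter_ball_le[OF r, of x] by (intro mult_right_mono ennreal_leI mult_left_mono) auto
  finally have P: "ennreal (A powr (1 / p)) \<le> ennreal (K powr (1 / p) * (2 * r)) *
      ennreal_powr (I / emeasure \<mu> (ball x r)) (1 / p)" .
  have "osc u x r c \<le> ennreal (K * (2 * r) powr p * (?n / ?m)) * I"
  proof (cases "I = \<infinity>")
    case True
    then show ?thesis using K r pos by (simp add: ennreal_mult_top)
  next
    case False
    then obtain i where i: "I = ennreal i" "0 \<le> i" by (cases I) auto
    have "I / emeasure \<mu> (ball x r) = ennreal (i / ?m)"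
      using i pos by (simp add: mu.emeasure_ball divide_ennreal)
    then have "A powr (1 / p) \<le> K powr (1 / p) * (2 * r) * (i / ?m) powr (1 / p)"
      using P i pos K r by (simp flip: ennreal_mult)
    then have "(A powr (1 / p)) powr p \<le> (K powr (1 / p) * (2 * r) * (i / ?m) powr (1 / p)) powr p"
      using p by (intro powr_mono2) auto
    then have "A \<le> K * (2 * r) powr p * (i / ?m)"
      using A0 p K r i pos by (simp add: powr_mult powr_powr)
    then have "A * ?n \<le> K * (2 * r) powr p * (i / ?m) * ?n" using pos by (intro mult_right_mono) auto
    also have "\<dots> = K * (2 * r) powr p * (?n / ?m) * i" by simp
    finally show ?thesis
      unfolding nn_integral_eq_avg[OF u] A_def[symmetric] i(1) using K r pos i
      by (simp flip: ennreal_mult)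
  qed
  then show thesis using that unfolding I_def by blast
qed

end

section \<open>Truncations\<close>

lemma infdist_lessD:
  assumes "E \<noteq> {}" "infdist x E < t"
  obtains a where "a \<in> E" "dist x a < t"
proof -
  have "(INF a\<in>E. dist x a) < t" using assms by (simp add: infdist_notempty)
  then obtain d where "d \<in> dist x ` E" "d < t" using assms(1) cInf_lessD by (metis image_is_empty)
  then show thesis using that by blast
qed

section \<open>Lipschitz truncations, their errors and weak type bounds\<close>

context geodesic_space_pair
begin

definition lip_const :: real where "lip_const = 32 * D\<^sup>2"

text \<open>\<open>1280 * D\<^sup>2\<close> is four times the constant of \<open>T\<close> in
  \<open>truncation_error\<close>, \<open>D ^ 4\<close> compares a ball around a good point with one
  around the bad point, and the last factor is that of \<open>balance_ratio\<close>.\<close>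

definition trunc_const :: real where
  "trunc_const = (1280 * D\<^sup>2) powr p * D ^ 4 * (C\<^sub>b * D ^ 3 * 128 powr (p - \<tau>))"

lemma D_pos: "0 < D" and D_ge_1: "1 \<le> D"
  using nu.D_gt_1 by auto

lemma lip_const_ge_1: "1 \<le> lip_const"
proof -
  have "1 \<le> D\<^sup>2" using D_ge_1 by (simp add: one_le_power)
  then show ?thesis by (simp add: lip_const_def)
qed

lemma trunc_const_pos: "0 < trunc_const"
  using D_pos C\<^sub>b by (simp add: trunc_const_def)

lemma level_set_borel: "level_set B\<^sub>0 N u s \<in> sets borel"
  by (rule borel_open[OF level_set_open])

lemma level_set_sets [measurable]: "level_set B\<^sub>0 N u s \<in> sets \<mu>"
  by (rule mu.borel_imp_sets[OF level_set_borel])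

lemma borel_subset: "sets borel \<subseteq> sets \<nu>" "sets borel \<subseteq> sets \<mu>"
  using nu.borel_imp_sets mu.borel_imp_sets by blast+

lemma fmeasurable_Int_ball: "G \<in> sets \<mu> \<Longrightarrow> G \<inter> ball x r \<in> fmeasurable \<mu>"
  by (rule fmeasurableI2[OF mu.fmeasurable_ball]) auto

text \<open>Off the level set \<open>lipschitz_of_controlled\<close> applies, and the function
  extends from there. Distances within the ball are below \<open>8 * r\<close>, hence the doubled
  balls involved stay within \<open>36 * r\<close> of \<open>z\<close>, well inside
  \<open>40 * r\<close>.\<close>

lemma truncation_exists:
  assumes u: "u \<in> Lip" and s: "0 < s" and r: "0 < r" and B\<^sub>0: "ball z (40 * r) \<subseteq> B\<^sub>0"
  obtains w where "(lip_const * s)-lipschitz_on UNIV w"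
    "\<And>x. x \<in> ball z (4 * r) - level_set B\<^sub>0 2 u s \<Longrightarrow> w x = u x"
proof (rule mcshane_extension)
  show "0 \<le> lip_const * s" using lip_const_ge_1 s by simp
  fix x y assume x: "x \<in> ball z (4 * r) - level_set B\<^sub>0 2 u s" and y: "y \<in> ball z (4 * r) - level_set B\<^sub>0 2 u s"
  show "\<bar>u x - u y\<bar> \<le> lip_const * s * dist x y"
  proof (cases "x = y")
    case False
    have d: "dist x y < 8 * r" using x y dist_triangle3[of x y z] by simp
    have sub: "ball v (2 * \<rho>) \<subseteq> B\<^sub>0" if "v \<in> ball z (4 * r)" "\<rho> \<le> 2 * dist x y" for v \<rho>
    proof -
      have "ball v (2 * \<rho>) \<subseteq> ball z (40 * r)"
      proof
        fix t assume "t \<in> ball v (2 * \<rho>)"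
        then have "dist v t < 2 * \<rho>" by simp
        moreover have "dist z v < 4 * r" using that(1) by simp
        ultimately have "dist z t < 40 * r" using that(2) d r dist_triangle[of z t v] by linarith
        then show "t \<in> ball z (40 * r)" by simp
      qed
      then show ?thesis using B\<^sub>0 by blast
    qed
    have x_sub: "ball x (2 * (2 * dist x y)) \<subseteq> B\<^sub>0" using x by (intro sub) auto
    have y_sub: "ball y (2 * dist x y) \<subseteq> B\<^sub>0" using y by (intro sub) auto
    show ?thesis
      unfolding lip_const_def
    proof (rule lipschitz_of_controlled[OF u s False])
      show "controlled u x (2 * dist x y / 2 ^ n) s" for n
        by (rule controlled_off_level_set[OF _ _ x_sub]) (use x False in auto)
      show "controlled u y (dist x y / 2 ^ n) s" for n
        by (rule controlled_off_level_set[OF _ _ y_sub]) (use y False in auto)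
    qed
  qed simp
qed (rule that)

text \<open>Cover \<open>level_set\<close> by the balls \<open>ball x d\<close>, with \<open>d\<close> the distance from \<open>x\<close> to the set where
  \<open>u\<close> and \<open>w\<close> agree. The balance condition with an exponent below \<open>p\<close> yields the factor \<open>\<eta> powr \<tau>\<close>.\<close>

lemma truncation_error:
  assumes u: "u \<in> Lip" and s: "0 < s" and r: "0 < r" and B\<^sub>0: "ball z (40 * r) \<subseteq> B\<^sub>0"
    and w: "(lip_const * s)-lipschitz_on UNIV w"
    and E_def: "E = ball z (4 * r) - level_set B\<^sub>0 2 u s"
    and eq: "\<And>x. x \<in> E \<Longrightarrow> w x = u x" and E: "E \<noteq> {}"
    and \<rho>: "0 < \<rho>" "fits \<rho>" "\<rho> \<le> r" "ball y (2 * \<rho>) \<subseteq> ball z (4 * r)"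
    and \<eta>: "0 < \<eta>" "\<eta> \<le> 1"
    and near: "\<And>x. x \<in> ball y \<rho> \<Longrightarrow> x \<in> level_set B\<^sub>0 2 u s \<Longrightarrow> infdist x E \<le> \<eta> * \<rho>"
  shows "(\<integral>\<^sup>+x\<in>ball y \<rho>. ennreal (\<bar>u x - w x\<bar> powr p) \<partial>\<nu>) \<le>
    ennreal (trunc_const * (s * \<rho>) powr p * \<eta> powr \<tau> * (measure \<nu> (ball y \<rho>) / measure \<mu> (ball y \<rho>))) *
      emeasure \<mu> (level_set B\<^sub>0 2 u s \<inter> ball y (2 * \<rho>))"
proof -
  let ?V = "level_set B\<^sub>0 2 u s"
  define F where "F = (\<lambda>x. (x, infdist x E)) ` (ball y \<rho> \<inter> ?V)"
  define M where "M = measure \<nu> (ball y \<rho>) / measure \<mu> (ball y \<rho>)"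
  define Q where "Q = trunc_const * (s * \<rho>) powr p * \<eta> powr \<tau> * M"
  have n0: "0 < measure \<nu> (ball y \<rho>)" and m0: "0 < measure \<mu> (ball y \<rho>)"
    using \<rho>(1) by (auto intro: nu_pos mu_pos)
  have M: "0 < M" using n0 m0 by (simp add: M_def)
  have Q: "0 \<le> Q" using M trunc_const_pos by (simp add: Q_def)
  have w_Lip: "w \<in> Lip" using w by (auto simp: Lip_def)
  have \<eta>\<rho>: "\<eta> * \<rho> \<le> \<rho>" using \<eta> \<rho>(1) by (simp add: mult_left_le_one_le)
  \<comment> \<open>Openness of the level set keeps bad points at positive distance from
    \<open>E\<close>, which makes the radii of the covering admissible.\<close>
  have pos: "0 < infdist x E" if x: "x \<in> ball y \<rho>" "x \<in> ?V" for x
  proof -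
    have "ball y \<rho> \<subseteq> ball y (2 * \<rho>)" using \<rho>(1) by (intro subset_ball) simp
    then have "x \<in> ball z (4 * r)" using x(1) \<rho>(4) by blast
    then have "x \<in> ?V \<inter> ball z (4 * r)" using x(2) by blast
    moreover have "open (?V \<inter> ball z (4 * r))" by (intro open_Int level_set_open) simp
    ultimately obtain e where e: "0 < e" "ball x e \<subseteq> ?V \<inter> ball z (4 * r)"
      using openE by blast
    have "e \<le> infdist x E"
    proof (rule ccontr)
      assume "\<not> e \<le> infdist x E"
      then obtain a where "a \<in> E" "dist x a < e" using infdist_lessD[OF E, of x e] by auto
      then show False using e(2) by (auto simp: E_def)
    qed
    then show ?thesis using e(1) by linarith
  qed
  \<comment> \<open>Closer to \<open>x\<close> than \<open>infdist x E\<close> there is no point of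
    \<open>E\<close>, so the ball is filled by the level set; the error is thus charged to the level
    set alone.\<close>
  have inV: "ball x (infdist x E) \<subseteq> ?V \<inter> ball y (2 * \<rho>)" if x: "x \<in> ball y \<rho>" "x \<in> ?V" for x
  proof
    fix v assume v: "v \<in> ball x (infdist x E)"
    have "infdist x E \<le> \<rho>" using near[OF x] \<eta>\<rho> by linarith
    then have vy: "v \<in> ball y (2 * \<rho>)" using v x(1) dist_triangle[of y v x] by simp
    have "v \<notin> E" using v infdist_le[of v E x] by auto
    then show "v \<in> ?V \<inter> ball y (2 * \<rho>)" using vy \<rho>(4) by (auto simp: E_def)
  qed
  have local_est: "(\<integral>\<^sup>+v\<in>ball x (5 * d). ennreal (\<bar>u v - w v\<bar> powr p) \<partial>\<nu>) \<le>
      (\<integral>\<^sup>+v\<in>ball x d. ennreal Q * indicator ?V v \<partial>\<mu>)" if xd: "(x, d) \<in> F" for x d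
  proof -
    have x: "x \<in> ball y \<rho>" "x \<in> ?V" and d_eq: "d = infdist x E" using xd by (auto simp: F_def)
    have d: "0 < d" "d \<le> \<eta> * \<rho>" using pos[OF x] near[OF x] d_eq by auto
    have d\<rho>: "d \<le> \<rho>" using d(2) \<eta>\<rho> by linarith
    obtain a where a: "a \<in> E" "dist x a < 2 * d"
      using infdist_lessD[OF E, of x "2 * d"] d(1) d_eq by auto
    \<comment> \<open>The ball of radius \<open>8 * d\<close> around the good point \<open>a\<close>
      contains \<open>ball x (5 * d)\<close>, and its double still lies in \<open>B\<^sub>0\<close>
      because \<open>d \<le> r\<close>.\<close>
    have "ball a (2 * (8 * d)) \<subseteq> ball z (40 * r)"
    proof
      fix v assume "v \<in> ball a (2 * (8 * d))"
      then show "v \<in> ball z (40 * r)"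
        using a(1) d\<rho> \<rho>(3) r dist_triangle[of z v a] by (simp add: E_def)
    qed
    then have a_sub: "ball a (2 * (8 * d)) \<subseteq> B\<^sub>0" using B\<^sub>0 by blast
    have ctrl: "controlled u a (8 * d / 2 ^ n) s" for n
      by (rule controlled_off_level_set[OF _ _ a_sub]) (use a(1) d(1) in \<open>auto simp: E_def\<close>)
    obtain c where c: "osc u a (8 * d) c \<le> ennreal ((s * (8 * d)) powr p * measure \<nu> (ball a (8 * d)))"
      using ctrl[of 0] by (auto simp: controlled_def)
    have uc: "\<bar>u a - c\<bar> \<le> 8 * D * s * (8 * d)"
      using d(1) by (intro telescoping[OF u _ s ctrl c]) simp
    have sub: "ball x (5 * d) \<subseteq> ball a (8 * d)"
    proof
      fix v assume "v \<in> ball x (5 * d)"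
      then show "v \<in> ball a (8 * d)" using a(2) d(1) dist_triangle[of a v x] by (simp add: dist_commute)
    qed
    \<comment> \<open>256 bounds the variation of \<open>w\<close> over radius \<open>8 * d\<close>,
      as 8 times the 32 of \<open>lip_const\<close>; 64 comes from \<open>telescoping\<close> at
      that radius.\<close>
    define T where "T = 320 * D\<^sup>2 * s * d"
    have T: "0 < T" using D_pos s d(1) by (simp add: T_def)
    have wc: "\<bar>w v - c\<bar> \<le> T" if "v \<in> ball a (8 * d)" for v
    proof -
      have "\<bar>w v - w a\<bar> \<le> lip_const * s * dist v a"
        using lipschitz_onD[OF w, of v a] by (simp add: dist_real_def)
      also have "\<dots> \<le> lip_const * s * (8 * d)"
        using that lip_const_ge_1 s by (intro mult_left_mono) (auto simp: dist_commute)
      finally have "\<bar>w v - w a\<bar> \<le> 256 * D\<^sup>2 * s * d" by (simp add: lip_const_def)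
      moreover have "64 * D * (s * d) \<le> 64 * D\<^sup>2 * (s * d)"
        using D_ge_1 s d(1) by (intro mult_right_mono mult_left_mono self_le_power) auto
      ultimately show ?thesis using uc eq[OF a(1)] unfolding T_def by (simp add: mult_ac)
    qed
    let ?n = "measure \<nu> (ball a (8 * d))"
    have "(\<integral>\<^sup>+v\<in>ball x (5 * d). ennreal (\<bar>u v - w v\<bar> powr p) \<partial>\<nu>) \<le>
        (\<integral>\<^sup>+v\<in>ball a (8 * d). ennreal (\<bar>u v - w v\<bar> powr p) \<partial>\<nu>)"
      by (rule nn_set_integral_set_mono[OF sub])
    also have "\<dots> \<le> ennreal (2 powr p) * (osc u a (8 * d) c + osc w a (8 * d) c)"
      using nn_integral_powr_triangle[OF u w_Lip const_Lip, of a "8 * d" c]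
      by (simp add: osc_def abs_minus_commute)
    also have "\<dots> \<le> ennreal (2 powr p) * (ennreal (T powr p * ?n) + ennreal (T powr p * ?n))"
    proof (intro mult_left_mono add_mono)
      have "1 \<le> D\<^sup>2" using D_ge_1 by (simp add: one_le_power)
      then have "s * (8 * d) \<le> T" using s d(1) mult_right_mono[of 1 "D\<^sup>2" "s * d"] by (simp add: T_def mult_ac)
      then have "(s * (8 * d)) powr p * ?n \<le> T powr p * ?n"
        using s d(1) p by (intro mult_right_mono powr_mono2) auto
      then show "osc u a (8 * d) c \<le> ennreal (T powr p * ?n)" by (intro order_trans[OF c] ennreal_leI)
      show "osc w a (8 * d) c \<le> ennreal (T powr p * ?n)" by (rule osc_le_const[OF wc])
    qed simp
    also have "\<dots> = ennreal (2 powr p * 2 * T powr p * ?n)"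
      by (simp flip: ennreal_plus ennreal_mult add: algebra_simps)
    also have "\<dots> \<le> ennreal (Q * measure \<mu> (ball x d))"
    proof (rule ennreal_leI)
      have "2 powr p * 2 * T powr p \<le> 2 powr p * 2 powr p * T powr p"
        using le_powr_self[of 2 p] p by (intro mult_right_mono mult_left_mono) auto
      also have "\<dots> = (2 * (2 * T)) powr p" by (simp only: powr_mult mult.assoc)
      also have "\<dots> = (1280 * D\<^sup>2) powr p * s powr p * d powr p"
        unfolding T_def using D_pos s d(1) by (simp flip: powr_mult add: mult_ac)
      finally have c1: "2 powr p * 2 * T powr p \<le> (1280 * D\<^sup>2) powr p * s powr p * d powr p" .
      have c2: "?n \<le> D ^ 4 * measure \<nu> (ball x d)"
        using d(1) a(2) by (intro nu.measure_ball_le) (auto simp: dist_commute)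
      \<comment> \<open>One part of the power is spent on the balance condition; the remaining
        exponent \<open>\<tau>\<close> yields the smallness, as
        \<open>d / \<rho> \<le> \<eta>\<close>.\<close>
      have dp: "d powr p = \<rho> powr p * (d / \<rho>) powr \<tau> * (d / \<rho>) powr (p - \<tau>)"
      proof -
        have e: "(d / \<rho>) powr p = (d / \<rho>) powr \<tau> * (d / \<rho>) powr (p - \<tau>)"
          by (simp flip: powr_add)
        have "d powr p = \<rho> powr p * (d / \<rho>) powr p" using d(1) \<rho>(1) by (simp add: powr_divide)
        then show ?thesis unfolding e by (simp only: mult.assoc)
      qed
      have ratio: "(d / \<rho>) powr \<tau> \<le> \<eta> powr \<tau>"
        using d \<rho>(1) \<tau>(1) by (intro powr_mono2) (auto simp: field_simps)
      let ?B = "C\<^sub>b * D ^ 3 * 128 powr (p - \<tau>)"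
      have "(d / \<rho>) powr (p - \<tau>) * (measure \<nu> (ball x d) / measure \<nu> (ball y \<rho>)) * measure \<nu> (ball y \<rho>) \<le>
          ?B * (measure \<mu> (ball x d) / measure \<mu> (ball y \<rho>)) * measure \<nu> (ball y \<rho>)"
        using n0 by (intro mult_right_mono balance_ratio \<rho> x d d\<rho>) auto
      then have bal: "(d / \<rho>) powr (p - \<tau>) * measure \<nu> (ball x d) \<le> ?B * M * measure \<mu> (ball x d)"
        using n0 by (simp add: M_def mult_ac)
      have "2 powr p * 2 * T powr p * ?n \<le>
          (1280 * D\<^sup>2) powr p * s powr p * d powr p * (D ^ 4 * measure \<nu> (ball x d))"
        by (rule mult_mono[OF c1 c2]) auto
      also have "\<dots> = (1280 * D\<^sup>2) powr p * D ^ 4 * (s powr p * \<rho> powr p) *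
          ((d / \<rho>) powr \<tau> * ((d / \<rho>) powr (p - \<tau>) * measure \<nu> (ball x d)))"
        unfolding dp by (simp only: mult_ac)
      also have "\<dots> \<le> (1280 * D\<^sup>2) powr p * D ^ 4 * (s powr p * \<rho> powr p) *
          (\<eta> powr \<tau> * (?B * M * measure \<mu> (ball x d)))"
        using D_pos by (intro mult_left_mono mult_mono ratio bal) auto
      also have "\<dots> = Q * measure \<mu> (ball x d)"
        unfolding Q_def trunc_const_def using s \<rho>(1) by (simp add: powr_mult mult_ac)
      finally show "2 powr p * 2 * T powr p * ?n \<le> Q * measure \<mu> (ball x d)" .
    qed
    also have "\<dots> = (\<integral>\<^sup>+v\<in>ball x d. ennreal Q \<partial>\<mu>)"
      using Q by (simp add: nn_integral_cmult_indicator mu.emeasure_ball ennreal_mult)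
    also have "\<dots> = (\<integral>\<^sup>+v\<in>ball x d. ennreal Q * indicator ?V v \<partial>\<mu>)"
      using inV[OF x] d_eq by (intro nn_integral_cong) (auto split: split_indicator)
    finally show ?thesis .
  qed
  have [measurable]: "u \<in> borel_measurable \<nu>" "w \<in> borel_measurable \<nu>"
    using u w_Lip by (auto intro: nu.borel_imp_measurable Lip_borel_measurable)
  have "(\<integral>\<^sup>+x\<in>ball y \<rho>. ennreal (\<bar>u x - w x\<bar> powr p) \<partial>\<nu>) \<le>
      (\<integral>\<^sup>+x\<in>(\<Union>(x, d)\<in>F. ball x d). ennreal (\<bar>u x - w x\<bar> powr p) \<partial>\<nu>)"
  proof (rule nn_integral_mono)
    fix x
    have "u x = w x" if "x \<in> ball y \<rho>" "x \<notin> ?V"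
    proof -
      have "ball y \<rho> \<subseteq> ball y (2 * \<rho>)" using \<rho>(1) by (intro subset_ball) simp
      then have "x \<in> E" unfolding E_def using that \<rho>(4) by blast
      then show ?thesis using eq by simp
    qed
    moreover have "x \<in> (\<Union>(x, d)\<in>F. ball x d)" if "x \<in> ball y \<rho>" "x \<in> ?V"
      using that pos[OF that] by (intro UN_I[of "(x, infdist x E)"]) (auto simp: F_def)
    ultimately show "ennreal (\<bar>u x - w x\<bar> powr p) * indicator (ball y \<rho>) x \<le>
        ennreal (\<bar>u x - w x\<bar> powr p) * indicator (\<Union>(x, d)\<in>F. ball x d) x"
      by (cases "x \<in> ball y \<rho>"; cases "x \<in> ?V") (simp_all add: indicator_def)
  qed
  also have "\<dots> \<le> (\<integral>\<^sup>+x\<in>(\<Union>(x, d)\<in>F. ball x d). ennreal Q * indicator ?V x \<partial>\<mu>)"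
  proof (rule nu.vitali_nn_integral[where R = \<rho>])
    show "0 < d \<and> d \<le> \<rho>" if "(x, d) \<in> F" for x d
    proof -
      have "x \<in> ball y \<rho>" "x \<in> ?V" "d = infdist x E" using that by (auto simp: F_def)
      then show ?thesis using pos[of x] near[of x] \<eta>\<rho> by force
    qed
    show "(\<lambda>x. ennreal (\<bar>u x - w x\<bar> powr p)) \<in> borel_measurable \<nu>"
      "(\<lambda>x. ennreal Q * indicator ?V x) \<in> borel_measurable \<mu>" by measurable
  qed (rule borel_subset local_est; assumption?)+
  also have "\<dots> \<le> (\<integral>\<^sup>+x\<in>?V \<inter> ball y (2 * \<rho>). ennreal Q \<partial>\<mu>)"
  proof (rule nn_integral_mono)
    fix x
    have "x \<in> ball y (2 * \<rho>)" if xU: "x \<in> (\<Union>(x, d)\<in>F. ball x d)"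
    proof -
      obtain v where "v \<in> ball y \<rho>" "v \<in> ?V" "x \<in> ball v (infdist v E)" using xU by (auto simp: F_def)
      then show ?thesis using inV[of v] by blast
    qed
    then show "ennreal Q * indicator ?V x * indicator (\<Union>(x, d)\<in>F. ball x d) x \<le>
        ennreal Q * indicator (?V \<inter> ball y (2 * \<rho>)) x"
      by (cases "x \<in> (\<Union>(x, d)\<in>F. ball x d)"; cases "x \<in> ?V") (simp_all add: indicator_def)
  qed
  also have "\<dots> = ennreal Q * emeasure \<mu> (?V \<inter> ball y (2 * \<rho>))"
    by (simp add: nn_integral_cmult_indicator)
  finally show ?thesis by (simp add: Q_def M_def)
qed

text \<open>A larger ball inside \<open>G\<close> that reaches \<open>ball z (2 * r)\<close> would
  contain a ball of radius \<open>\<eta> * r / 2\<close> inside \<open>ball z (4 * r)\<close>, and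
  by doubling that one is too heavy for the assumed density of \<open>G\<close>.\<close>

lemma small_radius:
  assumes \<eta>: "0 < \<eta>" "\<eta> \<le> 1" "8 \<le> 2 ^ n * \<eta>" and r: "0 < r"
    and G: "G \<in> sets \<mu>" "measure \<mu> (G \<inter> ball z (4 * r)) < measure \<mu> (ball z r) / D ^ n"
    and \<rho>: "0 < \<rho>" "ball y \<rho> \<subseteq> G" "ball y \<rho> \<inter> ball z (2 * r) \<noteq> {}"
  shows "\<rho> \<le> \<eta> * r"
proof (rule ccontr)
  assume "\<not> \<rho> \<le> \<eta> * r"
  then have big: "\<eta> * r < \<rho>" by simp
  have \<eta>r: "0 < \<eta> * r" "\<eta> * r \<le> r" using \<eta> r by (auto simp: mult_le_cancel_right1)
  obtain x where x: "dist y x < \<rho>" "dist z x < 2 * r" using \<rho>(3) by auto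
  \<comment> \<open>Moves along a geodesic from \<open>x\<close> towards the centre \<open>y\<close>
    just far enough that the ball of radius \<open>\<eta> * r / 2\<close> around \<open>v\<close>
    stays inside \<open>ball y \<rho>\<close>.\<close>
  obtain v where v: "dist x v \<le> \<eta> * r / 2" "dist v y < \<rho> - \<eta> * r / 2"
  proof (cases "dist x y \<le> \<eta> * r / 2")
    case True
    show thesis by (rule that[of y]) (use True big \<eta>r in auto)
  next
    case False
    obtain v where "dist x v = \<eta> * r / 2" "dist v y = dist x y - \<eta> * r / 2"
      using geodesic_point[of "\<eta> * r / 2" x y] False \<eta>r by auto
    then show thesis using that[of v] x(1) by (simp add: dist_commute)
  qed
  let ?b = "ball v (\<eta> * r / 2)"
  have "?b \<subseteq> G \<inter> ball z (4 * r)"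
  proof
    fix t assume t: "t \<in> ?b"
    have "dist y t < \<rho>" using t v(2) dist_triangle[of y t v] by (simp add: dist_commute)
    moreover have "dist z t < 4 * r"
      using t v(1) x(2) \<eta>r dist_triangle[of z t v] dist_triangle[of z v x] by simp
    ultimately show "t \<in> G \<inter> ball z (4 * r)" using \<rho>(2) by auto
  qed
  then have "measure \<mu> ?b \<le> measure \<mu> (G \<inter> ball z (4 * r))"
    using G(1) by (intro measure_mono_fmeasurable fmeasurable_Int_ball) auto
  moreover have "measure \<mu> (ball z r) \<le> D ^ n * measure \<mu> ?b"
  proof (rule mu.measure_ball_le)
    have "dist z v \<le> 3 * r" using v(1) x(2) \<eta>r dist_triangle[of z v x] by linarith
    then have "dist z v + r \<le> 8 * (r / 2)" by simp
    also have "\<dots> \<le> 2 ^ n * \<eta> * (r / 2)" using \<eta>(3) r by (intro mult_right_mono) auto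
    finally show "dist z v + r \<le> 2 ^ n * (\<eta> * r / 2)" by simp
  qed (use \<eta>r in simp)
  ultimately have "measure \<mu> (ball z r) < D ^ n * (measure \<mu> (ball z r) / D ^ n)"
    using G(2) D_pos by (smt (verit, best) mult_le_cancel_left_pos mult_less_cancel_left_pos zero_less_power)
  then show False using D_pos by simp
qed

text \<open>Two thresholds: below density \<open>1 / D\<close> the level set cannot contain a whole
  ball of the same radius, and the second one makes the truncation error at most half of the
  oscillation to be explained.\<close>

definition density_const :: real where
  "density_const = min (1 / D) (1 / (2 * 2 powr p * trunc_const))"

text \<open>\<open>D ^ 4\<close> comes from the covering argument, which meets the tenfold ball; the
  bracket is the constant on a single ball, one summand for each of its two cases.\<close>

definition weak_const :: real where
  "weak_const = D ^ 4 * (1 / density_const + 2 * 4 powr p * K * lip_const powr p)"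

lemma density_const_pos: "0 < density_const"
  using D_pos trunc_const_pos by (simp add: density_const_def)

lemma weak_const_pos: "0 < weak_const"
  using D_pos density_const_pos K lip_const_ge_1 by (auto simp: weak_const_def intro!: mult_pos_pos add_pos_nonneg)

text \<open>The weak type estimate is applied to the truncation of \<open>u\<close> at the level \<open>S\<close>, unless the ball
  meets the level set of \<open>S\<close> in a set of large measure.\<close>

lemma weak_estimate_ball:
  assumes u: "u \<in> Lip" and g: "g \<in> upper_gradients \<mu> p u" and s: "0 < s" "s \<le> S"
    and r: "0 < r" and B\<^sub>0: "ball z (40 * r) \<subseteq> B\<^sub>0"
    and E_def: "E = ball z (4 * r) - level_set B\<^sub>0 2 u S" and E: "E \<noteq> {}"
    and \<rho>: "0 < \<rho>" "fits \<rho>" "\<rho> \<le> r" "ball y (2 * \<rho>) \<subseteq> ball z (4 * r)" and bad: "\<not> controlled u y \<rho> s"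
  shows "ennreal (s powr p * measure \<mu> (ball y \<rho>)) \<le>
    ennreal (1 / density_const + 2 * 4 powr p * K * lip_const powr p) *
    (\<integral>\<^sup>+x\<in>ball y (2 * \<rho>). ennreal (S powr p) * indicator (level_set B\<^sub>0 2 u S) x +
      ennreal_powr (g x) p * indicator (- level_set B\<^sub>0 2 u S) x \<partial>\<mu>)"
proof -
  let ?V = "level_set B\<^sub>0 2 u S"
  let ?n = "measure \<nu> (ball y \<rho>)" and ?m = "measure \<mu> (ball y \<rho>)"
  define h where "h x = ennreal (S powr p) * indicator ?V x + ennreal_powr (g x) p * indicator (- ?V) x" for x
  have S: "0 < S" using s by linarith
  have n0: "0 < ?n" and m0: "0 < ?m" using \<rho>(1) by (auto intro: nu_pos mu_pos)
  have fin: "?V \<inter> ball y (2 * \<rho>) \<in> fmeasurable \<mu>"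
    by (intro fmeasurable_Int_ball) simp
  define a where "a = measure \<mu> (?V \<inter> ball y (2 * \<rho>))"
  have a: "emeasure \<mu> (?V \<inter> ball y (2 * \<rho>)) = ennreal a"
    using fin by (simp add: a_def emeasure_eq_measure2)
  define \<beta> where "\<beta> = density_const"
  have \<beta>: "0 < \<beta>" "\<beta> * D \<le> 1" "2 powr p * trunc_const * \<beta> \<le> 1 / 2"
  proof -
    show "0 < \<beta>" using density_const_pos by (simp add: \<beta>_def)
    have "\<beta> \<le> 1 / D" by (simp add: \<beta>_def density_const_def)
    then show "\<beta> * D \<le> 1" using D_pos by (simp add: field_simps)
    have "\<beta> \<le> 1 / (2 * 2 powr p * trunc_const)" by (simp add: \<beta>_def density_const_def)
    then show "2 powr p * trunc_const * \<beta> \<le> 1 / 2" using trunc_const_pos by (simp add: field_simps)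
  qed
  define C where "C = 2 * 4 powr p * K * lip_const powr p"
  have C: "0 \<le> C" using K by (simp add: C_def)
  \<comment> \<open>Either the level set of \<open>S\<close> is dense enough in the doubled ball to
    pay for the left side, or it is so thin that the truncation at \<open>S\<close> can replace
    \<open>u\<close>.\<close>
  have main: "ennreal (s powr p * ?m) \<le> ennreal (1 / \<beta>) * (\<integral>\<^sup>+x\<in>ball y (2 * \<rho>). h x \<partial>\<mu>) \<or>
      ennreal (s powr p * ?m) \<le> ennreal C * (\<integral>\<^sup>+x\<in>ball y (2 * \<rho>). h x \<partial>\<mu>)"
  proof (cases "\<beta> * (s / S) powr p * ?m \<le> a")
    case True
    have "s powr p * ?m = 1 / \<beta> * (S powr p * (\<beta> * (s / S) powr p * ?m))"
      using \<beta>(1) s S by (simp add: powr_divide)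
    also have "\<dots> \<le> 1 / \<beta> * (S powr p * a)"
      using True \<beta>(1) by (intro mult_left_mono) auto
    finally have "ennreal (s powr p * ?m) \<le> ennreal (1 / \<beta>) * (ennreal (S powr p) * ennreal a)"
      using \<beta>(1) by (simp flip: ennreal_mult add: ennreal_leI a_def)
    also have "ennreal (S powr p) * ennreal a = (\<integral>\<^sup>+x\<in>?V \<inter> ball y (2 * \<rho>). ennreal (S powr p) \<partial>\<mu>)"
      by (simp add: nn_integral_cmult_indicator a)
    also have "\<dots> \<le> (\<integral>\<^sup>+x\<in>ball y (2 * \<rho>). h x \<partial>\<mu>)"
      by (intro nn_integral_mono) (auto simp: h_def split: split_indicator)
    finally show ?thesis by (auto simp: mult_left_mono)
  next
    case False
    then have small: "a < \<beta> * (s / S) powr p * ?m" by simp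
    have "(s / S) powr p \<le> 1" using s S p by (intro powr_le1) auto
    then have "\<beta> * (s / S) powr p * ?m \<le> \<beta> * 1 * ?m"
      using \<beta>(1) by (intro mult_right_mono mult_left_mono) auto
    then have a\<beta>: "a < \<beta> * ?m" using small by simp
    \<comment> \<open>Otherwise \<open>ball x \<rho>\<close> would be filled by the level set,
      against the threshold \<open>1 / D\<close>.\<close>
    have near: "infdist x E \<le> 1 * \<rho>" if x: "x \<in> ball y \<rho>" "x \<in> ?V" for x
    proof (rule ccontr)
      assume "\<not> infdist x E \<le> 1 * \<rho>"
      then have far: "\<rho> < infdist x E" by simp
      have "ball x \<rho> \<subseteq> ?V \<inter> ball y (2 * \<rho>)"
      proof
        fix v assume v: "v \<in> ball x \<rho>"
        then have vy: "v \<in> ball y (2 * \<rho>)" using x(1) dist_triangle[of y v x] by simp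
        have "v \<notin> E" using v far infdist_le[of v E x] by auto
        then show "v \<in> ?V \<inter> ball y (2 * \<rho>)" using vy \<rho>(4) by (auto simp: E_def)
      qed
      then have "measure \<mu> (ball x \<rho>) \<le> a"
        unfolding a_def using fin by (intro measure_mono_fmeasurable) auto
      moreover have "?m \<le> D ^ 1 * measure \<mu> (ball x \<rho>)"
        using x(1) \<rho>(1) by (intro mu.measure_ball_le) auto
      ultimately have "?m \<le> D * a" using D_pos by (smt (verit) mult_left_mono power_one_right)
      also have "\<dots> < D * (\<beta> * ?m)" using a\<beta> D_pos by simp
      also have "\<dots> \<le> 1 * ?m" using \<beta>(2) m0 by (simp only: mult.assoc[symmetric] mult_le_cancel_right) (simp add: mult.commute)
      finally show False by simp
    qed
    obtain w where w: "(lip_const * S)-lipschitz_on UNIV w"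
      and w_eq: "\<And>x. x \<in> ball z (4 * r) - ?V \<Longrightarrow> w x = u x"
      using truncation_exists[OF u S r B\<^sub>0] by blast
    have w_Lip: "w \<in> Lip" using w by (auto simp: Lip_def)
    have wE: "w x = u x" if "x \<in> E" for x using w_eq that by (simp add: E_def)
    have "(\<integral>\<^sup>+x\<in>ball y \<rho>. ennreal (\<bar>u x - w x\<bar> powr p) \<partial>\<nu>) \<le>
        ennreal (trunc_const * (S * \<rho>) powr p * 1 powr \<tau> * (?n / ?m)) * ennreal a"
      unfolding a[symmetric] by (rule truncation_error[OF u S r B\<^sub>0 w E_def wE E \<rho> zero_less_one order_refl near])
    also have "\<dots> \<le> ennreal (trunc_const * \<beta> * ((s * \<rho>) powr p * ?n))"
    proof -
      have "trunc_const * (S * \<rho>) powr p * 1 powr \<tau> * (?n / ?m) * a \<le>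
          trunc_const * (S * \<rho>) powr p * 1 powr \<tau> * (?n / ?m) * (\<beta> * (s / S) powr p * ?m)"
        using small trunc_const_pos n0 m0 by (intro mult_left_mono) auto
      also have "\<dots> = trunc_const * \<beta> * ((s * \<rho>) powr p * ?n)"
        using m0 S s \<rho>(1) by (simp add: powr_mult powr_divide)
      finally show ?thesis using trunc_const_pos n0 m0 by (simp add: a_def ennreal_leI flip: ennreal_mult)
    qed
    finally have err: "(\<integral>\<^sup>+x\<in>ball y \<rho>. ennreal (\<bar>u x - w x\<bar> powr p) \<partial>\<nu>) \<le>
        ennreal (trunc_const * \<beta> * ((s * \<rho>) powr p * ?n))" .
    \<comment> \<open>The truncation inherits \<open>g\<close> where it equals \<open>u\<close>;
      elsewhere its Lipschitz constant serves.\<close>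
    define gw where "gw x = (if x \<in> E then g x else ennreal (lip_const * S))" for x
    have "E \<in> sets borel" unfolding E_def using level_set_borel by (intro sets.Diff) auto
    then have gw: "gw \<in> upper_gradients \<mu> p w"
      unfolding gw_def using p g w wE
      by (intro mu.upper_gradients_glue_borel[where u = u] mu.upper_gradients_Lipschitz) auto
    obtain c where c: "osc w y \<rho> c \<le> ennreal (K * (2 * \<rho>) powr p * (?n / ?m)) *
        (\<integral>\<^sup>+x\<in>ball y \<rho>. ennreal_powr (gw x) p \<partial>\<mu>)"
      using poincare_osc[OF w_Lip gw \<rho>(1)] by blast
    have sub2: "ball y \<rho> \<subseteq> ball y (2 * \<rho>)" using \<rho>(1) by (intro subset_ball) simp
    have L1: "1 \<le> lip_const powr p" using lip_const_ge_1 p by (simp add: ge_one_powr_ge_zero)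
    have gw_h: "ennreal_powr (gw x) p \<le> ennreal (lip_const powr p) * h x" if "x \<in> ball y \<rho>" for x
    proof (cases "x \<in> ?V")
      case True
      have "ennreal_powr (ennreal (lip_const * S)) p = ennreal ((lip_const * S) powr p)"
        using S lip_const_ge_1 by (intro ennreal_powr_ennreal) simp
      also have "\<dots> = ennreal (lip_const powr p) * ennreal (S powr p)"
        using S lip_const_ge_1 by (simp add: powr_mult ennreal_mult)
      finally show ?thesis using True by (simp add: gw_def E_def h_def)
    next
      case False
      then have "x \<in> E" unfolding E_def using that sub2 \<rho>(4) by blast
      then have "ennreal_powr (gw x) p = 1 * h x" using False by (simp add: gw_def h_def)
      also have "\<dots> \<le> ennreal (lip_const powr p) * h x"
        using mult_right_mono[OF ennreal_leI[OF L1], of "h x"] by simp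
      finally show ?thesis .
    qed
    have h_meas: "h \<in> borel_measurable \<mu>"
    proof -
      have [measurable]: "g \<in> borel_measurable \<mu>" using mu.upper_gradients_measurable[OF g] .
      show ?thesis unfolding h_def by measurable
    qed
    have Igw: "(\<integral>\<^sup>+x\<in>ball y \<rho>. ennreal_powr (gw x) p \<partial>\<mu>) \<le>
        ennreal (lip_const powr p) * (\<integral>\<^sup>+x\<in>ball y (2 * \<rho>). h x \<partial>\<mu>)"
    proof -
      have "(\<integral>\<^sup>+x\<in>ball y \<rho>. ennreal_powr (gw x) p \<partial>\<mu>) \<le>
          (\<integral>\<^sup>+x. ennreal (lip_const powr p) * (h x * indicator (ball y (2 * \<rho>)) x) \<partial>\<mu>)"
        using gw_h sub2 by (intro nn_integral_mono) (auto split: split_indicator)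
      also have "\<dots> = ennreal (lip_const powr p) * (\<integral>\<^sup>+x\<in>ball y (2 * \<rho>). h x \<partial>\<mu>)"
        using h_meas by (intro nn_integral_cmult) auto
      finally show ?thesis .
    qed
    show ?thesis
    proof (cases "(\<integral>\<^sup>+x\<in>ball y (2 * \<rho>). h x \<partial>\<mu>) = \<infinity>")
      case True
      then show ?thesis using \<beta>(1) by (simp add: ennreal_mult_top)
    next
      case False
      then obtain i where i: "(\<integral>\<^sup>+x\<in>ball y (2 * \<rho>). h x \<partial>\<mu>) = ennreal i" "0 \<le> i"
        by (cases "\<integral>\<^sup>+x\<in>ball y (2 * \<rho>). h x \<partial>\<mu>") auto
      have c': "osc w y \<rho> c \<le> ennreal (K * (2 * \<rho>) powr p * (?n / ?m) * (lip_const powr p * i))"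
      proof -
        have "osc w y \<rho> c \<le> ennreal (K * (2 * \<rho>) powr p * (?n / ?m)) * (ennreal (lip_const powr p) * ennreal i)"
          using c Igw unfolding i(1) by (meson mult_left_mono order_trans zero_le)
        then show ?thesis using i(2) K n0 m0 by (simp flip: ennreal_mult)
      qed
      \<comment> \<open>On an uncontrolled ball every constant fails, in particular the one that is
        good for \<open>w\<close>. The truncation error takes at most half of the left side, so the
        energy of \<open>w\<close> must account for the rest.\<close>
      have "ennreal ((s * \<rho>) powr p * ?n) < osc u y \<rho> c" using bad by (auto simp: controlled_def not_le)
      also have "\<dots> \<le> ennreal (2 powr p) * ((\<integral>\<^sup>+x\<in>ball y \<rho>. ennreal (\<bar>u x - w x\<bar> powr p) \<partial>\<nu>) + osc w y \<rho> c)"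
        unfolding osc_def by (rule nn_integral_powr_triangle[OF u const_Lip w_Lip])
      also have "\<dots> \<le> ennreal (2 powr p) * (ennreal (trunc_const * \<beta> * ((s * \<rho>) powr p * ?n)) +
          ennreal (K * (2 * \<rho>) powr p * (?n / ?m) * (lip_const powr p * i)))"
        by (intro mult_left_mono add_mono err c') simp
      also have "\<dots> = ennreal (2 powr p * (trunc_const * \<beta> * ((s * \<rho>) powr p * ?n) +
          K * (2 * \<rho>) powr p * (?n / ?m) * (lip_const powr p * i)))"
        using trunc_const_pos \<beta>(1) n0 m0 K i(2) by (simp flip: ennreal_plus ennreal_mult)
      finally have "(s * \<rho>) powr p * ?n < 2 powr p * (trunc_const * \<beta> * ((s * \<rho>) powr p * ?n) +
          K * (2 * \<rho>) powr p * (?n / ?m) * (lip_const powr p * i))"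
        by (simp add: ennreal_less_iff)
      moreover have "2 powr p * (trunc_const * \<beta> * ((s * \<rho>) powr p * ?n)) \<le> 1 / 2 * ((s * \<rho>) powr p * ?n)"
        using mult_right_mono[OF \<beta>(3), of "(s * \<rho>) powr p * ?n"] n0 by (simp add: mult_ac)
      moreover have "2 powr p * (K * (2 * \<rho>) powr p * (?n / ?m) * (lip_const powr p * i)) =
          \<rho> powr p * ?n * (4 powr p * K * lip_const powr p * i / ?m)"
      proof -
        have "(4::real) powr p = 2 powr p * 2 powr p" by (simp flip: powr_mult)
        then show ?thesis using \<rho>(1) by (simp add: powr_mult)
      qed
      ultimately have "1 / 2 * ((s * \<rho>) powr p * ?n) \<le> \<rho> powr p * ?n * (4 powr p * K * lip_const powr p * i / ?m)"
        unfolding distrib_left by linarith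
      then have "\<rho> powr p * ?n * (1 / 2 * s powr p) \<le> \<rho> powr p * ?n * (4 powr p * K * lip_const powr p * i / ?m)"
        using s \<rho>(1) by (simp add: powr_mult mult_ac)
      then have "1 / 2 * s powr p \<le> 4 powr p * K * lip_const powr p * i / ?m"
        using \<rho>(1) n0 by (subst (asm) mult_le_cancel_left_pos) auto
      then have "s powr p * ?m \<le> C * i" using m0 by (simp add: C_def field_simps)
      then show ?thesis unfolding i(1) using C i(2) by (simp flip: ennreal_mult add: ennreal_leI)
    qed
  qed
  have "ennreal (1 / \<beta>) * I \<le> ennreal (1 / \<beta> + C) * I" "ennreal C * I \<le> ennreal (1 / \<beta> + C) * I" for I
    using \<beta>(1) C by (auto intro!: mult_right_mono ennreal_leI)
  then show ?thesis using main unfolding h_def \<beta>_def C_def by (meson order_trans)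
qed

text \<open>Covers the level set by the doubled balls over which \<open>weak_estimate_ball\<close>
  integrates; the smallness of balls that meet \<open>ball z (2 * r)\<close> keeps them all within
  \<open>ball z (4 * r)\<close>.\<close>

lemma weak_estimate:
  assumes u: "u \<in> Lip" and g: "g \<in> upper_gradients \<mu> p u" and s: "0 < s" "s \<le> S"
    and r: "0 < r" and B\<^sub>0: "ball z (40 * r) \<subseteq> B\<^sub>0" and E: "ball z (4 * r) - level_set B\<^sub>0 2 u S \<noteq> {}"
    and small: "\<And>y \<rho>. 0 < \<rho> \<Longrightarrow> ball y \<rho> \<subseteq> level_set B\<^sub>0 2 u s \<Longrightarrow> ball y \<rho> \<inter> ball z (2 * r) \<noteq> {} \<Longrightarrow> \<rho> \<le> r / 8"
  shows "ennreal (s powr p) * emeasure \<mu> (level_set B\<^sub>0 2 u s \<inter> ball z (2 * r)) \<le> ennreal weak_const *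
    (\<integral>\<^sup>+x\<in>ball z (4 * r). ennreal (S powr p) * indicator (level_set B\<^sub>0 2 u S) x +
      ennreal_powr (g x) p * indicator (- level_set B\<^sub>0 2 u S) x \<partial>\<mu>)"
proof -
  let ?V = "level_set B\<^sub>0 2 u"
  define h where "h x = ennreal (S powr p) * indicator (?V S) x + ennreal_powr (g x) p * indicator (- ?V S) x" for x
  have [measurable]: "g \<in> borel_measurable \<mu>" using mu.upper_gradients_measurable[OF g] .
  have h_meas [measurable]: "h \<in> borel_measurable \<mu>" unfolding h_def by measurable
  define C where "C = 1 / density_const + 2 * 4 powr p * K * lip_const powr p"
  have C: "0 \<le> C" using K density_const_pos by (simp add: C_def)
  define F where "F = {(y, 2 * \<rho>) | y \<rho>. 0 < \<rho> \<and> fits \<rho> \<and> \<rho> \<le> r / 8 \<and> ball y (2 * \<rho>) \<subseteq> ball z (4 * r) \<and>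
    \<not> controlled u y \<rho> s}"
  have "ennreal (s powr p) * emeasure \<mu> (?V s \<inter> ball z (2 * r)) =
      (\<integral>\<^sup>+x\<in>?V s \<inter> ball z (2 * r). ennreal (s powr p) \<partial>\<mu>)"
    by (simp add: nn_integral_cmult_indicator)
  also have "\<dots> \<le> (\<integral>\<^sup>+x\<in>(\<Union>(y, \<rho>)\<in>F. ball y \<rho>). ennreal (s powr p) \<partial>\<mu>)"
  proof (rule nn_set_integral_set_mono, rule subsetI)
    fix x assume x: "x \<in> ?V s \<inter> ball z (2 * r)"
    then have "x \<in> ?V s" by blast
    then obtain y \<rho> where y: "0 < \<rho>" "fits \<rho>" "ball y (2 * \<rho>) \<subseteq> B\<^sub>0" "x \<in> ball y \<rho>" "\<not> controlled u y \<rho> s"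
      by (rule level_setE[OF _ less_imp_le[OF s(1)] zero_le_numeral])
    have "ball y \<rho> \<subseteq> ?V s" using level_setI[OF y(1,3) _ y(5)] by blast
    then have "\<rho> \<le> r / 8" using x y by (intro small) auto
    moreover have "ball y (2 * \<rho>) \<subseteq> ball z (4 * r)"
    proof
      fix t assume "t \<in> ball y (2 * \<rho>)"
      then show "t \<in> ball z (4 * r)"
        using x y(4) \<open>\<rho> \<le> r / 8\<close> r dist_triangle[of z t y] dist_triangle[of z y x] by (simp add: dist_commute)
    qed
    ultimately have "(y, 2 * \<rho>) \<in> F" using y by (auto simp: F_def)
    moreover have "x \<in> ball y (2 * \<rho>)" using y(1,4) by simp
    ultimately show "x \<in> (\<Union>(y, \<rho>)\<in>F. ball y \<rho>)" by blast
  qed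
  also have "\<dots> \<le> (\<integral>\<^sup>+x\<in>(\<Union>(y, \<rho>)\<in>F. ball y \<rho>). ennreal (D ^ 4 * C) * h x \<partial>\<mu>)"
  proof (rule mu.vitali_nn_integral[where R = r])
    show "0 < \<rho> \<and> \<rho> \<le> r" if "(y, \<rho>) \<in> F" for y \<rho> using that r by (auto simp: F_def)
    fix y \<rho>' assume "(y, \<rho>') \<in> F"
    then obtain \<rho> where \<rho>: "\<rho>' = 2 * \<rho>" "0 < \<rho>" "fits \<rho>" "\<rho> \<le> r / 8" "ball y (2 * \<rho>) \<subseteq> ball z (4 * r)"
      "\<not> controlled u y \<rho> s" by (auto simp: F_def)
    have "(\<integral>\<^sup>+x\<in>ball y (5 * \<rho>'). ennreal (s powr p) \<partial>\<mu>) = ennreal (s powr p * measure \<mu> (ball y (10 * \<rho>)))"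
      by (simp add: nn_integral_cmult_indicator mu.emeasure_ball ennreal_mult \<rho>(1))
    also have "\<dots> \<le> ennreal (D ^ 4 * (s powr p * measure \<mu> (ball y \<rho>)))"
    proof (rule ennreal_leI)
      have "measure \<mu> (ball y (10 * \<rho>)) \<le> D ^ 4 * measure \<mu> (ball y \<rho>)"
        using \<rho>(2) by (intro mu.measure_ball_le) auto
      then have "s powr p * measure \<mu> (ball y (10 * \<rho>)) \<le> s powr p * (D ^ 4 * measure \<mu> (ball y \<rho>))"
        by (rule mult_left_mono) simp
      then show "s powr p * measure \<mu> (ball y (10 * \<rho>)) \<le> D ^ 4 * (s powr p * measure \<mu> (ball y \<rho>))"
        by (simp add: mult_ac)
    qed
    also have "\<dots> = ennreal (D ^ 4) * ennreal (s powr p * measure \<mu> (ball y \<rho>))"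
      using D_pos by (simp add: ennreal_mult)
    also have "\<dots> \<le> ennreal (D ^ 4) * (ennreal C * (\<integral>\<^sup>+x\<in>ball y (2 * \<rho>). h x \<partial>\<mu>))"
      unfolding C_def h_def using \<rho> r
      by (intro mult_left_mono weak_estimate_ball[OF u g s r B\<^sub>0 refl E]) auto
    also have "\<dots> = ennreal (D ^ 4 * C) * (\<integral>\<^sup>+x\<in>ball y (2 * \<rho>). h x \<partial>\<mu>)"
      using D_pos C by (simp add: ennreal_mult mult.assoc)
    also have "\<dots> = (\<integral>\<^sup>+x\<in>ball y \<rho>'. ennreal (D ^ 4 * C) * h x \<partial>\<mu>)"
      unfolding \<rho>(1) mult.assoc by (rule nn_integral_cmult[symmetric]) measurable
    finally show "(\<integral>\<^sup>+x\<in>ball y (5 * \<rho>'). ennreal (s powr p) \<partial>\<mu>) \<le>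
        (\<integral>\<^sup>+x\<in>ball y \<rho>'. ennreal (D ^ 4 * C) * h x \<partial>\<mu>)" .
  next
    show "(\<lambda>_. ennreal (s powr p)) \<in> borel_measurable \<mu>" "(\<lambda>x. ennreal (D ^ 4 * C) * h x) \<in> borel_measurable \<mu>"
      by measurable
  qed (rule borel_subset)+
  also have "\<dots> \<le> (\<integral>\<^sup>+x\<in>ball z (4 * r). ennreal (D ^ 4 * C) * h x \<partial>\<mu>)"
    by (rule nn_set_integral_set_mono) (auto simp: F_def)
  also have "\<dots> = (\<integral>\<^sup>+x. ennreal (D ^ 4 * C) * (h x * indicator (ball z (4 * r)) x) \<partial>\<mu>)"
    by (simp only: mult.assoc)
  also have "\<dots> = ennreal (D ^ 4 * C) * (\<integral>\<^sup>+x\<in>ball z (4 * r). h x \<partial>\<mu>)"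
    by (rule nn_integral_cmult) measurable
  finally show ?thesis by (simp only: h_def weak_const_def C_def)
qed

text \<open>Balls with double in \<open>B\<^sub>0\<close> are reached from much smaller ones by chains along geodesics.\<close>

lemma controlled_chain:
  assumes u: "u \<in> Lip" and r: "0 < r" and s: "0 < s"
    and ctrl: "\<And>y. y \<in> ball z r \<Longrightarrow> controlled u y (r / 40) s"
  shows "controlled u z r (32 * D ^ 6 * s)"
proof -
  obtain c where c: "\<And>y. y \<in> ball z r \<Longrightarrow>
      osc u y (r / 40) (c y) \<le> ennreal ((s * (r / 40)) powr p * measure \<nu> (ball y (r / 40)))"
    using ctrl unfolding controlled_def by metis
  \<comment> \<open>The factor \<open>D\<^sup>2\<close> compares a ball of radius
    \<open>r / 40\<close> with the ball of half that radius around a neighbouring centre, on which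
    both constants are tested.\<close>
  define \<sigma> where "\<sigma> = D\<^sup>2 * (s * (r / 40))"
  have \<sigma>: "0 < \<sigma>" using D_pos s r by (simp add: \<sigma>_def)
  have link: "\<bar>c y - c v\<bar> \<le> 4 * \<sigma>"
    if yv: "y \<in> ball z r" "v \<in> ball z r" "dist v y \<le> r / 80" for y v
  proof (rule osc_const_diff[OF u _ \<sigma>, where x = y and r = "r / 80"])
    have half: "osc u y (r / 80) (c t) \<le> ennreal (\<sigma> powr p * measure \<nu> (ball y (r / 80)))"
      if t: "t \<in> ball z r" "dist t y \<le> r / 80" for t
    proof -
      have "osc u y (r / 80) (c t) \<le> osc u t (r / 40) (c t)"
      proof (rule osc_mono, rule subsetI)
        fix x assume "x \<in> ball y (r / 80)"
        then show "x \<in> ball t (r / 40)" using t(2) dist_triangle[of t x y] by simp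
      qed
      also have "\<dots> \<le> ennreal ((s * (r / 40)) powr p * measure \<nu> (ball t (r / 40)))" by (rule c[OF t(1)])
      also have "\<dots> \<le> ennreal (\<sigma> powr p * measure \<nu> (ball y (r / 80)))"
      proof (rule ennreal_leI)
        have "measure \<nu> (ball t (r / 40)) \<le> D\<^sup>2 * measure \<nu> (ball y (r / 80))"
          using r t(2) by (intro nu.measure_ball_le) auto
        also have "\<dots> \<le> D\<^sup>2 powr p * measure \<nu> (ball y (r / 80))"
          using D_powr[of 2] by (intro mult_right_mono) auto
        finally have "(s * (r / 40)) powr p * measure \<nu> (ball t (r / 40)) \<le>
            (s * (r / 40)) powr p * (D\<^sup>2 powr p * measure \<nu> (ball y (r / 80)))" by (rule mult_left_mono) simp
        moreover have "\<sigma> powr p = D\<^sup>2 powr p * (s * (r / 40)) powr p"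
          unfolding \<sigma>_def by (subst powr_mult) (use s r D_pos in auto)
        ultimately show "(s * (r / 40)) powr p * measure \<nu> (ball t (r / 40)) \<le> \<sigma> powr p * measure \<nu> (ball y (r / 80))"
          by (simp only: mult_ac)
      qed
      finally show ?thesis .
    qed
    show "osc u y (r / 80) (c y) \<le> ennreal (\<sigma> powr p * measure \<nu> (ball y (r / 80)))"
      using yv r by (intro half) auto
    show "osc u y (r / 80) (c v) \<le> ennreal (\<sigma> powr p * measure \<nu> (ball y (r / 80)))"
      using yv by (intro half) auto
  qed (use r in simp)
  have chain: "\<bar>c y - c z\<bar> \<le> real n * (4 * \<sigma>)" if "y \<in> ball z r" "dist z y \<le> real n * (r / 80)" for n y
    using that
  proof (induction n arbitrary: y)
    case 0
    then show ?case by simp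
  next
    case (Suc n)
    show ?case
    proof (cases "dist z y \<le> r / 80")
      case True
      have "\<bar>c y - c z\<bar> \<le> 4 * \<sigma>" using True Suc.prems r by (intro link) auto
      also have "\<dots> \<le> real (Suc n) * (4 * \<sigma>)" using \<sigma> by simp
      finally show ?thesis .
    next
      case False
      obtain v where v: "dist z v = dist z y - r / 80" "dist v y = dist z y - (dist z y - r / 80)"
        by (rule geodesic_point[of "dist z y - r / 80" z y]) (use False r in auto)
      have vz: "v \<in> ball z r" using v(1) Suc.prems(1) r by simp
      have "\<bar>c v - c z\<bar> \<le> real n * (4 * \<sigma>)"
        using v(1) Suc.prems(2) vz by (intro Suc.IH) (auto simp: field_simps)
      moreover have "\<bar>c y - c v\<bar> \<le> 4 * \<sigma>" using v(2) Suc.prems vz by (intro link) auto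
      ultimately have "\<bar>c y - c z\<bar> \<le> real n * (4 * \<sigma>) + 4 * \<sigma>" by linarith
      then show ?thesis by (simp add: distrib_right)
    qed
  qed
  \<comment> \<open>A point of the ball is reached in 80 steps of length at most
    \<open>r / 80\<close>, each costing \<open>4 * \<sigma>\<close>; the product is
    \<open>T\<close>.\<close>
  define T where "T = 8 * D\<^sup>2 * s * r"
  have T: "0 < T" using D_pos s r by (simp add: T_def)
  have cz: "\<bar>c y - c z\<bar> \<le> T" if "y \<in> ball z r" for y
    using chain[of y 80] that by (simp add: T_def \<sigma>_def mult_ac)
  define Q where "Q = (4 * T) powr p * D ^ 3"
  have Q: "0 \<le> Q" using D_pos by (simp add: Q_def)
  \<comment> \<open>The fivefold balls have radius \<open>r / 40\<close>, the one for which the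
    constants \<open>c y\<close> are good.\<close>
  define F where "F = (\<lambda>y. (y, r / 200)) ` ball z r"
  have [measurable]: "u \<in> borel_measurable \<nu>"
    using u by (intro nu.borel_imp_measurable Lip_borel_measurable)
  have sub: "ball z r \<subseteq> (\<Union>(y, \<rho>)\<in>F. ball y \<rho>)" using r by (force simp: F_def)
  have "osc u z r (c z) \<le> (\<integral>\<^sup>+x\<in>(\<Union>(y, \<rho>)\<in>F. ball y \<rho>). ennreal (\<bar>u x - c z\<bar> powr p) \<partial>\<nu>)"
    unfolding osc_def by (rule nn_set_integral_set_mono[OF sub])
  also have "\<dots> \<le> (\<integral>\<^sup>+x\<in>(\<Union>(y, \<rho>)\<in>F. ball y \<rho>). ennreal Q \<partial>\<nu>)"
  proof (rule nu.vitali_nn_integral[where R = "r / 200"])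
    show "0 < \<rho> \<and> \<rho> \<le> r / 200" if "(y, \<rho>) \<in> F" for y \<rho> using that r by (auto simp: F_def)
    fix y \<rho> assume "(y, \<rho>) \<in> F"
    then have y: "y \<in> ball z r" "\<rho> = r / 200" by (auto simp: F_def)
    let ?n = "measure \<nu> (ball y (r / 40))"
    have "(\<integral>\<^sup>+x\<in>ball y (5 * \<rho>). ennreal (\<bar>u x - c z\<bar> powr p) \<partial>\<nu>) = osc u y (r / 40) (c z)"
      by (simp add: osc_def y(2))
    also have "\<dots> \<le> ennreal (2 powr p) * (osc u y (r / 40) (c y) + osc (\<lambda>_. c y) y (r / 40) (c z))"
      unfolding osc_def by (rule nn_integral_powr_triangle[OF u const_Lip const_Lip])
    also have "\<dots> \<le> ennreal (2 powr p) * (ennreal (T powr p * ?n) + ennreal (T powr p * ?n))"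
    proof (intro mult_left_mono add_mono)
      have "1 \<le> D\<^sup>2" using D_ge_1 by (simp add: one_le_power)
      then have "s * (r / 40) \<le> T" using s r mult_right_mono[of 1 "D\<^sup>2" "s * r"] by (simp add: T_def mult_ac)
      then have "(s * (r / 40)) powr p * ?n \<le> T powr p * ?n"
        using s r p by (intro mult_right_mono powr_mono2) auto
      then show "osc u y (r / 40) (c y) \<le> ennreal (T powr p * ?n)"
        by (intro order_trans[OF c[OF y(1)]] ennreal_leI)
      show "osc (\<lambda>_. c y) y (r / 40) (c z) \<le> ennreal (T powr p * ?n)"
        using cz[OF y(1)] by (rule osc_le_const)
    qed simp
    also have "\<dots> = ennreal (2 powr p * 2 * T powr p * ?n)"
      by (simp flip: ennreal_plus ennreal_mult add: algebra_simps)
    also have "\<dots> \<le> ennreal (Q * measure \<nu> (ball y \<rho>))"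
    proof (rule ennreal_leI)
      have "2 powr p * 2 * T powr p \<le> 2 powr p * 2 powr p * T powr p"
        using le_powr_self[of 2 p] p by (intro mult_right_mono mult_left_mono) auto
      also have "\<dots> = (4 * T) powr p" using T by (simp flip: powr_mult)
      finally have "2 powr p * 2 * T powr p * ?n \<le> (4 * T) powr p * (D ^ 3 * measure \<nu> (ball y \<rho>))"
        using r y(2) by (intro mult_mono nu.measure_ball_le) auto
      then show "2 powr p * 2 * T powr p * ?n \<le> Q * measure \<nu> (ball y \<rho>)" by (simp add: Q_def mult.assoc)
    qed
    also have "\<dots> = (\<integral>\<^sup>+x\<in>ball y \<rho>. ennreal Q \<partial>\<nu>)"
      using Q by (simp add: nn_integral_cmult_indicator nu.emeasure_ball ennreal_mult)
    finally show "(\<integral>\<^sup>+x\<in>ball y (5 * \<rho>). ennreal (\<bar>u x - c z\<bar> powr p) \<partial>\<nu>) \<le> (\<integral>\<^sup>+x\<in>ball y \<rho>. ennreal Q \<partial>\<nu>)" .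
  next
    show "(\<lambda>x. ennreal (\<bar>u x - c z\<bar> powr p)) \<in> borel_measurable \<nu>" "(\<lambda>_. ennreal Q) \<in> borel_measurable \<nu>"
      by measurable
  qed (rule borel_subset)+
  also have "\<dots> \<le> (\<integral>\<^sup>+x\<in>ball z (2 * r). ennreal Q \<partial>\<nu>)"
  proof (rule nn_set_integral_set_mono, rule subsetI)
    fix x assume "x \<in> (\<Union>(y, \<rho>)\<in>F. ball y \<rho>)"
    then obtain y where "dist z y < r" "dist y x < r / 200" by (auto simp: F_def)
    then show "x \<in> ball z (2 * r)" using dist_triangle[of z x y] r by simp
  qed
  also have "\<dots> = ennreal (Q * measure \<nu> (ball z (2 * r)))"
    using Q by (simp add: nn_integral_cmult_indicator nu.emeasure_ball ennreal_mult)
  \<comment> \<open>One more \<open>D\<close> pays for the passage from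
    \<open>ball z (2 * r)\<close>; then \<open>D ^ 4\<close> is absorbed into the power, where
    \<open>4 * 8 * D\<^sup>2 * D ^ 4\<close> is the stated constant.\<close>
  also have "\<dots> \<le> ennreal ((32 * D ^ 6 * s * r) powr p * measure \<nu> (ball z r))"
  proof (rule ennreal_leI)
    have "Q * measure \<nu> (ball z (2 * r)) \<le> Q * (D * measure \<nu> (ball z r))"
      using Q r by (intro mult_left_mono nu.doubling) auto
    also have "\<dots> = (4 * T) powr p * D ^ 4 * measure \<nu> (ball z r)" by (simp add: Q_def power_numeral_reduce)
    also have "\<dots> \<le> (4 * T) powr p * (D ^ 4) powr p * measure \<nu> (ball z r)"
      using D_powr[of 4] by (intro mult_right_mono mult_left_mono) auto
    also have "(4 * T) powr p * (D ^ 4) powr p = (32 * D ^ 6 * s * r) powr p"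
    proof -
      have "4 * T * D ^ 4 = 32 * D ^ 6 * s * r" by (simp add: T_def power_numeral_reduce)
      moreover have "(4 * T) powr p * (D ^ 4) powr p = (4 * T * D ^ 4) powr p"
        using T D_pos by (simp add: powr_mult)
      ultimately show ?thesis by (simp only:)
    qed
    finally show "Q * measure \<nu> (ball z (2 * r)) \<le> (32 * D ^ 6 * s * r) powr p * measure \<nu> (ball z r)" .
  qed
  finally show ?thesis by (auto simp: controlled_def)
qed

text \<open>A fitting radius is at most eight times the diameter of its ball. This supplies the
  uniform bound on radii that the covering lemma requires.\<close>

lemma radius_bound:
  fixes y x\<^sub>0 :: 'a
  assumes "fits \<rho>" "0 < \<rho>" "ball y \<rho> \<subseteq> ball x\<^sub>0 r\<^sub>0"
  shows "\<rho> \<le> 16 * r\<^sub>0"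
proof -
  have "y \<in> ball y \<rho>" using assms(2) by simp
  then have "y \<in> ball x\<^sub>0 r\<^sub>0" using assms(3) by blast
  then have "0 < r\<^sub>0" by (metis dist_not_less_zero linorder_neqE_linordered_idom mem_ball less_trans)
  have "\<rho> / 8 \<le> diameter (ball y \<rho>)" by (rule fits_diameter[OF assms(1,2)])
  also have "\<dots> \<le> diameter (ball x\<^sub>0 r\<^sub>0)" using assms(3) by (rule diameter_subset) simp
  also have "\<dots> \<le> 2 * r\<^sub>0" using \<open>0 < r\<^sub>0\<close> by (rule diameter_ball_le)
  finally show ?thesis by simp
qed

text \<open>By \<open>controlled_chain\<close>, an uncontrolled \<open>ball z r\<close> contains the
  centre of an uncontrolled ball of radius \<open>r / 40\<close>, whose forty-fold enlargement lies
  in \<open>ball z (2 * r)\<close>. The exponent 9 compares this small ball with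
  \<open>ball z (10 * r)\<close>.\<close>

lemma level_set_compare:
  assumes u: "u \<in> Lip" and s: "0 < s"
  shows "emeasure \<mu> (level_set (ball x\<^sub>0 r\<^sub>0) 2 u (32 * D ^ 6 * s)) \<le>
    ennreal (D ^ 9) * emeasure \<mu> (level_set (ball x\<^sub>0 r\<^sub>0) 40 u s)"
proof -
  let ?B = "ball x\<^sub>0 r\<^sub>0" and ?t = "32 * D ^ 6 * s"
  let ?V = "level_set ?B 40 u s"
  have t: "0 \<le> ?t" using D_pos s by simp
  define F where "F = {(z, 2 * r) | z r. 0 < r \<and> fits r \<and> ball z (2 * r) \<subseteq> ?B \<and> \<not> controlled u z r ?t}"
  have "emeasure \<mu> (level_set ?B 2 u ?t) = (\<integral>\<^sup>+x\<in>level_set ?B 2 u ?t. 1 \<partial>\<mu>)" by simp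
  also have "\<dots> \<le> (\<integral>\<^sup>+x\<in>(\<Union>(y, \<rho>)\<in>F. ball y \<rho>). 1 \<partial>\<mu>)"
  proof (rule nn_set_integral_set_mono, rule subsetI)
    fix x assume "x \<in> level_set ?B 2 u ?t"
    then obtain z r where "0 < r" "fits r" "ball z (2 * r) \<subseteq> ?B" "x \<in> ball z r" "\<not> controlled u z r ?t"
      by (rule level_setE[OF _ t zero_le_numeral])
    then have "(z, 2 * r) \<in> F" "x \<in> ball z (2 * r)" by (auto simp: F_def)
    then show "x \<in> (\<Union>(y, \<rho>)\<in>F. ball y \<rho>)" by blast
  qed
  also have "\<dots> \<le> (\<integral>\<^sup>+x\<in>(\<Union>(y, \<rho>)\<in>F. ball y \<rho>). ennreal (D ^ 9) * indicator ?V x \<partial>\<mu>)"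
  proof (rule mu.vitali_nn_integral[where R = "32 * r\<^sub>0"])
    show "0 < \<rho> \<and> \<rho> \<le> 32 * r\<^sub>0" if zF: "(z, \<rho>) \<in> F" for z \<rho>
    proof -
      obtain r where r: "\<rho> = 2 * r" "0 < r" "fits r" "ball z (2 * r) \<subseteq> ?B" using zF by (auto simp: F_def)
      have "ball z r \<subseteq> ball z (2 * r)" using r(2) by (intro subset_ball) simp
      then show ?thesis using radius_bound[of r z x\<^sub>0 r\<^sub>0] r by auto
    qed
    fix z \<rho> assume "(z, \<rho>) \<in> F"
    then obtain r where r: "\<rho> = 2 * r" "0 < r" "fits r" "ball z (2 * r) \<subseteq> ?B" "\<not> controlled u z r ?t"
      by (auto simp: F_def)
    obtain y where y: "y \<in> ball z r" "\<not> controlled u y (r / 40) s"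
      using controlled_chain[OF u r(2) s] r(5) by blast
    have ysub: "ball y r \<subseteq> ball z (2 * r)"
    proof
      fix x assume "x \<in> ball y r"
      then show "x \<in> ball z (2 * r)" using y(1) dist_triangle[of z x y] by simp
    qed
    have "ball y (r / 40) \<subseteq> ?V"
    proof
      fix x assume "x \<in> ball y (r / 40)"
      then show "x \<in> ?V" using ysub r(2,4) y(2) by (intro level_setI[of "r / 40" y]) auto
    qed
    moreover have "ball y (r / 40) \<subseteq> ball z \<rho>"
      using ysub r(1,2) subset_ball[of "r / 40" r y] by auto
    ultimately have sub: "ball y (r / 40) \<subseteq> ?V \<inter> ball z \<rho>" by blast
    have "(\<integral>\<^sup>+x\<in>ball z (5 * \<rho>). 1 \<partial>\<mu>) = ennreal (measure \<mu> (ball z (10 * r)))"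
      by (simp add: r(1) mu.emeasure_ball)
    also have "\<dots> \<le> ennreal (D ^ 9 * measure \<mu> (ball y (r / 40)))"
      using y(1) r(2) by (intro ennreal_leI mu.measure_ball_le) auto
    also have "\<dots> = ennreal (D ^ 9) * emeasure \<mu> (ball y (r / 40))"
      using D_pos by (simp add: mu.emeasure_ball ennreal_mult)
    also have "\<dots> \<le> ennreal (D ^ 9) * emeasure \<mu> (?V \<inter> ball z \<rho>)"
      using sub by (intro mult_left_mono emeasure_mono) auto
    also have "\<dots> = (\<integral>\<^sup>+x\<in>?V \<inter> ball z \<rho>. ennreal (D ^ 9) \<partial>\<mu>)"
      by (simp add: nn_integral_cmult_indicator)
    also have "\<dots> = (\<integral>\<^sup>+x\<in>ball z \<rho>. ennreal (D ^ 9) * indicator ?V x \<partial>\<mu>)"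
      by (intro nn_integral_cong) (auto split: split_indicator)
    finally show "(\<integral>\<^sup>+x\<in>ball z (5 * \<rho>). 1 \<partial>\<mu>) \<le> (\<integral>\<^sup>+x\<in>ball z \<rho>. ennreal (D ^ 9) * indicator ?V x \<partial>\<mu>)" .
  next
    show "(\<lambda>_. 1) \<in> borel_measurable \<mu>" "(\<lambda>x. ennreal (D ^ 9) * indicator ?V x) \<in> borel_measurable \<mu>"
      by measurable
  qed (rule borel_subset)+
  also have "\<dots> \<le> (\<integral>\<^sup>+x\<in>?V. ennreal (D ^ 9) \<partial>\<mu>)"
    by (intro nn_integral_mono) (auto split: split_indicator)
  also have "\<dots> = ennreal (D ^ 9) * emeasure \<mu> ?V"
    by (simp add: nn_integral_cmult_indicator)
  finally show ?thesis .
qed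

end

section \<open>Good-lambda inequality\<close>

text \<open>Jensen's inequality for the power \<open>p\<close>. Young's inequality for each
  \<open>a i\<close> against \<open>m powr (p - 1)\<close> is averaged, and the part of
  \<open>m powr p\<close> on the right is moved to the left.\<close>

lemma powr_mean_le:
  fixes a :: "nat \<Rightarrow> real"
  assumes p: "1 < p" and I: "finite I" "I \<noteq> {}" and a: "\<And>i. i \<in> I \<Longrightarrow> 0 \<le> a i"
  shows "(\<Sum>i\<in>I. a i / card I) powr p \<le> (\<Sum>i\<in>I. a i powr p / card I)"
proof -
  define m where "m = (\<Sum>i\<in>I. a i / card I)"
  define q where "q = p / (p - 1)"
  have n: "0 < real (card I)" using I by (simp add: card_gt_0_iff)
  have m0: "0 \<le> m" unfolding m_def using a by (intro sum_nonneg divide_nonneg_nonneg) auto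
  have q: "1 < q" "1 / p + 1 / q = 1" using p by (auto simp: q_def field_simps)
  have mq: "(m powr (p - 1)) powr q = m powr p" using p by (simp add: q_def powr_powr)
  have "m powr p = m * m powr (p - 1)"
    using m0 p powr_add[of m 1 "p - 1"] by (cases "m = 0") auto
  also have "\<dots> = (\<Sum>i\<in>I. a i * m powr (p - 1) / card I)" by (simp add: m_def sum_distrib_right)
  also have "\<dots> \<le> (\<Sum>i\<in>I. (a i powr p / p + m powr p / q) / card I)"
  proof (intro sum_mono divide_right_mono)
    fix i assume "i \<in> I"
    then show "a i * m powr (p - 1) \<le> a i powr p / p + m powr p / q"
      using Youngs_inequality[of p q "a i" "m powr (p - 1)"] a p q by (simp add: mq)
  qed simp
  also have "\<dots> = (\<Sum>i\<in>I. a i powr p / card I) / p + m powr p / q"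
    using n by (simp add: add_divide_distrib sum.distrib sum_divide_distrib mult.commute)
  finally have "m powr p * (1 - 1 / q) \<le> (\<Sum>i\<in>I. a i powr p / card I) / p" by (simp add: algebra_simps)
  moreover have "1 - 1 / q = 1 / p" using q(2) by simp
  ultimately have "m powr p / p \<le> (\<Sum>i\<in>I. a i powr p / card I) / p" by simp
  then show ?thesis using p by (simp add: m_def divide_le_cancel)
qed

text \<open>A sum of distinct powers of two is at most twice its largest term. This is why averaging
  truncations gains: the power of the sum costs no factor that grows with the number of
  terms.\<close>

lemma powr_geometric_sum_le:
  fixes J :: "nat set" and lam p :: real
  assumes J: "finite J" and lam: "0 < lam" and p: "0 < p"
  shows "(\<Sum>i\<in>J. 2 ^ i * lam) powr p \<le> 2 powr p * (\<Sum>i\<in>J. (2 ^ i * lam) powr p)"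
proof (cases "J = {}")
  case False
  define m where "m = Max J"
  have m: "m \<in> J" "J \<subseteq> {..m}" using J False by (auto simp: m_def)
  have "(\<Sum>i\<in>J. 2 ^ i * lam) \<le> (\<Sum>i\<le>m. 2 ^ i * lam)"
    using lam m by (intro sum_mono2) auto
  also have "\<dots> \<le> 2 * (2 ^ m * lam)"
  proof -
    have "(\<Sum>i\<le>m. (2::real) ^ i) \<le> 2 * 2 ^ m" by (induction m) auto
    then have "(\<Sum>i\<le>m. 2 ^ i) * lam \<le> 2 * 2 ^ m * lam" using lam by (intro mult_right_mono) auto
    then show ?thesis by (simp add: sum_distrib_right mult.assoc)
  qed
  finally have "(\<Sum>i\<in>J. 2 ^ i * lam) powr p \<le> (2 * (2 ^ m * lam)) powr p"
    using lam p by (intro powr_mono2 sum_nonneg) auto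
  also have "\<dots> = 2 powr p * (2 ^ m * lam) powr p" using lam by (subst powr_mult) auto
  also have "\<dots> \<le> 2 powr p * (\<Sum>i\<in>J. (2 ^ i * lam) powr p)"
    using J m(1) by (intro mult_left_mono member_le_sum) auto
  finally show ?thesis .
qed simp

lemma Lip_add: "u \<in> Lip \<Longrightarrow> v \<in> Lip \<Longrightarrow> (\<lambda>x. u x + v x) \<in> Lip"
  unfolding Lip_def by (blast intro: lipschitz_on_add)

lemma Lip_cmult: "u \<in> Lip \<Longrightarrow> (\<lambda>x. c * u x) \<in> Lip"
  unfolding Lip_def by (blast intro: lipschitz_on_cmult_real)

lemma Lip_sum:
  "finite I \<Longrightarrow> (\<And>i. i \<in> I \<Longrightarrow> u i \<in> Lip) \<Longrightarrow> (\<lambda>x. \<Sum>i\<in>I. u i x) \<in> Lip"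
proof (induction I rule: finite_induct)
  case empty
  then show ?case unfolding Lip_def by (auto intro!: exI[of _ 0] lipschitz_onI)
next
  case (insert i I)
  then show ?case by (simp add: Lip_add)
qed

section \<open>The alternative on a single ball\<close>

context geodesic_space_pair
begin

text \<open>Will bound \<open>s i powr p\<close> times the measure of the bad set of level
  \<open>s i\<close>, in units of \<open>lam powr p\<close> times the measure of the ball. It does
  not involve \<open>k\<close>, so \<open>k\<close> can be chosen large afterwards.\<close>

definition level_const :: "real \<Rightarrow> real" where
  "level_const Q = weak_const * (Q + D\<^sup>2 + lip_const powr p)"

text \<open>Will bound the energy of the minimal gradient off the top level set, in the same units:
  the first term where the gradient is at most \<open>lam / 8 ^ k\<close>, the second where it is
  larger, which happens on a set of small measure.\<close>

definition tail :: "nat \<Rightarrow> real" where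
  "tail k = D\<^sup>2 / 8 powr (k * p) + lip_const powr p / 8 ^ k"

lemma tail_bounds: "0 \<le> tail k" "tail k \<le> D\<^sup>2 + lip_const powr p"
proof -
  show "0 \<le> tail k" by (simp add: tail_def)
  have "(1::real) \<le> 8 powr (k * p)" using p by (intro ge_one_powr_ge_zero) auto
  then have "D\<^sup>2 / 8 powr (k * p) \<le> D\<^sup>2" by (simp add: divide_le_eq mult_le_cancel_left1)
  moreover have "lip_const powr p / 8 ^ k \<le> lip_const powr p"
    by (simp add: divide_le_eq mult_le_cancel_left1)
  ultimately show "tail k \<le> D\<^sup>2 + lip_const powr p" by (simp add: tail_def)
qed

text \<open>The alternative of Keith and Zhong. If all three terms on the right are small, then
  the mean \<open>h\<close> of the truncations of \<open>u\<close> at the levels \<open>2 ^ i * lam\<close>, \<open>2 * k \<le> i < 3 * k\<close>, is close to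
  \<open>u\<close>, while averaging \<open>k\<close> truncations gains the factor \<open>k powr (1 - p)\<close> in the energy of \<open>h\<close>.\<close>

lemma good_lambda_ball:
  assumes Q: "1 \<le> Q" and k: "1 \<le> k" and \<eta>: "0 < \<eta>" "\<eta> \<le> 1 / 8" "8 \<le> 2 ^ n * \<eta>"
    and kn: "Q / 2 powr (k * p) \<le> 1 / D ^ n"
    and num1: "2 powr p * (trunc_const * \<eta> powr \<tau> * level_const Q) \<le> 1 / 4"
    and num2: "2 powr p * (K * 2 powr p * (2 powr p * (tail k + (2 * lip_const) powr p * k powr (1 - p) * level_const Q))) \<le> 1 / 4"
    and u: "u \<in> Lip" and min: "minimal_upper_gradient \<mu> p u g" and lam: "0 < lam"
    and r: "0 < r" "fits r" and B\<^sub>0: "ball z (40 * r) \<subseteq> B\<^sub>0" and bad: "\<not> controlled u z r lam"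
  shows "measure \<mu> (ball z r) \<le>
    2 powr (k * p) / Q * measure \<mu> (level_set B\<^sub>0 2 u (2 ^ k * lam) \<inter> ball z (4 * r)) +
    8 powr (k * p) / Q * measure \<mu> (level_set B\<^sub>0 2 u (8 ^ k * lam) \<inter> ball z (4 * r)) +
    8 powr (k * (p + 1)) * measure \<mu> ({x. ennreal (lam / 8 ^ k) < g x} \<inter> ball z (4 * r))"
proof (rule ccontr)
  let ?V = "level_set B\<^sub>0 2 u" and ?W = "ball z (4 * r)" and ?B = "ball z r" and ?L = lip_const
  define S where "S = 8 ^ k * lam"
  define s where "s i = 2 ^ i * lam" for i :: nat
  \<comment> \<open>These levels exceed \<open>2 ^ k * lam\<close>, so all bad sets lie in one set
    of tiny density, and they stay below the top level \<open>S\<close>.\<close>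
  define I where "I = {2 * k..<3 * k}"
  define mB where "mB = measure \<mu> ?B"
  define nB where "nB = measure \<nu> ?B"
  define G where "G = {x. ennreal (lam / 8 ^ k) < g x}"
  assume "\<not> ?thesis"
  then have neg: "2 powr (k * p) / Q * measure \<mu> (?V (2 ^ k * lam) \<inter> ?W) +
    8 powr (k * p) / Q * measure \<mu> (?V S \<inter> ?W) + 8 powr (k * (p + 1)) * measure \<mu> (G \<inter> ?W) < mB"
    by (simp add: not_le S_def G_def mB_def)
  have nonneg: "0 \<le> 2 powr (k * p) / Q * measure \<mu> (?V (2 ^ k * lam) \<inter> ?W)"
    "0 \<le> 8 powr (k * p) / Q * measure \<mu> (?V S \<inter> ?W)" "0 \<le> 8 powr (k * (p + 1)) * measure \<mu> (G \<inter> ?W)"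
    using Q by auto
  have mB: "0 < mB" and nB: "0 < nB" using r(1) by (auto simp: mB_def nB_def intro: nu_pos mu_pos)
  have g: "g \<in> upper_gradients \<mu> p u" using min by (simp add: minimal_upper_gradient_def)
  have [measurable]: "g \<in> borel_measurable \<mu>" using mu.upper_gradients_measurable[OF g] .
  have "{x \<in> space \<mu>. ennreal (lam / 8 ^ k) < g x} \<in> sets \<mu>" by measurable
  then have G_meas [measurable]: "G \<in> sets \<mu>" by (simp add: G_def)
  have L1: "1 \<le> ?L" by (rule lip_const_ge_1)
  have S: "0 < S" using lam by (simp add: S_def)
  have s: "0 < s i" for i using lam by (simp add: s_def)
  have sS: "s i \<le> S" if "i \<in> I" for i
  proof -
    have "(2::real) ^ i \<le> 2 ^ (3 * k)" using that by (intro power_increasing) (auto simp: I_def)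
    also have "\<dots> = 8 ^ k" by (simp add: power_mult)
    finally show ?thesis using lam by (simp add: s_def S_def)
  qed
  have ks: "2 ^ k * lam \<le> s i" if "i \<in> I" for i
  proof -
    have "(2::real) ^ k \<le> 2 ^ i" using that by (intro power_increasing) (auto simp: I_def)
    then show ?thesis using lam by (simp add: s_def)
  qed
  have V_sub: "?V (s i) \<subseteq> ?V (2 ^ k * lam)" "?V S \<subseteq> ?V (s i)" if "i \<in> I" for i
    using level_set_antimono[OF _ ks[OF that]] level_set_antimono[OF _ sS[OF that]] lam s[of i]
    by (auto simp: less_imp_le)
  have I: "finite I" "card I = k" "I \<noteq> {}" using k by (auto simp: I_def)
  obtain i0 where i0: "i0 \<in> I" using I(3) by blast
  have VS_sub: "?V S \<subseteq> ?V (2 ^ k * lam)" using V_sub[OF i0] by blast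
  have a: "measure \<mu> (?V (2 ^ k * lam) \<inter> ?W) < mB / D ^ n"
  proof -
    have "2 powr (k * p) / Q * measure \<mu> (?V (2 ^ k * lam) \<inter> ?W) < mB" using neg nonneg by linarith
    then have "measure \<mu> (?V (2 ^ k * lam) \<inter> ?W) < Q / 2 powr (k * p) * mB"
      using Q by (simp add: field_simps)
    also have "\<dots> \<le> 1 / D ^ n * mB" using kn mB by (intro mult_right_mono) auto
    finally show ?thesis by simp
  qed
  have b: "S powr p * measure \<mu> (?V S \<inter> ?W) \<le> Q * lam powr p * mB"
  proof -
    have "8 powr (k * p) / Q * measure \<mu> (?V S \<inter> ?W) < mB" using neg nonneg by linarith
    then have "8 powr (k * p) * measure \<mu> (?V S \<inter> ?W) \<le> Q * mB"
      using Q by (simp add: field_simps)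
    then have "lam powr p * (8 powr (k * p) * measure \<mu> (?V S \<inter> ?W)) \<le> lam powr p * (Q * mB)"
      by (rule mult_left_mono) simp
    moreover have "S powr p = lam powr p * 8 powr (k * p)"
      unfolding S_def using lam by (simp add: powr_mult powr_powr flip: powr_realpow)
    ultimately show ?thesis by (simp add: mult_ac)
  qed
  have c: "(?L * S) powr p * measure \<mu> (G \<inter> ?W) \<le> ?L powr p / 8 ^ k * lam powr p * mB"
  proof -
    have "8 powr (k * (p + 1)) * measure \<mu> (G \<inter> ?W) \<le> mB" using neg nonneg by linarith
    moreover have "(8::real) powr (k * (p + 1)) = 8 powr (k * p) * 8 ^ k"
      by (simp add: distrib_left powr_add powr_realpow)
    ultimately have "8 powr (k * p) * measure \<mu> (G \<inter> ?W) \<le> mB / 8 ^ k" by (simp add: field_simps)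
    then have "?L powr p * lam powr p * (8 powr (k * p) * measure \<mu> (G \<inter> ?W)) \<le> ?L powr p * lam powr p * (mB / 8 ^ k)"
      by (rule mult_left_mono) simp
    moreover have "(?L * S) powr p = ?L powr p * lam powr p * 8 powr (k * p)"
      unfolding S_def using lam L1 by (simp add: powr_mult powr_powr flip: powr_realpow)
    ultimately show ?thesis by (simp add: mult_ac)
  qed
  \<comment> \<open>Balls inside the lowest level set are tiny; this will put every point of
    \<open>ball z r\<close> close to the good set of each level.\<close>
  have small: "\<rho> \<le> \<eta> * r" if "0 < \<rho>" "ball y \<rho> \<subseteq> ?V (2 ^ k * lam)" "ball y \<rho> \<inter> ball z (2 * r) \<noteq> {}" for y \<rho>
    using \<eta> r(1) a that by (intro small_radius[of \<eta> n r "?V (2 ^ k * lam)" z \<rho> y]) (auto simp: mB_def)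
  have mW: "mB \<le> measure \<mu> ?W"
    unfolding mB_def using r(1) by (intro mu.measure_mono_ball subset_ball) auto
  have "mB / D ^ n \<le> mB" using mB D_ge_1 by (simp add: divide_le_eq mult_le_cancel_left1 one_le_power)
  then have "measure \<mu> (?V (2 ^ k * lam) \<inter> ?W) < measure \<mu> ?W" using a mW by linarith
  then have nW: "\<not> ?W \<subseteq> ?V (2 ^ k * lam)" by (metis inf.absorb2 less_irrefl)
  define E where "E i = ?W - ?V (s i)" for i
  have E: "E i \<noteq> {}" if "i \<in> I" for i using nW V_sub[OF that] by (auto simp: E_def)
  have ES: "?W - ?V S \<noteq> {}" using nW VS_sub by blast
  have E_borel: "E i \<in> sets borel" for i unfolding E_def using level_set_borel by (intro sets.Diff) auto
  \<comment> \<open>Here minimality enters: off the level set of \<open>S\<close> the function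
    \<open>u\<close> agrees with a truncation, so the Lipschitz constant of the latter bounds the
    minimal gradient there.\<close>
  have gS: "AE x in \<mu>. x \<in> ?W - ?V S \<longrightarrow> g x \<le> ennreal (?L * S)"
  proof -
    obtain w where w: "(?L * S)-lipschitz_on UNIV w" "\<And>x. x \<in> ?W - ?V S \<Longrightarrow> w x = u x"
      using truncation_exists[OF u S r(1) B\<^sub>0] by blast
    have "?W - ?V S \<in> sets borel" using level_set_borel by (intro sets.Diff) auto
    then have "(\<lambda>x. if x \<in> ?W - ?V S then ennreal (?L * S) else g x) \<in> upper_gradients \<mu> p u"
      using p w g by (intro mu.upper_gradients_glue_borel[where u = w] mu.upper_gradients_Lipschitz) auto
    then have "AE x in \<mu>. g x \<le> (if x \<in> ?W - ?V S then ennreal (?L * S) else g x)"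
      by (rule bspec[OF conjunct2[OF min[unfolded minimal_upper_gradient_def]]])
    then show ?thesis by (rule eventually_mono) auto
  qed
  have intG: "(\<integral>\<^sup>+x\<in>?W. ennreal_powr (g x) p * indicator (- ?V S) x \<partial>\<mu>) \<le> ennreal (tail k * lam powr p * mB)"
  proof -
    have "(\<integral>\<^sup>+x\<in>?W. ennreal_powr (g x) p * indicator (- ?V S) x \<partial>\<mu>) \<le>
        (\<integral>\<^sup>+x. ennreal ((lam / 8 ^ k) powr p) * indicator ?W x + ennreal ((?L * S) powr p) * indicator (G \<inter> ?W) x \<partial>\<mu>)"
    proof (rule nn_integral_mono_AE, rule eventually_mono[OF gS])
      fix x assume gx: "x \<in> ?W - ?V S \<longrightarrow> g x \<le> ennreal (?L * S)"
      show "ennreal_powr (g x) p * indicator (- ?V S) x * indicator ?W x \<le>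
          ennreal ((lam / 8 ^ k) powr p) * indicator ?W x + ennreal ((?L * S) powr p) * indicator (G \<inter> ?W) x"
      proof (cases "x \<in> ?W - ?V S")
        case True
        show ?thesis
        proof (cases "x \<in> G")
          case inG: True
          have "ennreal_powr (g x) p \<le> ennreal_powr (ennreal (?L * S)) p"
            using gx True p by (intro ennreal_powr_mono) auto
          also have "\<dots> = ennreal ((?L * S) powr p)" using L1 S by (intro ennreal_powr_ennreal) simp
          finally show ?thesis using True inG by (simp add: add_increasing)
        next
          case False
          then have "g x \<le> ennreal (lam / 8 ^ k)" by (simp add: G_def)
          then have "ennreal_powr (g x) p \<le> ennreal_powr (ennreal (lam / 8 ^ k)) p"
            using p by (intro ennreal_powr_mono) auto
          also have "\<dots> = ennreal ((lam / 8 ^ k) powr p)" using lam by (intro ennreal_powr_ennreal) simp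
          finally show ?thesis using True False by simp
        qed
      qed (auto split: split_indicator)
    qed
    also have "\<dots> = ennreal ((lam / 8 ^ k) powr p) * emeasure \<mu> ?W + ennreal ((?L * S) powr p) * emeasure \<mu> (G \<inter> ?W)"
      by (subst nn_integral_add) (simp_all add: nn_integral_cmult_indicator)
    also have "\<dots> = ennreal ((lam / 8 ^ k) powr p * measure \<mu> ?W + (?L * S) powr p * measure \<mu> (G \<inter> ?W))"
      using fmeasurable_Int_ball[OF G_meas, of z "4 * r"]
      by (simp add: mu.emeasure_ball emeasure_eq_measure2 ennreal_mult)
    also have "\<dots> \<le> ennreal (tail k * lam powr p * mB)"
    proof (rule ennreal_leI)
      have "measure \<mu> ?W \<le> D\<^sup>2 * mB" unfolding mB_def using r(1) by (intro mu.measure_ball_le) auto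
      then have le: "(lam / 8 ^ k) powr p * measure \<mu> ?W \<le> (lam / 8 ^ k) powr p * (D\<^sup>2 * mB)"
        by (rule mult_left_mono) simp
      have e: "(lam / 8 ^ k) powr p = lam powr p / 8 powr (k * p)"
        using lam by (simp add: powr_divide powr_powr flip: powr_realpow)
      show "(lam / 8 ^ k) powr p * measure \<mu> ?W + (?L * S) powr p * measure \<mu> (G \<inter> ?W) \<le>
          tail k * lam powr p * mB"
        using c le unfolding e by (simp add: tail_def algebra_simps)
    qed
    finally show ?thesis .
  qed
  define m where "m i = measure \<mu> (?V (s i) \<inter> ball z (2 * r))" for i
  have em: "emeasure \<mu> (?V (s i) \<inter> ball z (2 * r)) = ennreal (m i)" for i
    unfolding m_def by (rule emeasure_eq_measure2) (rule fmeasurable_Int_ball, measurable)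
  have C0: "0 \<le> level_const Q" using weak_const_pos Q by (auto simp: level_const_def intro!: mult_nonneg_nonneg add_nonneg_nonneg)
  \<comment> \<open>The estimate is taken with upper level \<open>S\<close>, so that its right side
    consists of the two quantities already bounded by \<open>b\<close> and
    \<open>intG\<close>.\<close>
  have weak: "s i powr p * m i \<le> level_const Q * lam powr p * mB" if i: "i \<in> I" for i
  proof -
    have "ennreal (s i powr p) * ennreal (m i) \<le> ennreal weak_const *
      (\<integral>\<^sup>+x\<in>?W. ennreal (S powr p) * indicator (?V S) x + ennreal_powr (g x) p * indicator (- ?V S) x \<partial>\<mu>)"
      unfolding em[symmetric]
    proof (rule weak_estimate[OF u g s sS[OF i] r(1) B\<^sub>0 ES])
      fix y \<rho> assume "0 < \<rho>" "ball y \<rho> \<subseteq> ?V (s i)" "ball y \<rho> \<inter> ball z (2 * r) \<noteq> {}"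
      then have "\<rho> \<le> \<eta> * r" using V_sub(1)[OF i] by (intro small) auto
      also have "\<dots> \<le> 1 / 8 * r" using \<eta>(2) r(1) by (intro mult_right_mono) auto
      finally show "\<rho> \<le> r / 8" by simp
    qed
    also have "(\<integral>\<^sup>+x\<in>?W. ennreal (S powr p) * indicator (?V S) x + ennreal_powr (g x) p * indicator (- ?V S) x \<partial>\<mu>) =
        (\<integral>\<^sup>+x. ennreal (S powr p) * indicator (?V S \<inter> ?W) x + ennreal_powr (g x) p * indicator (- ?V S) x * indicator ?W x \<partial>\<mu>)"
      by (intro nn_integral_cong) (auto split: split_indicator)
    also have "\<dots> = ennreal (S powr p) * emeasure \<mu> (?V S \<inter> ?W) +
        (\<integral>\<^sup>+x\<in>?W. ennreal_powr (g x) p * indicator (- ?V S) x \<partial>\<mu>)"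
      by (subst nn_integral_add) (simp_all add: nn_integral_cmult_indicator)
    also have "ennreal (S powr p) * emeasure \<mu> (?V S \<inter> ?W) = ennreal (S powr p * measure \<mu> (?V S \<inter> ?W))"
      using fmeasurable_Int_ball[OF level_set_sets, of B\<^sub>0 2 u S z "4 * r"]
      by (simp add: emeasure_eq_measure2 ennreal_mult)
    also have "ennreal weak_const * (ennreal (S powr p * measure \<mu> (?V S \<inter> ?W)) +
        (\<integral>\<^sup>+x\<in>?W. ennreal_powr (g x) p * indicator (- ?V S) x \<partial>\<mu>)) \<le>
        ennreal weak_const * (ennreal (Q * lam powr p * mB) + ennreal (tail k * lam powr p * mB))"
      by (intro mult_left_mono add_mono ennreal_leI b intG) simp
    also have "\<dots> = ennreal (weak_const * (Q * lam powr p * mB + tail k * lam powr p * mB))"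
      using weak_const_pos Q mB tail_bounds(1)[of k] by (simp flip: ennreal_mult ennreal_plus)
    also have "\<dots> \<le> ennreal (level_const Q * lam powr p * mB)"
    proof (rule ennreal_leI)
      have "Q + tail k \<le> Q + D\<^sup>2 + ?L powr p" using tail_bounds(2)[of k] by simp
      then have "weak_const * (lam powr p * mB) * (Q + tail k) \<le> weak_const * (lam powr p * mB) * (Q + D\<^sup>2 + ?L powr p)"
        using weak_const_pos mB by (intro mult_left_mono) auto
      then show "weak_const * (Q * lam powr p * mB + tail k * lam powr p * mB) \<le> level_const Q * lam powr p * mB"
        by (simp add: level_const_def algebra_simps)
    qed
    finally have "ennreal (s i powr p * m i) \<le> ennreal (level_const Q * lam powr p * mB)"
      by (simp add: ennreal_mult m_def)
    then show ?thesis using C0 mB by simp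
  qed
  have "\<exists>w. (?L * s i)-lipschitz_on UNIV w \<and> (\<forall>x\<in>E i. w x = u x)" for i
    using truncation_exists[OF u s r(1) B\<^sub>0, of i] unfolding E_def by metis
  then obtain w where w: "\<And>i. (?L * s i)-lipschitz_on UNIV (w i)" and wE: "\<And>i x. x \<in> E i \<Longrightarrow> w i x = u x"
    by metis
  have w_Lip: "w i \<in> Lip" for i using w[of i] by (auto simp: Lip_def)
  have sub24: "ball z (2 * r) \<subseteq> ?W" using r(1) by (intro subset_ball) simp
  have err: "(\<integral>\<^sup>+x\<in>?B. ennreal (\<bar>u x - w i x\<bar> powr p) \<partial>\<nu>) \<le>
      ennreal (trunc_const * \<eta> powr \<tau> * level_const Q * ((lam * r) powr p * nB))" if i: "i \<in> I" for i
  proof -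
    have near: "infdist x (E i) \<le> \<eta> * r" if x: "x \<in> ?B" "x \<in> ?V (s i)" for x
    proof (rule ccontr)
      assume "\<not> infdist x (E i) \<le> \<eta> * r"
      moreover have "\<eta> * r < 2 * r" using \<eta>(2) r(1) by simp
      ultimately have far: "\<eta> * r < min (infdist x (E i)) (2 * r)" by simp
      \<comment> \<open>The cut-off at \<open>2 * r\<close> keeps the ball inside
        \<open>ball z (4 * r)\<close>, where a point outside \<open>E i\<close> belongs to the level
        set.\<close>
      have "ball x (min (infdist x (E i)) (2 * r)) \<subseteq> ?V (s i)"
      proof
        fix v assume v: "v \<in> ball x (min (infdist x (E i)) (2 * r))"
        then have "dist z v < 4 * r" using x(1) dist_triangle[of z v x] r(1) by simp
        moreover have "v \<notin> E i" using v infdist_le[of v "E i" x] by auto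
        ultimately show "v \<in> ?V (s i)" by (simp add: E_def)
      qed
      then have sub: "ball x (min (infdist x (E i)) (2 * r)) \<subseteq> ?V (2 ^ k * lam)" using V_sub(1)[OF i] by blast
      have pos: "0 < min (infdist x (E i)) (2 * r)" using far mult_pos_pos[OF \<eta>(1) r(1)] by linarith
      have "x \<in> ball x (min (infdist x (E i)) (2 * r)) \<inter> ball z (2 * r)" using pos x(1) r(1) by simp
      then have "min (infdist x (E i)) (2 * r) \<le> \<eta> * r" by (intro small[OF pos sub]) blast
      then show False using far by simp
    qed
    have "\<eta> \<le> 1" using \<eta>(2) by simp
    from truncation_error[OF u s r(1) B\<^sub>0 w E_def wE E[OF i] r order_refl sub24 \<eta>(1) this near]
    have "(\<integral>\<^sup>+x\<in>?B. ennreal (\<bar>u x - w i x\<bar> powr p) \<partial>\<nu>) \<le>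
        ennreal (trunc_const * (s i * r) powr p * \<eta> powr \<tau> * (nB / mB)) * ennreal (m i)"
      unfolding em mB_def nB_def .
    also have "\<dots> = ennreal (trunc_const * (s i * r) powr p * \<eta> powr \<tau> * (nB / mB) * m i)"
      using trunc_const_pos nB mB by (intro ennreal_mult[symmetric] mult_nonneg_nonneg) (auto simp: m_def)
    also have "\<dots> \<le> ennreal (trunc_const * \<eta> powr \<tau> * level_const Q * ((lam * r) powr p * nB))"
    proof (rule ennreal_leI)
      have "trunc_const * (s i * r) powr p * \<eta> powr \<tau> * (nB / mB) * m i =
          trunc_const * \<eta> powr \<tau> * r powr p * (nB / mB) * (s i powr p * m i)"
        using s[of i] r(1) by (simp add: powr_mult)
      also have "\<dots> \<le> trunc_const * \<eta> powr \<tau> * r powr p * (nB / mB) * (level_const Q * lam powr p * mB)"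
        using trunc_const_pos nB mB by (intro mult_left_mono weak[OF i]) auto
      also have "\<dots> = trunc_const * \<eta> powr \<tau> * level_const Q * ((lam * r) powr p * nB)"
        using lam r(1) mB by (simp add: powr_mult)
      finally show "trunc_const * (s i * r) powr p * \<eta> powr \<tau> * (nB / mB) * m i \<le>
          trunc_const * \<eta> powr \<tau> * level_const Q * ((lam * r) powr p * nB)" .
    qed
    finally show ?thesis .
  qed
  define h where "h x = (\<Sum>i\<in>I. (1 / k) * w i x)" for x
  have h_Lip: "h \<in> Lip" unfolding h_def by (intro Lip_sum I(1) Lip_cmult w_Lip)
  have [measurable]: "u \<in> borel_measurable \<nu>" "w i \<in> borel_measurable \<nu>" for i
    using u w_Lip by (auto intro: nu.borel_imp_measurable Lip_borel_measurable)
  have uh: "(\<integral>\<^sup>+x\<in>?B. ennreal (\<bar>u x - h x\<bar> powr p) \<partial>\<nu>) \<le>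
      ennreal (trunc_const * \<eta> powr \<tau> * level_const Q * ((lam * r) powr p * nB))" (is "_ \<le> ennreal ?X")
  proof -
    \<comment> \<open>By convexity, the error of the mean is at most the mean of the errors.\<close>
    have pt: "\<bar>u x - h x\<bar> powr p \<le> (\<Sum>i\<in>I. 1 / k * \<bar>u x - w i x\<bar> powr p)" for x
    proof -
      have "u x - h x = (\<Sum>i\<in>I. (u x - w i x) / k)"
        using I k by (simp add: h_def sum_subtractf diff_divide_distrib)
      then have "\<bar>u x - h x\<bar> \<le> (\<Sum>i\<in>I. \<bar>u x - w i x\<bar> / k)"
        using sum_abs[of "\<lambda>i. (u x - w i x) / k" I] by simp
      then have "\<bar>u x - h x\<bar> powr p \<le> (\<Sum>i\<in>I. \<bar>u x - w i x\<bar> / k) powr p"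
        using p by (intro powr_mono2) auto
      also have "\<dots> \<le> (\<Sum>i\<in>I. \<bar>u x - w i x\<bar> powr p / k)"
        using powr_mean_le[OF p I(1,3), of "\<lambda>i. \<bar>u x - w i x\<bar>"] I(2) by simp
      finally show ?thesis by simp
    qed
    have "(\<integral>\<^sup>+x\<in>?B. ennreal (\<bar>u x - h x\<bar> powr p) \<partial>\<nu>) \<le>
        (\<integral>\<^sup>+x. (\<Sum>i\<in>I. ennreal (1 / k) * (ennreal (\<bar>u x - w i x\<bar> powr p) * indicator ?B x)) \<partial>\<nu>)"
    proof (rule nn_integral_mono)
      fix x
      have "ennreal (\<bar>u x - h x\<bar> powr p) \<le> (\<Sum>i\<in>I. ennreal (1 / k) * ennreal (\<bar>u x - w i x\<bar> powr p))"
        using ennreal_leI[OF pt[of x]] by (simp add: sum_nonneg flip: ennreal_mult sum_ennreal)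
      then show "ennreal (\<bar>u x - h x\<bar> powr p) * indicator ?B x \<le>
          (\<Sum>i\<in>I. ennreal (1 / k) * (ennreal (\<bar>u x - w i x\<bar> powr p) * indicator ?B x))"
        by (auto split: split_indicator)
    qed
    also have "\<dots> = (\<Sum>i\<in>I. \<integral>\<^sup>+x. ennreal (1 / k) * (ennreal (\<bar>u x - w i x\<bar> powr p) * indicator ?B x) \<partial>\<nu>)"
      by (rule nn_integral_sum) measurable
    also have "\<dots> = (\<Sum>i\<in>I. ennreal (1 / k) * (\<integral>\<^sup>+x\<in>?B. ennreal (\<bar>u x - w i x\<bar> powr p) \<partial>\<nu>))"
      by (intro sum.cong refl nn_integral_cmult) measurable
    also have "\<dots> \<le> (\<Sum>i\<in>I. ennreal (1 / k) * ennreal ?X)"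
      by (intro sum_mono mult_left_mono err) auto
    also have "\<dots> = (\<Sum>i\<in>I. ennreal (1 / k * ?X))"
      using C0 trunc_const_pos nB by (intro sum.cong refl ennreal_mult[symmetric]) auto
    also have "\<dots> = ennreal (\<Sum>i\<in>I. 1 / k * ?X)"
      using C0 trunc_const_pos nB by (intro sum_ennreal) auto
    also have "(\<Sum>i\<in>I. 1 / k * ?X) = ?X" using I(2) k by simp
    finally show ?thesis .
  qed
  define gh where "gh x = (\<Sum>i\<in>I. ennreal (1 / k) * (if x \<in> E i then g x else ennreal (?L * s i)))" for x
  have gh: "gh \<in> upper_gradients \<mu> p h"
    unfolding gh_def h_def
  proof (intro mu.upper_gradients_sum mu.upper_gradients_cmult I(1))
    show "(\<lambda>x. if x \<in> E i then g x else ennreal (?L * s i)) \<in> upper_gradients \<mu> p (w i)" for i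
      using p g w[of i] wE[of _ i] E_borel[of i]
      by (intro mu.upper_gradients_glue_borel[where u = u] mu.upper_gradients_Lipschitz) auto
  qed (use p k in auto)
  \<comment> \<open>Outside its bad set each truncation contributes \<open>g\<close>, and these
    contributions average to at most \<open>g\<close>; on its bad set it contributes its Lipschitz
    constant, divided by \<open>k\<close>. The level set of \<open>S\<close> lies in every bad set,
    so \<open>g\<close> does not occur there.\<close>
  have gh_le: "gh x \<le> g x * indicator (- ?V S) x + ennreal (?L / k * (\<Sum>i\<in>{i \<in> I. x \<in> ?V (s i)}. 2 ^ i * lam))"
    if x: "x \<in> ?B" for x
  proof -
    have xW: "x \<in> ?W" using x r(1) by simp
    have "gh x \<le> (\<Sum>i\<in>I. ennreal (1 / k) * (g x * indicator (- ?V S) x) +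
        ennreal (1 / k) * (ennreal (?L * s i) * indicator (?V (s i)) x))"
      unfolding gh_def
    proof (rule sum_mono)
      fix i assume i: "i \<in> I"
      show "ennreal (1 / k) * (if x \<in> E i then g x else ennreal (?L * s i)) \<le>
        ennreal (1 / k) * (g x * indicator (- ?V S) x) + ennreal (1 / k) * (ennreal (?L * s i) * indicator (?V (s i)) x)"
        using V_sub(2)[OF i] xW by (cases "x \<in> E i") (auto simp: E_def split: split_indicator)
    qed
    also have "\<dots> = (\<Sum>i\<in>I. ennreal (1 / k) * (g x * indicator (- ?V S) x)) +
        (\<Sum>i\<in>I. ennreal (1 / k) * (ennreal (?L * s i) * indicator (?V (s i)) x))"
      by (rule sum.distrib)
    also have "(\<Sum>i\<in>I. ennreal (1 / k) * (g x * indicator (- ?V S) x)) = g x * indicator (- ?V S) x"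
    proof -
      have "(\<Sum>i\<in>I. ennreal (1 / k) * (g x * indicator (- ?V S) x)) =
          (ennreal k * ennreal (1 / k)) * (g x * indicator (- ?V S) x)"
        using I(2) by (simp add: mult.assoc ennreal_of_nat_eq_real_of_nat)
      also have "ennreal k * ennreal (1 / k) = 1" using k by (simp flip: ennreal_mult)
      finally show ?thesis by simp
    qed
    also have "(\<Sum>i\<in>I. ennreal (1 / k) * (ennreal (?L * s i) * indicator (?V (s i)) x)) =
        ennreal (?L / k * (\<Sum>i\<in>{i \<in> I. x \<in> ?V (s i)}. 2 ^ i * lam))"
    proof -
      have "(\<Sum>i\<in>I. ennreal (1 / k) * (ennreal (?L * s i) * indicator (?V (s i)) x)) =
          (\<Sum>i\<in>I. if x \<in> ?V (s i) then ennreal (?L / k * (2 ^ i * lam)) else 0)"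
        using L1 lam by (intro sum.cong) (auto simp: s_def simp flip: ennreal_mult split: split_indicator)
      also have "\<dots> = (\<Sum>i\<in>{i \<in> I. x \<in> ?V (s i)}. ennreal (?L / k * (2 ^ i * lam)))"
        by (rule sum.inter_filter[OF I(1), symmetric])
      also have "\<dots> = ennreal (\<Sum>i\<in>{i \<in> I. x \<in> ?V (s i)}. ?L / k * (2 ^ i * lam))"
        using L1 lam by (intro sum_ennreal) auto
      finally show ?thesis by (simp add: sum_distrib_left)
    qed
    finally show ?thesis .
  qed
  define Y where "Y = (2 * ?L / k) powr p"
  have gh_powr: "ennreal_powr (gh x) p \<le> ennreal (2 powr p) * (ennreal_powr (g x) p * indicator (- ?V S) x +
      ennreal Y * (\<Sum>i\<in>I. ennreal (s i powr p) * indicator (?V (s i)) x))" if x: "x \<in> ?B" for x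
  proof -
    let ?J = "{i \<in> I. x \<in> ?V (s i)}"
    have "ennreal_powr (gh x) p \<le> ennreal_powr (g x * indicator (- ?V S) x + ennreal (?L / k * (\<Sum>i\<in>?J. 2 ^ i * lam))) p"
      using gh_le[OF x] p by (intro ennreal_powr_mono) auto
    also have "\<dots> \<le> ennreal (2 powr p) * (ennreal_powr (g x * indicator (- ?V S) x) p +
        ennreal_powr (ennreal (?L / k * (\<Sum>i\<in>?J. 2 ^ i * lam))) p)"
      using p by (intro ennreal_powr_add_le) simp
    also have "ennreal_powr (g x * indicator (- ?V S) x) p = ennreal_powr (g x) p * indicator (- ?V S) x"
      using p by (auto simp: ennreal_powr_def split: split_indicator)
    also have "ennreal_powr (ennreal (?L / k * (\<Sum>i\<in>?J. 2 ^ i * lam))) p =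
        ennreal ((?L / k * (\<Sum>i\<in>?J. 2 ^ i * lam)) powr p)"
      using L1 lam by (intro ennreal_powr_ennreal mult_nonneg_nonneg sum_nonneg) auto
    also have "\<dots> \<le> ennreal (Y * (\<Sum>i\<in>?J. s i powr p))"
    proof (rule ennreal_leI)
      have "(?L / k * (\<Sum>i\<in>?J. 2 ^ i * lam)) powr p = (?L / k) powr p * (\<Sum>i\<in>?J. 2 ^ i * lam) powr p"
        by (rule powr_mult)
      also have "\<dots> \<le> (?L / k) powr p * (2 powr p * (\<Sum>i\<in>?J. (2 ^ i * lam) powr p))"
        using I(1) lam p by (intro mult_left_mono powr_geometric_sum_le) auto
      also have "\<dots> = ((?L / k) powr p * 2 powr p) * (\<Sum>i\<in>?J. s i powr p)"
        by (simp only: s_def mult.assoc)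
      also have "(?L / k) powr p * 2 powr p = Y"
      proof -
        have "2 * ?L / k = ?L / k * 2" by simp
        then show ?thesis unfolding Y_def by (simp only: powr_mult)
      qed
      finally show "(?L / k * (\<Sum>i\<in>?J. 2 ^ i * lam)) powr p \<le> Y * (\<Sum>i\<in>?J. s i powr p)" .
    qed
    also have "ennreal (Y * (\<Sum>i\<in>?J. s i powr p)) = ennreal Y * (\<Sum>i\<in>?J. ennreal (s i powr p))"
      by (simp add: ennreal_mult sum_nonneg Y_def)
    also have "(\<Sum>i\<in>?J. ennreal (s i powr p)) = (\<Sum>i\<in>I. if x \<in> ?V (s i) then ennreal (s i powr p) else 0)"
      by (rule sum.inter_filter[OF I(1)])
    also have "\<dots> = (\<Sum>i\<in>I. ennreal (s i powr p) * indicator (?V (s i)) x)"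
      by (intro sum.cong) (auto split: split_indicator)
    finally show ?thesis by (simp add: add_left_mono mult_left_mono)
  qed
  have intGh: "(\<integral>\<^sup>+x\<in>?B. ennreal_powr (gh x) p \<partial>\<mu>) \<le>
      ennreal (2 powr p * (tail k + (2 * ?L) powr p * k powr (1 - p) * level_const Q) * (lam powr p * mB))"
  proof -
    have "(\<integral>\<^sup>+x\<in>?B. ennreal_powr (gh x) p \<partial>\<mu>) \<le>
        (\<integral>\<^sup>+x. ennreal (2 powr p) * (ennreal_powr (g x) p * indicator (- ?V S) x * indicator ?W x +
          ennreal Y * (\<Sum>i\<in>I. ennreal (s i powr p) * indicator (?V (s i) \<inter> ball z (2 * r)) x)) \<partial>\<mu>)"
    proof (rule nn_integral_mono)
      fix x
      show "ennreal_powr (gh x) p * indicator ?B x \<le>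
          ennreal (2 powr p) * (ennreal_powr (g x) p * indicator (- ?V S) x * indicator ?W x +
          ennreal Y * (\<Sum>i\<in>I. ennreal (s i powr p) * indicator (?V (s i) \<inter> ball z (2 * r)) x))"
      proof (cases "x \<in> ?B")
        case True
        then have "x \<in> ?W" "x \<in> ball z (2 * r)" using r(1) by auto
        then show ?thesis using gh_powr[OF True] True by (simp add: indicator_inter_arith)
      qed simp
    qed
    also have "\<dots> = ennreal (2 powr p) * ((\<integral>\<^sup>+x\<in>?W. ennreal_powr (g x) p * indicator (- ?V S) x \<partial>\<mu>) +
        ennreal Y * (\<Sum>i\<in>I. ennreal (s i powr p) * ennreal (m i)))"
      by (simp add: nn_integral_cmult nn_integral_add nn_integral_sum nn_integral_cmult_indicator em)
    also have "\<dots> \<le> ennreal (2 powr p) * (ennreal (tail k * lam powr p * mB) +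
        ennreal Y * (\<Sum>i\<in>I. ennreal (level_const Q * lam powr p * mB)))"
    proof (intro mult_left_mono add_mono intG sum_mono)
      fix i assume "i \<in> I"
      then show "ennreal (s i powr p) * ennreal (m i) \<le> ennreal (level_const Q * lam powr p * mB)"
        using ennreal_leI[OF weak[of i]] by (simp add: ennreal_mult m_def)
    qed auto
    also have "(\<Sum>i\<in>I. ennreal (level_const Q * lam powr p * mB)) = ennreal (k * (level_const Q * lam powr p * mB))"
      using I C0 mB by (simp add: ennreal_of_nat_eq_real_of_nat flip: ennreal_mult)
    also have "ennreal (2 powr p) * (ennreal (tail k * lam powr p * mB) +
        ennreal Y * ennreal (k * (level_const Q * lam powr p * mB))) =
        ennreal (2 powr p * (tail k * lam powr p * mB + Y * (k * (level_const Q * lam powr p * mB))))"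
      using tail_bounds(1)[of k] C0 mB by (simp add: Y_def flip: ennreal_mult ennreal_plus)
    also have "2 powr p * (tail k * lam powr p * mB + Y * (k * (level_const Q * lam powr p * mB))) =
        2 powr p * (tail k + (2 * ?L) powr p * k powr (1 - p) * level_const Q) * (lam powr p * mB)"
    proof -
      \<comment> \<open>The factor \<open>1 / k\<close> raised to the power \<open>p\<close> is
        multiplied by the number \<open>k\<close> of levels; since \<open>p > 1\<close>, this tends
        to 0.\<close>
      have "Y * k = (2 * ?L) powr p * k powr (1 - p)"
        unfolding Y_def using k L1 by (simp add: powr_divide powr_diff)
      then have "Y * (k * (level_const Q * lam powr p * mB)) =
          (2 * ?L) powr p * k powr (1 - p) * level_const Q * (lam powr p * mB)" by (simp add: mult.assoc[symmetric])
      then show ?thesis by (simp add: algebra_simps)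
    qed
    finally show ?thesis .
  qed
  define T where "T = tail k + (2 * ?L) powr p * k powr (1 - p) * level_const Q"
  have T: "0 \<le> T" using tail_bounds(1)[of k] C0 by (simp add: T_def)
  obtain c where c: "osc h z r c \<le> ennreal (K * (2 * r) powr p * (nB / mB)) * (\<integral>\<^sup>+x\<in>?B. ennreal_powr (gh x) p \<partial>\<mu>)"
    using poincare_osc[OF h_Lip gh r(1)] unfolding nB_def mB_def by blast
  have c': "osc h z r c \<le> ennreal (K * 2 powr p * (2 powr p * T) * ((lam * r) powr p * nB))"
  proof -
    have "osc h z r c \<le> ennreal (K * (2 * r) powr p * (nB / mB)) * ennreal (2 powr p * T * (lam powr p * mB))"
      using c intGh unfolding T_def by (meson mult_left_mono order_trans zero_le)
    also have "\<dots> = ennreal (K * (2 * r) powr p * (nB / mB) * (2 powr p * T * (lam powr p * mB)))"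
      using K nB mB T by (simp flip: ennreal_mult)
    also have "K * (2 * r) powr p * (nB / mB) * (2 powr p * T * (lam powr p * mB)) =
        K * 2 powr p * (2 powr p * T) * ((lam * r) powr p * nB)"
      using lam r(1) mB by (simp add: powr_mult)
    finally show ?thesis .
  qed
  have "ennreal ((lam * r) powr p * nB) < osc u z r c" using bad by (auto simp: controlled_def not_le nB_def)
  also have "\<dots> \<le> ennreal (2 powr p) * ((\<integral>\<^sup>+x\<in>?B. ennreal (\<bar>u x - h x\<bar> powr p) \<partial>\<nu>) + osc h z r c)"
    unfolding osc_def by (rule nn_integral_powr_triangle[OF u const_Lip h_Lip])
  also have "\<dots> \<le> ennreal (2 powr p) * (ennreal (trunc_const * \<eta> powr \<tau> * level_const Q * ((lam * r) powr p * nB)) +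
      ennreal (K * 2 powr p * (2 powr p * T) * ((lam * r) powr p * nB)))"
    by (intro mult_left_mono add_mono uh c') simp
  also have "\<dots> = ennreal (2 powr p * (trunc_const * \<eta> powr \<tau> * level_const Q * ((lam * r) powr p * nB) +
      K * 2 powr p * (2 powr p * T) * ((lam * r) powr p * nB)))"
    using trunc_const_pos C0 nB K T by (simp flip: ennreal_mult ennreal_plus)
  also have "\<dots> = ennreal ((2 powr p * (trunc_const * \<eta> powr \<tau> * level_const Q) +
      2 powr p * (K * 2 powr p * (2 powr p * T))) * ((lam * r) powr p * nB))"
    by (simp add: algebra_simps)
  also have "\<dots> \<le> ennreal ((1 / 4 + 1 / 4) * ((lam * r) powr p * nB))"
    using num1 num2 nB unfolding T_def by (intro ennreal_leI mult_right_mono add_mono) auto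
  finally have "ennreal ((lam * r) powr p * nB) < ennreal ((1 / 4 + 1 / 4) * ((lam * r) powr p * nB))" .
  then have "(lam * r) powr p * nB < (1 / 4 + 1 / 4) * ((lam * r) powr p * nB)"
    by (rule ennreal_less_iff[THEN iffD1, rotated]) (use nB in simp)
  moreover have "0 < (lam * r) powr p * nB" using lam r(1) nB by simp
  moreover have "\<not> (0 < X \<and> X < (1 / 4 + 1 / 4) * X)" for X :: real by simp
  ultimately show False by blast
qed

text \<open>First \<open>\<eta>\<close> is taken from \<open>level_const Q\<close>, then
  \<open>n\<close> from \<open>\<eta>\<close>, and \<open>k\<close> last. This is not circular
  because neither \<open>level_const Q\<close> nor \<open>n\<close> depends on
  \<open>k\<close>.\<close>

lemma good_lambda:
  assumes Q: "1 \<le> Q"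
  obtains k\<^sub>0 where "\<And>k B\<^sub>0 u g z r lam. k\<^sub>0 \<le> k \<Longrightarrow> u \<in> Lip \<Longrightarrow> minimal_upper_gradient \<mu> p u g \<Longrightarrow>
    0 < lam \<Longrightarrow> 0 < r \<Longrightarrow> fits r \<Longrightarrow> ball z (40 * r) \<subseteq> B\<^sub>0 \<Longrightarrow> \<not> controlled u z r lam \<Longrightarrow>
    measure \<mu> (ball z r) \<le>
    2 powr (real k * p) / Q * measure \<mu> (level_set B\<^sub>0 2 u (2 ^ k * lam) \<inter> ball z (4 * r)) +
    8 powr (real k * p) / Q * measure \<mu> (level_set B\<^sub>0 2 u (8 ^ k * lam) \<inter> ball z (4 * r)) +
    8 powr (real k * (p + 1)) * measure \<mu> ({x. ennreal (lam / 8 ^ k) < g x} \<inter> ball z (4 * r))"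
proof -
  define C where "C = 4 * 2 powr p * trunc_const * level_const Q"
  have lc: "0 < level_const Q"
    using weak_const_pos Q by (auto simp: level_const_def intro!: mult_pos_pos add_pos_nonneg)
  have C: "0 < C" using trunc_const_pos lc by (simp add: C_def)
  define \<eta> where "\<eta> = min (1 / 8) ((1 / C) powr (1 / \<tau>))"
  have \<eta>: "0 < \<eta>" "\<eta> \<le> 1 / 8" using C by (auto simp: \<eta>_def)
  have "\<eta> powr \<tau> \<le> ((1 / C) powr (1 / \<tau>)) powr \<tau>" using \<eta> \<tau>(1) by (intro powr_mono2) (auto simp: \<eta>_def)
  also have "\<dots> = 1 / C" using C \<tau>(1) by (simp add: powr_powr)
  finally have "C * \<eta> powr \<tau> \<le> 1" using C by (simp add: field_simps)
  moreover have "2 powr p * (trunc_const * \<eta> powr \<tau> * level_const Q) = C * \<eta> powr \<tau> / 4"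
    by (simp add: C_def mult_ac)
  ultimately have num1: "2 powr p * (trunc_const * \<eta> powr \<tau> * level_const Q) \<le> 1 / 4" by linarith
  obtain n where n: "8 / \<eta> < 2 ^ n" using real_arch_pow[of 2 "8 / \<eta>"] by auto
  then have n8: "8 \<le> 2 ^ n * \<eta>" using \<eta>(1) by (simp add: field_simps)
  have p2: "(1 / 2 powr p) < (1::real)" "(1 / 8 powr p) < (1::real)" using p by auto
  have "(\<lambda>k. Q * (1 / 2 powr p) ^ k) \<longlonglongrightarrow> Q * 0"
    using p2 by (intro tendsto_intros LIMSEQ_realpow_zero) auto
  then have ev1: "eventually (\<lambda>k. Q * (1 / 2 powr p) ^ k < 1 / D ^ n) sequentially"
    using D_pos by (intro order_tendstoD(2)) auto
  have lim: "(\<lambda>k. 2 powr p * (K * 2 powr p * (2 powr p * ((D\<^sup>2 * (1 / 8 powr p) ^ k + lip_const powr p * (1 / 8) ^ k) +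
      (2 * lip_const) powr p * real k powr (1 - p) * level_const Q)))) \<longlonglongrightarrow>
      2 powr p * (K * 2 powr p * (2 powr p * ((D\<^sup>2 * 0 + lip_const powr p * 0) + (2 * lip_const) powr p * 0 * level_const Q)))"
    using p p2 by (intro tendsto_intros LIMSEQ_realpow_zero tendsto_neg_powr filterlim_real_sequentially) auto
  have "eventually (\<lambda>k. 2 powr p * (K * 2 powr p * (2 powr p * ((D\<^sup>2 * (1 / 8 powr p) ^ k + lip_const powr p * (1 / 8) ^ k) +
      (2 * lip_const) powr p * real k powr (1 - p) * level_const Q))) < 1 / 4) sequentially"
    by (rule order_tendstoD(2)[OF lim]) simp
  with ev1 have "eventually (\<lambda>k. Q * (1 / 2 powr p) ^ k < 1 / D ^ n \<and>
      2 powr p * (K * 2 powr p * (2 powr p * ((D\<^sup>2 * (1 / 8 powr p) ^ k + lip_const powr p * (1 / 8) ^ k) +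
      (2 * lip_const) powr p * real k powr (1 - p) * level_const Q))) < 1 / 4) sequentially"
    by (rule eventually_conj)
  then obtain k0 where k0: "\<And>k. k0 \<le> k \<Longrightarrow> Q * (1 / 2 powr p) ^ k < 1 / D ^ n"
      "\<And>k. k0 \<le> k \<Longrightarrow> 2 powr p * (K * 2 powr p * (2 powr p * ((D\<^sup>2 * (1 / 8 powr p) ^ k + lip_const powr p * (1 / 8) ^ k) +
      (2 * lip_const) powr p * real k powr (1 - p) * level_const Q))) < 1 / 4"
    unfolding eventually_sequentially by blast
  have pk: "(1 / b powr p) ^ k = 1 / b powr (real k * p)" if "0 < b" for b :: real and k :: nat
    using that by (simp add: power_divide powr_powr mult.commute flip: powr_realpow)
  show thesis
  proof (rule that[of "max 1 k0"])
    fix k B\<^sub>0 u g z r lam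
    assume k: "max 1 k0 \<le> k" and rest: "u \<in> Lip" "minimal_upper_gradient \<mu> p u g"
      "0 < lam" "0 < r" "fits r" "ball z (40 * r) \<subseteq> B\<^sub>0" "\<not> controlled u z r lam"
    have kn: "Q / 2 powr (real k * p) \<le> 1 / D ^ n" using k0(1)[of k] k by (simp add: pk)
    have num2: "2 powr p * (K * 2 powr p * (2 powr p * (tail k + (2 * lip_const) powr p * real k powr (1 - p) * level_const Q))) \<le> 1 / 4"
    proof -
      have "D\<^sup>2 * (1 / 8 powr p) ^ k + lip_const powr p * (1 / 8) ^ k = tail k"
        by (subst pk) (simp_all add: tail_def power_divide)
      then show ?thesis using k0(2)[of k] k by simp
    qed
    show "measure \<mu> (ball z r) \<le>
    2 powr (real k * p) / Q * measure \<mu> (level_set B\<^sub>0 2 u (2 ^ k * lam) \<inter> ball z (4 * r)) +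
    8 powr (real k * p) / Q * measure \<mu> (level_set B\<^sub>0 2 u (8 ^ k * lam) \<inter> ball z (4 * r)) +
    8 powr (real k * (p + 1)) * measure \<mu> ({x. ennreal (lam / 8 ^ k) < g x} \<inter> ball z (4 * r))"
      using k by (intro good_lambda_ball[OF Q _ \<eta> n8 kn num1 num2 rest(1-5,6,7)]) auto
  qed
qed

end

section \<open>Maximal Poincare inequality\<close>

lemma ennreal_suminf_shift_le:
  fixes f h :: "nat \<Rightarrow> ennreal"
  assumes "\<And>i. i < j \<Longrightarrow> f i = 0" "\<And>i. f (i + j) \<le> h i"
  shows "(\<Sum>i. f i) \<le> (\<Sum>i. h i)"
proof -
  have "(\<Sum>i. f i) = (\<Sum>i. f (i + j)) + (\<Sum>i<j. f i)" by (rule suminf_offset) simp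
  also have "\<dots> = (\<Sum>i. f (i + j))" using assms(1) by simp
  also have "\<dots> \<le> (\<Sum>i. h i)" by (intro suminf_le assms(2)) auto
  finally show ?thesis .
qed

lemma ennreal_term_le_suminf: "f i \<le> (\<Sum>i. f i)" for f :: "nat \<Rightarrow> ennreal"
  using sum_le_suminf[of f "{i}"] by simp

lemma dyadic_sum_finite:
  assumes "1 \<le> t" "0 < \<Lambda>"
  shows "(\<Sum>i. ennreal ((\<Lambda> / 2 ^ i) powr t)) \<le> ennreal (2 * \<Lambda> powr t)"
proof -
  have term_le: "(\<Lambda> / 2 ^ i) powr t \<le> \<Lambda> powr t * (1 / 2) ^ i" for i :: nat
  proof -
    have "(2::real) ^ i \<le> (2 ^ i) powr t" using assms(1) by (intro le_powr_self) auto
    then have "\<Lambda> powr t / (2 ^ i) powr t \<le> \<Lambda> powr t / 2 ^ i" by (intro divide_left_mono) auto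
    then show ?thesis using assms(2) by (simp add: powr_divide power_divide)
  qed
  have "(\<Sum>i. ennreal ((\<Lambda> / 2 ^ i) powr t)) \<le> (\<Sum>i. ennreal (\<Lambda> powr t * (1 / 2) ^ i))"
    by (intro suminf_le ennreal_leI term_le) auto
  also have "\<dots> = ennreal (\<Sum>i. \<Lambda> powr t * (1 / 2) ^ i)"
    by (intro suminf_ennreal2 summable_mult summable_geometric) auto
  also have "(\<Sum>i. \<Lambda> powr t * (1 / 2) ^ i) = \<Lambda> powr t * 2"
    by (subst suminf_mult) (auto simp: suminf_geometric intro!: summable_geometric)
  finally show ?thesis by (simp add: mult.commute)
qed

text \<open>A dyadic layer-cake bound: only levels below \<open>x\<close> count, and from the
  largest of them on the terms decay at least like powers of 1/2, since
  \<open>t \<ge> 1\<close>.\<close>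

lemma dyadic_sum_le_powr:
  fixes x :: ennreal
  assumes t: "1 \<le> t" and \<Lambda>: "0 < \<Lambda>"
  shows "(\<Sum>i. ennreal ((\<Lambda> / 2 ^ i) powr t) * (if ennreal (\<Lambda> / 2 ^ i) < x then 1 else 0)) \<le> 2 * ennreal_powr x t"
proof (cases "\<exists>i. ennreal (\<Lambda> / 2 ^ i) < x")
  case True
  define i where "i = (LEAST i. ennreal (\<Lambda> / 2 ^ i) < x)"
  have i: "ennreal (\<Lambda> / 2 ^ i) < x" unfolding i_def by (rule LeastI_ex[OF True])
  have less: "\<not> ennreal (\<Lambda> / 2 ^ j) < x" if "j < i" for j using not_less_Least[of j] that by (simp add: i_def)
  have "(\<Sum>j. ennreal ((\<Lambda> / 2 ^ j) powr t) * (if ennreal (\<Lambda> / 2 ^ j) < x then 1 else 0)) \<le>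
      (\<Sum>j. ennreal ((\<Lambda> / 2 ^ i / 2 ^ j) powr t))"
  proof (rule ennreal_suminf_shift_le[where j = i])
    show "ennreal ((\<Lambda> / 2 ^ j) powr t) * (if ennreal (\<Lambda> / 2 ^ j) < x then 1 else 0) = 0" if "j < i" for j
      using less[OF that] by simp
    show "ennreal ((\<Lambda> / 2 ^ (j + i)) powr t) * (if ennreal (\<Lambda> / 2 ^ (j + i)) < x then 1 else 0) \<le>
        ennreal ((\<Lambda> / 2 ^ i / 2 ^ j) powr t)" for j
      by (simp add: power_add mult.commute)
  qed
  also have "\<dots> \<le> ennreal (2 * (\<Lambda> / 2 ^ i) powr t)"
    using t \<Lambda> by (intro dyadic_sum_finite) auto
  also have "\<dots> = 2 * ennreal_powr (ennreal (\<Lambda> / 2 ^ i)) t"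
    using \<Lambda> by (simp add: ennreal_mult)
  also have "\<dots> \<le> 2 * ennreal_powr x t"
    using i t by (intro mult_left_mono ennreal_powr_mono) auto
  finally show ?thesis .
qed simp

section \<open>From level sets to the sharp maximal function\<close>

context geodesic_space_pair
begin

text \<open>The average is almost as good as any other constant, since its distance from
  \<open>c\<close> is at most \<open>2 * \<sigma>\<close>.\<close>

lemma avg_osc_le:
  assumes u: "u \<in> Lip" and r: "0 < r" and \<sigma>: "0 < \<sigma>"
    and c: "osc u x r c \<le> ennreal (\<sigma> powr p * measure \<nu> (ball x r))"
  shows "osc u x r (avg \<nu> (ball x r) u) \<le> ennreal ((8 * \<sigma>) powr p * measure \<nu> (ball x r))"
proof -
  let ?n = "measure \<nu> (ball x r)" and ?B = "ball x r"
  define a where "a = avg \<nu> ?B u"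
  have n: "0 < ?n" using r by (rule nu_pos)
  obtain \<kappa> where \<kappa>: "\<kappa>-lipschitz_on UNIV u" using u by (auto simp: Lip_def)
  have [measurable]: "u \<in> borel_measurable \<nu>"
    using u by (intro nu.borel_imp_measurable Lip_borel_measurable)
  have fin: "emeasure \<nu> ?B < \<infinity>" by (rule nu.emeasure_ball_finite)
  have int_u: "integrable \<nu> (\<lambda>y. indicator ?B y *\<^sub>R u y)"
  proof (rule integrableI_bounded_set[where A = ?B and B = "\<bar>u x\<bar> + \<kappa> * r"])
    show "AE y in \<nu>. y \<in> ?B \<longrightarrow> norm (indicator ?B y *\<^sub>R u y) \<le> \<bar>u x\<bar> + \<kappa> * r"
    proof (intro AE_I2 impI)
      fix y assume y: "y \<in> ?B"
      have "\<bar>u y - u x\<bar> \<le> \<kappa> * dist y x" using lipschitz_onD[OF \<kappa>, of y x] by (simp add: dist_real_def)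
      also have "\<dots> \<le> \<kappa> * r" using y lipschitz_on_nonneg[OF \<kappa>] by (intro mult_left_mono) (auto simp: dist_commute)
      finally show "norm (indicator ?B y *\<^sub>R u y) \<le> \<bar>u x\<bar> + \<kappa> * r" using y by simp
    qed
  qed (use fin in auto)
  have int_c: "integrable \<nu> (\<lambda>y. indicator ?B y *\<^sub>R c)"
    using fin by (intro integrable_scaleR_left integrable_real_indicator) auto
  have "a * ?n = (\<integral>y. indicator ?B y *\<^sub>R u y \<partial>\<nu>)"
    using n by (simp add: a_def avg_def set_lebesgue_integral_def)
  moreover have "c * ?n = (\<integral>y. indicator ?B y *\<^sub>R c \<partial>\<nu>)" by simp
  ultimately have "(a - c) * ?n = (\<integral>y. indicator ?B y *\<^sub>R u y - indicator ?B y *\<^sub>R c \<partial>\<nu>)"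
    using Bochner_Integration.integral_diff[OF int_u int_c] by (simp add: left_diff_distrib)
  then have "ennreal (\<bar>a - c\<bar> * ?n) = ennreal (norm (\<integral>y. indicator ?B y *\<^sub>R u y - indicator ?B y *\<^sub>R c \<partial>\<nu>))"
    by (metis abs_mult abs_of_pos n real_norm_def)
  also have "\<dots> \<le> (\<integral>\<^sup>+y. ennreal (norm (indicator ?B y *\<^sub>R u y - indicator ?B y *\<^sub>R c)) \<partial>\<nu>)"
    by (intro integral_norm_bound_ennreal Bochner_Integration.integrable_diff int_u int_c)
  also have "\<dots> \<le> (\<integral>\<^sup>+y. ennreal \<sigma> * indicator ?B y + ennreal (\<sigma> / \<sigma> powr p) * (ennreal (\<bar>u y - c\<bar> powr p) * indicator ?B y) \<partial>\<nu>)"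
  proof (rule nn_integral_mono)
    fix y
    \<comment> \<open>Takes the place of Hoelder's inequality: where the deviation exceeds
      \<open>\<sigma>\<close>, its quotient by \<open>\<sigma>\<close> is at most the
      \<open>p\<close>-th power of that quotient.\<close>
    have "\<bar>u y - c\<bar> \<le> \<sigma> + \<sigma> / \<sigma> powr p * \<bar>u y - c\<bar> powr p"
    proof (cases "\<bar>u y - c\<bar> \<le> \<sigma>")
      case False
      then have "\<bar>u y - c\<bar> / \<sigma> \<le> (\<bar>u y - c\<bar> / \<sigma>) powr p" using \<sigma> p by (intro le_powr_self) auto
      then have "\<bar>u y - c\<bar> \<le> \<sigma> / \<sigma> powr p * \<bar>u y - c\<bar> powr p"
        using \<sigma> by (simp add: powr_divide field_simps)
      then show ?thesis using \<sigma> by simp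
    qed (use \<sigma> in \<open>simp add: add_increasing2\<close>)
    then have "ennreal \<bar>u y - c\<bar> \<le> ennreal \<sigma> + ennreal (\<sigma> / \<sigma> powr p) * ennreal (\<bar>u y - c\<bar> powr p)"
      using \<sigma> by (simp add: ennreal_leI flip: ennreal_mult ennreal_plus)
    then show "ennreal (norm (indicator ?B y *\<^sub>R u y - indicator ?B y *\<^sub>R c)) \<le>
        ennreal \<sigma> * indicator ?B y + ennreal (\<sigma> / \<sigma> powr p) * (ennreal (\<bar>u y - c\<bar> powr p) * indicator ?B y)"
      by (auto split: split_indicator)
  qed
  also have "\<dots> = ennreal \<sigma> * emeasure \<nu> ?B + ennreal (\<sigma> / \<sigma> powr p) * osc u x r c"
    unfolding osc_def by (simp add: nn_integral_add nn_integral_cmult nn_integral_cmult_indicator)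
  also have "\<dots> \<le> ennreal \<sigma> * ennreal ?n + ennreal (\<sigma> / \<sigma> powr p) * ennreal (\<sigma> powr p * ?n)"
    by (intro add_mono mult_left_mono c) (auto simp: nu.emeasure_ball)
  also have "\<dots> = ennreal (2 * \<sigma> * ?n)"
    using \<sigma> by (simp flip: ennreal_mult ennreal_plus)
  finally have "\<bar>a - c\<bar> * ?n \<le> 2 * \<sigma> * ?n" using \<sigma> by simp
  then have ac: "\<bar>c - a\<bar> \<le> 2 * \<sigma>" using n by simp
  have "osc u x r a \<le> ennreal (2 powr p) * (osc u x r c + osc (\<lambda>_. c) x r a)"
    unfolding osc_def by (rule nn_integral_powr_triangle[OF u const_Lip const_Lip])
  also have "\<dots> \<le> ennreal (2 powr p) * (ennreal ((2 * \<sigma>) powr p * ?n) + ennreal ((2 * \<sigma>) powr p * ?n))"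
  proof (intro mult_left_mono add_mono)
    have "\<sigma> powr p * ?n \<le> (2 * \<sigma>) powr p * ?n" using \<sigma> p by (intro mult_right_mono powr_mono2) auto
    then show "osc u x r c \<le> ennreal ((2 * \<sigma>) powr p * ?n)" by (intro order_trans[OF c] ennreal_leI)
    show "osc (\<lambda>_. c) x r a \<le> ennreal ((2 * \<sigma>) powr p * ?n)" by (rule osc_le_const[OF ac])
  qed simp
  also have "\<dots> = ennreal (2 powr p * 2 * (2 * \<sigma>) powr p * ?n)"
    by (simp flip: ennreal_plus ennreal_mult add: algebra_simps)
  also have "\<dots> \<le> ennreal ((8 * \<sigma>) powr p * ?n)"
  proof (intro ennreal_leI mult_right_mono)
    have "2 powr p * 2 * (2 * \<sigma>) powr p \<le> 2 powr p * 2 powr p * (2 * \<sigma>) powr p"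
      using le_powr_self[of 2 p] p by (intro mult_right_mono mult_left_mono) auto
    also have "\<dots> = (2 * 2 * (2 * \<sigma>)) powr p" by (simp only: powr_mult)
    finally show "2 powr p * 2 * (2 * \<sigma>) powr p \<le> (8 * \<sigma>) powr p" by simp
  qed simp
  finally show ?thesis by (simp add: a_def)
qed

text \<open>64 is the product of the 8 of \<open>avg_osc_le\<close>, for the average in place of a
  free constant, and the 8 of \<open>fits_diameter\<close>, for the diameter in place of the
  radius.\<close>

lemma sharp_maximal_level:
  assumes u: "u \<in> Lip" and s: "0 < s" and M: "ennreal (64 * s) < sharp_maximal \<nu> p (inner_balls B\<^sub>0) u x"
  shows "x \<in> level_set B\<^sub>0 2 u s"
proof -
  obtain z r where zr: "0 < r" "ball z (2 * r) \<subseteq> B\<^sub>0" "x \<in> ball z r"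
    and big: "ennreal (64 * s) < ennreal ((1 / diameter (ball z r) powr p *
      avg \<nu> (ball z r) (\<lambda>y. \<bar>u y - avg \<nu> (ball z r) u\<bar> powr p)) powr (1 / p))"
    using M unfolding sharp_maximal_def less_SUP_iff inner_balls_def by (auto simp: Let_def)
  obtain r' where r': "0 < r'" "r' \<le> r" "fits r'" "ball z r' = ball z r"
    using fits_shrink[OF zr(1)] by metis
  let ?B = "ball z r'"
  define A where "A = avg \<nu> ?B (\<lambda>y. \<bar>u y - avg \<nu> ?B u\<bar> powr p)"
  have d: "r' / 8 \<le> diameter ?B" by (rule fits_diameter[OF r'(3,1)])
  have n: "0 < measure \<nu> ?B" using r'(1) by (rule nu_pos)
  have A0: "0 \<le> A"
    unfolding A_def avg_def set_lebesgue_integral_def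
    by (intro divide_nonneg_nonneg Bochner_Integration.integral_nonneg) auto
  have "64 * s < (1 / diameter ?B powr p * A) powr (1 / p)"
    using big s unfolding A_def r'(4) by (simp add: ennreal_less_iff)
  then have "(64 * s) powr p < ((1 / diameter ?B powr p * A) powr (1 / p)) powr p"
    using s p by (intro powr_less_mono2) auto
  also have "\<dots> = A / diameter ?B powr p" using p A0 by (simp add: powr_powr)
  finally have "(64 * s) powr p * diameter ?B powr p < A"
    using d r'(1) by (simp add: field_simps)
  moreover have "(8 * (s * r')) powr p \<le> (64 * s * diameter ?B) powr p"
    using d s r'(1) p by (intro powr_mono2) auto
  ultimately have less: "(8 * (s * r')) powr p < A" by (simp add: powr_mult)
  have "\<not> controlled u z r' s"
  proof
    assume "controlled u z r' s"
    then obtain c where c: "osc u z r' c \<le> ennreal ((s * r') powr p * measure \<nu> ?B)"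
      by (auto simp: controlled_def)
    have "osc u z r' (avg \<nu> ?B u) \<le> ennreal ((8 * (s * r')) powr p * measure \<nu> ?B)"
      using s r'(1) by (intro avg_osc_le[OF u r'(1) _ c]) simp
    then have "ennreal (A * measure \<nu> ?B) \<le> ennreal ((8 * (s * r')) powr p * measure \<nu> ?B)"
      unfolding nn_integral_eq_avg[OF u] A_def .
    then have "A \<le> (8 * (s * r')) powr p" using n by simp
    then show False using less by simp
  qed
  moreover have "ball z (2 * r') \<subseteq> B\<^sub>0" using zr(2) r'(2) subset_ball[of "2 * r'" "2 * r" z] by auto
  ultimately show ?thesis using zr(3) r' by (intro level_setI[of r' z]) auto
qed

text \<open>The constant \<open>u z\<close> controls every ball around \<open>z\<close>. Hence only
  levels below the Lipschitz constant matter, and the dyadic sums have a largest level.\<close>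

lemma level_set_empty:
  assumes u: "\<kappa>-lipschitz_on UNIV u" and s: "\<kappa> \<le> s" and N: "0 \<le> N"
  shows "level_set B\<^sub>0 N u s = {}"
proof -
  have "controlled u z r s" if "0 < r" for z r
  proof -
    have \<kappa>: "0 \<le> \<kappa>" using u by (rule lipschitz_on_nonneg)
    have "\<bar>u y - u z\<bar> \<le> s * r" if "y \<in> ball z r" for y
    proof -
      have "\<bar>u y - u z\<bar> \<le> \<kappa> * dist y z" using lipschitz_onD[OF u, of y z] by (simp add: dist_real_def)
      also have "\<dots> \<le> s * r" using \<kappa> s that by (intro mult_mono) (auto simp: dist_commute)
      finally show ?thesis .
    qed
    then have "osc u z r (u z) \<le> ennreal ((s * r) powr p * measure \<nu> (ball z r))"
      by (rule osc_le_const)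
    then show ?thesis unfolding controlled_def by blast
  qed
  then show ?thesis by (auto simp: level_set_def)
qed

text \<open>Covers by the balls \<open>ball z (4 * r)\<close> on which the local inequality lives;
  the fivefold radius \<open>20 * r\<close> is below \<open>2 ^ 5 * r\<close>, hence
  \<open>D ^ 5\<close>. As \<open>ball z (40 * r)\<close> lies in the given ball, nothing outside is
  charged.\<close>

lemma global_good_lambda:
  assumes ball: "\<And>z r. 0 < r \<Longrightarrow> fits r \<Longrightarrow> ball z (40 * r) \<subseteq> ball x\<^sub>0 r\<^sub>0 \<Longrightarrow> \<not> controlled u z r lam \<Longrightarrow>
      measure \<mu> (ball z r) \<le> a1 * measure \<mu> (V1 \<inter> ball z (4 * r)) + a2 * measure \<mu> (V2 \<inter> ball z (4 * r)) +
        a3 * measure \<mu> (G \<inter> ball z (4 * r))"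
    and a: "0 \<le> a1" "0 \<le> a2" "0 \<le> a3" and lam: "0 \<le> lam"
    and sets: "V1 \<in> sets \<mu>" "V2 \<in> sets \<mu>" "G \<in> sets \<mu>"
  shows "emeasure \<mu> (level_set (ball x\<^sub>0 r\<^sub>0) 40 u lam) \<le>
    ennreal (D ^ 5) * (ennreal a1 * emeasure \<mu> V1 + ennreal a2 * emeasure \<mu> V2 +
      ennreal a3 * emeasure \<mu> (G \<inter> ball x\<^sub>0 r\<^sub>0))"
proof -
  let ?B = "ball x\<^sub>0 r\<^sub>0"
  let ?V = "level_set ?B 40 u lam"
  note [measurable] = sets
  define F where "F = {(z, 4 * r) | z r. 0 < r \<and> fits r \<and> ball z (40 * r) \<subseteq> ?B \<and> \<not> controlled u z r lam}"
  define h where "h x = ennreal a1 * indicator V1 x + ennreal a2 * indicator V2 x + ennreal a3 * indicator G x" for x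
  have h_meas [measurable]: "h \<in> borel_measurable \<mu>" unfolding h_def by measurable
  have int_h: "(\<integral>\<^sup>+x\<in>A. h x \<partial>\<mu>) = ennreal a1 * emeasure \<mu> (V1 \<inter> A) + ennreal a2 * emeasure \<mu> (V2 \<inter> A) +
      ennreal a3 * emeasure \<mu> (G \<inter> A)" if [measurable]: "A \<in> sets \<mu>" for A
  proof -
    have "(\<integral>\<^sup>+x\<in>A. h x \<partial>\<mu>) = (\<integral>\<^sup>+x. ennreal a1 * indicator (V1 \<inter> A) x + ennreal a2 * indicator (V2 \<inter> A) x +
        ennreal a3 * indicator (G \<inter> A) x \<partial>\<mu>)"
      by (intro nn_integral_cong) (auto simp: h_def split: split_indicator)
    also have "\<dots> = ennreal a1 * emeasure \<mu> (V1 \<inter> A) + ennreal a2 * emeasure \<mu> (V2 \<inter> A) + ennreal a3 * emeasure \<mu> (G \<inter> A)"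
      by (simp add: nn_integral_add nn_integral_cmult_indicator)
    finally show ?thesis .
  qed
  have "emeasure \<mu> ?V = (\<integral>\<^sup>+x\<in>?V. 1 \<partial>\<mu>)" by simp
  also have "\<dots> \<le> (\<integral>\<^sup>+x\<in>(\<Union>(y, \<rho>)\<in>F. ball y \<rho>). 1 \<partial>\<mu>)"
  proof (rule nn_set_integral_set_mono, rule subsetI)
    fix x assume "x \<in> ?V"
    then obtain z r where "0 < r" "fits r" "ball z (40 * r) \<subseteq> ?B" "x \<in> ball z r" "\<not> controlled u z r lam"
      by (rule level_setE[OF _ lam zero_le_numeral])
    then have "(z, 4 * r) \<in> F" "x \<in> ball z (4 * r)" by (auto simp: F_def)
    then show "x \<in> (\<Union>(y, \<rho>)\<in>F. ball y \<rho>)" by blast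
  qed
  also have "\<dots> \<le> (\<integral>\<^sup>+x\<in>(\<Union>(y, \<rho>)\<in>F. ball y \<rho>). ennreal (D ^ 5) * h x \<partial>\<mu>)"
  proof (rule mu.vitali_nn_integral[where R = "64 * r\<^sub>0"])
    show "0 < \<rho> \<and> \<rho> \<le> 64 * r\<^sub>0" if zF: "(z, \<rho>) \<in> F" for z \<rho>
    proof -
      obtain r where r: "\<rho> = 4 * r" "0 < r" "fits r" "ball z (40 * r) \<subseteq> ?B" using zF by (auto simp: F_def)
      have "ball z r \<subseteq> ball z (40 * r)" using r(2) by (intro subset_ball) simp
      then show ?thesis using radius_bound[of r z x\<^sub>0 r\<^sub>0] r by auto
    qed
    fix z \<rho> assume "(z, \<rho>) \<in> F"
    then obtain r where r: "\<rho> = 4 * r" "0 < r" "fits r" "ball z (40 * r) \<subseteq> ?B" "\<not> controlled u z r lam"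
      by (auto simp: F_def)
    have em: "emeasure \<mu> (A \<inter> ball z \<rho>) = ennreal (measure \<mu> (A \<inter> ball z \<rho>))" if "A \<in> sets \<mu>" for A
      using fmeasurable_Int_ball[OF that] by (rule emeasure_eq_measure2)
    have "(\<integral>\<^sup>+x\<in>ball z (5 * \<rho>). 1 \<partial>\<mu>) = ennreal (measure \<mu> (ball z (20 * r)))"
      by (simp add: r(1) mu.emeasure_ball)
    also have "\<dots> \<le> ennreal (D ^ 5 * measure \<mu> (ball z r))"
      using r(2) by (intro ennreal_leI mu.measure_ball_le) auto
    also have "\<dots> \<le> ennreal (D ^ 5 * (a1 * measure \<mu> (V1 \<inter> ball z \<rho>) + a2 * measure \<mu> (V2 \<inter> ball z \<rho>) +
        a3 * measure \<mu> (G \<inter> ball z \<rho>)))"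
      unfolding r(1) using D_pos by (intro ennreal_leI mult_left_mono ball r) auto
    also have "\<dots> = ennreal (D ^ 5) * (\<integral>\<^sup>+x\<in>ball z \<rho>. h x \<partial>\<mu>)"
      unfolding int_h[OF mu.sets_ball] em[OF sets(1)] em[OF sets(2)] em[OF sets(3)] using a D_pos
      by (simp add: ennreal_mult ennreal_plus)
    also have "\<dots> = (\<integral>\<^sup>+x\<in>ball z \<rho>. ennreal (D ^ 5) * h x \<partial>\<mu>)"
      unfolding mult.assoc by (rule nn_integral_cmult[symmetric]) measurable
    finally show "(\<integral>\<^sup>+x\<in>ball z (5 * \<rho>). 1 \<partial>\<mu>) \<le> (\<integral>\<^sup>+x\<in>ball z \<rho>. ennreal (D ^ 5) * h x \<partial>\<mu>)" .
  next
    show "(\<lambda>_. 1) \<in> borel_measurable \<mu>" "(\<lambda>x. ennreal (D ^ 5) * h x) \<in> borel_measurable \<mu>" by measurable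
  qed (rule borel_subset)+
  also have "\<dots> \<le> (\<integral>\<^sup>+x\<in>?B. ennreal (D ^ 5) * h x \<partial>\<mu>)"
  proof (rule nn_set_integral_set_mono, rule subsetI)
    fix x assume "x \<in> (\<Union>(y, \<rho>)\<in>F. ball y \<rho>)"
    then obtain z r where zr: "0 < r" "ball z (40 * r) \<subseteq> ?B" "x \<in> ball z (4 * r)" by (auto simp: F_def)
    then have "x \<in> ball z (40 * r)" by simp
    then show "x \<in> ?B" using zr(2) by blast
  qed
  also have "\<dots> = ennreal (D ^ 5) * (\<integral>\<^sup>+x\<in>?B. h x \<partial>\<mu>)"
    unfolding mult.assoc by (rule nn_integral_cmult) measurable
  also have "\<dots> \<le> ennreal (D ^ 5) * (ennreal a1 * emeasure \<mu> V1 + ennreal a2 * emeasure \<mu> V2 +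
      ennreal a3 * emeasure \<mu> (G \<inter> ?B))"
    unfolding int_h[OF mu.sets_ball] using sets by (intro mult_left_mono add_mono emeasure_mono order_refl) auto
  finally show ?thesis .
qed

text \<open>With a power of two, the loss of level in \<open>level_set_compare\<close> becomes a
  shift of index in dyadic sums.\<close>

definition shift_exponent :: nat where
  "shift_exponent = (SOME m. 32 * D ^ 6 \<le> 2 ^ m)"

lemma shift_exponent: "32 * D ^ 6 \<le> 2 ^ shift_exponent"
proof -
  obtain m where "32 * D ^ 6 < 2 ^ m" using real_arch_pow[of 2 "32 * D ^ 6"] by auto
  then have "\<exists>m. 32 * D ^ 6 \<le> 2 ^ m" by (meson less_imp_le)
  then show ?thesis unfolding shift_exponent_def by (rule someI_ex)
qed

lemma level_set_compare_dyadic: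
  assumes u: "u \<in> Lip" and s: "0 < s"
  shows "emeasure \<mu> (level_set (ball x\<^sub>0 r\<^sub>0) 2 u s) \<le>
    ennreal (D ^ 9) * emeasure \<mu> (level_set (ball x\<^sub>0 r\<^sub>0) 40 u (s / 2 ^ shift_exponent))"
proof -
  let ?m = "shift_exponent"
  have "32 * D ^ 6 * (s / 2 ^ ?m) \<le> 2 ^ ?m * (s / 2 ^ ?m)"
    using shift_exponent s by (intro mult_right_mono) auto
  then have "32 * D ^ 6 * (s / 2 ^ ?m) \<le> s" by simp
  moreover have "0 \<le> 32 * D ^ 6 * (s / 2 ^ ?m)" using D_pos s by simp
  ultimately have "level_set (ball x\<^sub>0 r\<^sub>0) 2 u s \<subseteq> level_set (ball x\<^sub>0 r\<^sub>0) 2 u (32 * D ^ 6 * (s / 2 ^ ?m))"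
    by (intro level_set_antimono)
  then have "emeasure \<mu> (level_set (ball x\<^sub>0 r\<^sub>0) 2 u s) \<le>
      emeasure \<mu> (level_set (ball x\<^sub>0 r\<^sub>0) 2 u (32 * D ^ 6 * (s / 2 ^ ?m)))"
    by (rule emeasure_mono) measurable
  also have "\<dots> \<le> ennreal (D ^ 9) * emeasure \<mu> (level_set (ball x\<^sub>0 r\<^sub>0) 40 u (s / 2 ^ ?m))"
    using s by (intro level_set_compare[OF u]) simp
  finally show ?thesis .
qed

text \<open>\<open>D ^ 14\<close> combines \<open>global_good_lambda\<close> with
  \<open>level_set_compare\<close>, and the power of two pays for the index shift. The 8 leaves the
  factor 1/2 for two terms, each of which carries another 2 because \<open>t\<close> may differ from
  \<open>p\<close>.\<close>

definition absorb_const :: real where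
  "absorb_const = 8 * D ^ 14 * 2 powr (shift_exponent * p)"

lemma absorb_const_ge_1: "1 \<le> absorb_const"
proof -
  have "1 \<le> D ^ 14" using D_ge_1 by (rule one_le_power)
  moreover have "(1::real) \<le> 2 powr (shift_exponent * p)" using p by (intro ge_one_powr_ge_zero) auto
  ultimately have "1 * 1 \<le> D ^ 14 * 2 powr (shift_exponent * p)" by (intro mult_mono) auto
  then show ?thesis by (simp add: absorb_const_def)
qed

text \<open>The weighted dyadic sum of level set measures is bounded by half of itself plus the
  energy. The condition on \<open>3 * real k * (p - t)\<close> keeps
  \<open>8 powr (k * (p - t))\<close> at most 2, so exponents near \<open>p\<close> lose only a
  bounded factor.\<close>

lemma maximal_estimate:
  assumes k: "shift_exponent \<le> k"
    and good: "\<And>B\<^sub>0 u g z r lam. u \<in> Lip \<Longrightarrow> minimal_upper_gradient \<mu> p u g \<Longrightarrow>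
      0 < lam \<Longrightarrow> 0 < r \<Longrightarrow> fits r \<Longrightarrow> ball z (40 * r) \<subseteq> B\<^sub>0 \<Longrightarrow> \<not> controlled u z r lam \<Longrightarrow>
      measure \<mu> (ball z r) \<le>
      2 powr (real k * p) / absorb_const * measure \<mu> (level_set B\<^sub>0 2 u (2 ^ k * lam) \<inter> ball z (4 * r)) +
      8 powr (real k * p) / absorb_const * measure \<mu> (level_set B\<^sub>0 2 u (8 ^ k * lam) \<inter> ball z (4 * r)) +
      8 powr (real k * (p + 1)) * measure \<mu> ({x. ennreal (lam / 8 ^ k) < g x} \<inter> ball z (4 * r))"
    and t: "1 \<le> t" "t \<le> p" "3 * real k * (p - t) \<le> 1"
  obtains C where "0 < C" "\<And>u g x\<^sub>0 r\<^sub>0. u \<in> Lip \<Longrightarrow> minimal_upper_gradient \<mu> p u g \<Longrightarrow>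
      (\<integral>\<^sup>+x\<in>ball x\<^sub>0 r\<^sub>0. ennreal_powr (sharp_maximal \<nu> p (inner_balls (ball x\<^sub>0 r\<^sub>0)) u x) t \<partial>\<mu>)
        \<le> ennreal C * (\<integral>\<^sup>+x\<in>ball x\<^sub>0 r\<^sub>0. ennreal_powr (g x) t \<partial>\<mu>)"
proof -
  define C1 where "C1 = D ^ 5 * 8 powr (real k * (p + 1)) * 2 * 8 powr (real k * t)"
  define C where "C = 128 powr t * (D ^ 9 * 2 powr (real shift_exponent * t) * (2 * C1))"
  have C1: "0 < C1" and C: "0 < C" using D_pos by (simp_all add: C1_def C_def)
  let ?m = shift_exponent
  show thesis
  proof (rule that[OF C])
    fix u :: "'a \<Rightarrow> real" and g :: "'a \<Rightarrow> ennreal" and x\<^sub>0 :: 'a and r\<^sub>0 :: real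
    assume u: "u \<in> Lip" and min: "minimal_upper_gradient \<mu> p u g"
    let ?B = "ball x\<^sub>0 r\<^sub>0"
    define I where "I = (\<integral>\<^sup>+x\<in>?B. ennreal_powr (g x) t \<partial>\<mu>)"
    have [measurable]: "g \<in> borel_measurable \<mu>"
      using min mu.upper_gradients_measurable by (auto simp: minimal_upper_gradient_def)
    obtain \<kappa> where \<kappa>: "\<kappa>-lipschitz_on UNIV u" using u by (auto simp: Lip_def)
    have \<kappa>0: "0 \<le> \<kappa>" using \<kappa> by (rule lipschitz_on_nonneg)
    \<comment> \<open>The summand 1 keeps the top level positive when the Lipschitz constant is
      0.\<close>
    define \<Lambda> where "\<Lambda> = \<kappa> + 1"
    have \<Lambda>: "0 < \<Lambda>" "\<kappa> \<le> \<Lambda>" using \<kappa>0 by (auto simp: \<Lambda>_def)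
    have empty: "level_set ?B N u s = {}" if "\<Lambda> \<le> s" "0 \<le> N" for N s
      using level_set_empty[OF \<kappa>, of s N ?B] that \<Lambda> by simp
    define a where "a s = emeasure \<mu> (level_set ?B 40 u s)" for s
    define w where "w i = ennreal ((\<Lambda> / 2 ^ i) powr t)" for i :: nat
    define S where "S = (\<Sum>i. w i * a (\<Lambda> / 2 ^ i))"
    define \<gamma> where "\<gamma> s = emeasure \<mu> ({x. ennreal (s / 8 ^ k) < g x} \<inter> ?B)" for s
    have G_meas: "{x. ennreal s < g x} \<in> sets \<mu>" for s
    proof -
      have "{x \<in> space \<mu>. ennreal s < g x} \<in> sets \<mu>" by measurable
      then show ?thesis by simp
    qed
    have w_shift: "w (i + j) = ennreal (2 powr (- (real j * t))) * w i" for i j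
    proof -
      have "(\<Lambda> / 2 ^ (i + j)) powr t = 2 powr (- (real j * t)) * (\<Lambda> / 2 ^ i) powr t"
      proof -
        have "\<Lambda> / 2 ^ (i + j) = 2 powr (- real j) * (\<Lambda> / 2 ^ i)"
          by (simp add: power_add powr_minus powr_realpow field_simps)
        then have "(\<Lambda> / 2 ^ (i + j)) powr t = (2 powr (- real j)) powr t * (\<Lambda> / 2 ^ i) powr t"
          by (simp only: powr_mult)
        then show ?thesis by (simp add: powr_powr)
      qed
      then show ?thesis by (simp add: w_def ennreal_mult)
    qed
    \<comment> \<open>Finiteness of \<open>S\<close> allows half of it to be subtracted later; the
      level sets lie in a ball of finite measure and the weights are summable.\<close>
    have S_fin: "S < \<infinity>"
    proof -
      have "S \<le> (\<Sum>i. w i * emeasure \<mu> ?B)"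
        unfolding S_def a_def using level_set_subset[of 40 ?B u]
        by (intro suminf_le mult_left_mono emeasure_mono) auto
      also have "\<dots> = (\<Sum>i. w i) * emeasure \<mu> ?B" by simp
      also have "\<dots> \<le> ennreal (2 * \<Lambda> powr t) * emeasure \<mu> ?B"
        unfolding w_def using t \<Lambda> by (intro mult_right_mono dyadic_sum_finite) auto
      also have "\<dots> < \<infinity>" using mu.emeasure_ball_finite[of x\<^sub>0 r\<^sub>0] by (simp add: ennreal_mult_less_top)
      finally show ?thesis .
    qed
    \<comment> \<open>Raising the level by \<open>2 ^ j\<close> is a shift of index: the first
      \<open>j\<close> terms have levels of at least \<open>\<Lambda>\<close> and vanish, and the
      weights supply the factor.\<close>
    have shift: "(\<Sum>i. w i * a (2 ^ j * (\<Lambda> / 2 ^ i))) \<le> ennreal (2 powr (- (real j * t))) * S" for j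
    proof -
      have "(\<Sum>i. w i * a (2 ^ j * (\<Lambda> / 2 ^ i))) \<le> (\<Sum>i. ennreal (2 powr (- (real j * t))) * (w i * a (\<Lambda> / 2 ^ i)))"
      proof (rule ennreal_suminf_shift_le[where j = j])
        show "w i * a (2 ^ j * (\<Lambda> / 2 ^ i)) = 0" if "i < j" for i
        proof -
          have "(2::real) ^ i \<le> 2 ^ j" using that by (intro power_increasing) auto
          then have "\<Lambda> \<le> 2 ^ j * (\<Lambda> / 2 ^ i)" using \<Lambda>(1) by (simp add: field_simps)
          then show ?thesis by (simp add: a_def empty)
        qed
        show "w (i + j) * a (2 ^ j * (\<Lambda> / 2 ^ (i + j))) \<le> ennreal (2 powr (- (real j * t))) * (w i * a (\<Lambda> / 2 ^ i))" for i
          by (simp add: w_shift power_add mult.assoc)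
      qed
      then show ?thesis by (simp add: S_def)
    qed
    \<comment> \<open>The level sets with \<open>N = 2\<close> on the right are replaced by those
      with \<open>N = 40\<close>, so that the same function \<open>a\<close> stands on both sides,
      at levels lower by \<open>2 ^ shift_exponent\<close>. As
      \<open>k \<ge> shift_exponent\<close>, the subtractions of exponents are exact.\<close>
    have rec: "a lam \<le> ennreal (D ^ 14 * 2 powr (real k * p) / absorb_const) * a (2 ^ (k - ?m) * lam) +
        ennreal (D ^ 14 * 8 powr (real k * p) / absorb_const) * a (2 ^ (3 * k - ?m) * lam) +
        ennreal (D ^ 5 * 8 powr (real k * (p + 1))) * \<gamma> lam" if lam: "0 < lam" for lam
    proof -
      have Q: "0 < absorb_const" using absorb_const_ge_1 by linarith
      let ?a1 = "2 powr (real k * p) / absorb_const" and ?a2 = "8 powr (real k * p) / absorb_const"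
        and ?a3 = "8 powr (real k * (p + 1))"
      have cmp: "emeasure \<mu> (level_set ?B 2 u (2 ^ j * lam)) \<le> ennreal (D ^ 9) * a (2 ^ (j - ?m) * lam)"
        if "?m \<le> j" for j
      proof -
        have "2 ^ j * lam / 2 ^ ?m = 2 ^ (j - ?m) * lam" using that by (simp add: power_diff)
        then show ?thesis
          using level_set_compare_dyadic[OF u, of "2 ^ j * lam" x\<^sub>0 r\<^sub>0] lam by (simp add: a_def)
      qed
      have "a lam \<le> ennreal (D ^ 5) * (ennreal ?a1 * emeasure \<mu> (level_set ?B 2 u (2 ^ k * lam)) +
          ennreal ?a2 * emeasure \<mu> (level_set ?B 2 u (8 ^ k * lam)) + ennreal ?a3 * \<gamma> lam)"
        unfolding a_def \<gamma>_def using lam Q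
        by (intro global_good_lambda good[OF u min] G_meas level_set_sets) auto
      also have "(8::real) ^ k = 2 ^ (3 * k)" by (simp add: power_mult)
      also have "ennreal (D ^ 5) * (ennreal ?a1 * emeasure \<mu> (level_set ?B 2 u (2 ^ k * lam)) +
          ennreal ?a2 * emeasure \<mu> (level_set ?B 2 u (2 ^ (3 * k) * lam)) + ennreal ?a3 * \<gamma> lam) \<le>
          ennreal (D ^ 5) * (ennreal ?a1 * (ennreal (D ^ 9) * a (2 ^ (k - ?m) * lam)) +
          ennreal ?a2 * (ennreal (D ^ 9) * a (2 ^ (3 * k - ?m) * lam)) + ennreal ?a3 * \<gamma> lam)"
        using k by (intro mult_left_mono add_mono cmp) auto
      also have "\<dots> = (ennreal (D ^ 5) * (ennreal ?a1 * ennreal (D ^ 9))) * a (2 ^ (k - ?m) * lam) +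
          (ennreal (D ^ 5) * (ennreal ?a2 * ennreal (D ^ 9))) * a (2 ^ (3 * k - ?m) * lam) +
          (ennreal (D ^ 5) * ennreal ?a3) * \<gamma> lam"
        by (simp add: distrib_left mult.assoc)
      also have "ennreal (D ^ 5) * (ennreal ?a1 * ennreal (D ^ 9)) = ennreal (D ^ 14 * 2 powr (real k * p) / absorb_const)"
        using D_pos Q by (simp flip: ennreal_mult power_add add: mult.left_commute)
      also have "ennreal (D ^ 5) * (ennreal ?a2 * ennreal (D ^ 9)) = ennreal (D ^ 14 * 8 powr (real k * p) / absorb_const)"
        using D_pos Q by (simp flip: ennreal_mult power_add add: mult.left_commute)
      also have "ennreal (D ^ 5) * ennreal ?a3 = ennreal (D ^ 5 * ?a3)"
        using D_pos by (simp flip: ennreal_mult)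
      finally show ?thesis .
    qed
    have \<gamma>_sum: "(\<Sum>i. w i * \<gamma> (\<Lambda> / 2 ^ i)) \<le> ennreal (2 * 8 powr (real k * t)) * I"
    proof -
      have "(\<Sum>i. w i * \<gamma> (\<Lambda> / 2 ^ i)) = (\<Sum>i. \<integral>\<^sup>+x. w i * indicator ({x. ennreal (\<Lambda> / 2 ^ i / 8 ^ k) < g x} \<inter> ?B) x \<partial>\<mu>)"
        unfolding \<gamma>_def using G_meas by (subst nn_integral_cmult_indicator) auto
      also have "\<dots> = (\<integral>\<^sup>+x. (\<Sum>i. w i * indicator ({x. ennreal (\<Lambda> / 2 ^ i / 8 ^ k) < g x} \<inter> ?B) x) \<partial>\<mu>)"
        using G_meas by (intro nn_integral_suminf[symmetric]) measurable
      also have "\<dots> \<le> (\<integral>\<^sup>+x. ennreal (2 * 8 powr (real k * t)) * (ennreal_powr (g x) t * indicator ?B x) \<partial>\<mu>)"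
      proof (rule nn_integral_mono)
        fix x
        show "(\<Sum>i. w i * indicator ({x. ennreal (\<Lambda> / 2 ^ i / 8 ^ k) < g x} \<inter> ?B) x) \<le>
            ennreal (2 * 8 powr (real k * t)) * (ennreal_powr (g x) t * indicator ?B x)"
        proof (cases "x \<in> ?B")
          case True
          have iff: "ennreal (\<Lambda> / 2 ^ i) < ennreal (8 ^ k) * g x" if "ennreal (\<Lambda> / 2 ^ i / 8 ^ k) < g x" for i
          proof -
            have "\<not> ennreal (8 ^ k) * g x \<le> ennreal (8 ^ k) * ennreal (\<Lambda> / 2 ^ i / 8 ^ k)"
              using that by (subst ennreal_mult_le_mult_iff) (auto simp: not_le)
            then have "ennreal (8 ^ k) * ennreal (\<Lambda> / 2 ^ i / 8 ^ k) < ennreal (8 ^ k) * g x"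
              by (simp only: not_le)
            moreover have "ennreal (8 ^ k) * ennreal (\<Lambda> / 2 ^ i / 8 ^ k) = ennreal (\<Lambda> / 2 ^ i)"
              using \<Lambda> by (simp flip: ennreal_mult)
            ultimately show ?thesis by simp
          qed
          have "(\<Sum>i. w i * indicator ({x. ennreal (\<Lambda> / 2 ^ i / 8 ^ k) < g x} \<inter> ?B) x) \<le>
              (\<Sum>i. ennreal ((\<Lambda> / 2 ^ i) powr t) * (if ennreal (\<Lambda> / 2 ^ i) < ennreal (8 ^ k) * g x then 1 else 0))"
            unfolding w_def using iff by (intro suminf_le mult_left_mono) (auto split: split_indicator)
          also have "\<dots> \<le> 2 * ennreal_powr (ennreal (8 ^ k) * g x) t"
            by (rule dyadic_sum_le_powr[OF t(1) \<Lambda>(1)])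
          also have "\<dots> = 2 * (ennreal ((8 ^ k) powr t) * ennreal_powr (g x) t)"
            by (subst ennreal_powr_cmult) auto
          also have "\<dots> = ennreal (2 * 8 powr (real k * t)) * ennreal_powr (g x) t"
            by (simp add: ennreal_mult mult.assoc powr_powr flip: powr_realpow)
          finally show ?thesis using True by simp
        qed simp
      qed
      also have "\<dots> = ennreal (2 * 8 powr (real k * t)) * I"
        unfolding I_def by (rule nn_integral_cmult) measurable
      finally show ?thesis .
    qed
    have S_le: "S \<le> ennreal (1 / 2) * S + ennreal C1 * I"
    proof -
      let ?b1 = "D ^ 14 * 2 powr (real k * p) / absorb_const" and ?b2 = "D ^ 14 * 8 powr (real k * p) / absorb_const"
        and ?b3 = "D ^ 5 * 8 powr (real k * (p + 1))"
      have Q: "0 < absorb_const" using absorb_const_ge_1 by linarith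
      have b: "0 \<le> ?b1" "0 \<le> ?b2" "0 \<le> ?b3" using D_pos Q by auto
      have collect: "ennreal b1 * (ennreal c1 * S) + ennreal b2 * (ennreal c2 * S) + ennreal b3 * (ennreal c3 * I) =
          ennreal (b1 * c1 + b2 * c2) * S + ennreal (b3 * c3) * I"
        if "0 \<le> b1" "0 \<le> b2" "0 \<le> b3" "0 \<le> c1" "0 \<le> c2" "0 \<le> c3" for b1 b2 b3 c1 c2 c3 :: real
        using that by (simp add: ennreal_mult ennreal_plus distrib_right mult.assoc)
      have "S \<le> (\<Sum>i. ennreal ?b1 * (w i * a (2 ^ (k - ?m) * (\<Lambda> / 2 ^ i))) +
          ennreal ?b2 * (w i * a (2 ^ (3 * k - ?m) * (\<Lambda> / 2 ^ i))) + ennreal ?b3 * (w i * \<gamma> (\<Lambda> / 2 ^ i)))"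
        unfolding S_def
      proof (rule suminf_le)
        fix i
        have "w i * a (\<Lambda> / 2 ^ i) \<le> w i * (ennreal ?b1 * a (2 ^ (k - ?m) * (\<Lambda> / 2 ^ i)) +
          ennreal ?b2 * a (2 ^ (3 * k - ?m) * (\<Lambda> / 2 ^ i)) + ennreal ?b3 * \<gamma> (\<Lambda> / 2 ^ i))"
          using \<Lambda>(1) by (intro mult_left_mono rec) auto
        then show "w i * a (\<Lambda> / 2 ^ i) \<le> ennreal ?b1 * (w i * a (2 ^ (k - ?m) * (\<Lambda> / 2 ^ i))) +
          ennreal ?b2 * (w i * a (2 ^ (3 * k - ?m) * (\<Lambda> / 2 ^ i))) + ennreal ?b3 * (w i * \<gamma> (\<Lambda> / 2 ^ i))"
          by (simp only: distrib_left mult.left_commute)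
      qed auto
      also have "\<dots> = ennreal ?b1 * (\<Sum>i. w i * a (2 ^ (k - ?m) * (\<Lambda> / 2 ^ i))) +
          ennreal ?b2 * (\<Sum>i. w i * a (2 ^ (3 * k - ?m) * (\<Lambda> / 2 ^ i))) + ennreal ?b3 * (\<Sum>i. w i * \<gamma> (\<Lambda> / 2 ^ i))"
        by (simp only: ennreal_suminf_cmult suminf_add[symmetric] summableI)
      also have "\<dots> \<le> ennreal ?b1 * (ennreal (2 powr (- (real (k - ?m) * t))) * S) +
          ennreal ?b2 * (ennreal (2 powr (- (real (3 * k - ?m) * t))) * S) +
          ennreal ?b3 * (ennreal (2 * 8 powr (real k * t)) * I)"
        by (intro add_mono mult_left_mono shift \<gamma>_sum) auto
      also have "\<dots> = ennreal (?b1 * 2 powr (- (real (k - ?m) * t)) + ?b2 * 2 powr (- (real (3 * k - ?m) * t))) * S +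
          ennreal (?b3 * (2 * 8 powr (real k * t))) * I"
        using b by (intro collect) auto
      also have "?b3 * (2 * 8 powr (real k * t)) = C1" by (simp add: C1_def)
      also have "ennreal (?b1 * 2 powr (- (real (k - ?m) * t)) + ?b2 * 2 powr (- (real (3 * k - ?m) * t))) * S \<le> ennreal (1 / 2) * S"
      proof (intro mult_right_mono ennreal_leI)
        have mt: "2 powr (real ?m * t) \<le> (2::real) powr (real ?m * p)"
          using t by (intro powr_mono mult_left_mono) auto
        \<comment> \<open>The local inequality carries the power \<open>p\<close> of the level, the
          weights only \<open>t\<close>. What remains is the cost of the shift and a factor for the
          gap \<open>p - t\<close>, which is at most 2.\<close>
        have e1: "2 powr (real k * p) * 2 powr (- (real (k - ?m) * t)) \<le> 2 powr (real ?m * p) * (2::real)"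
        proof -
          have "2 powr (real k * p) * 2 powr (- (real (k - ?m) * t)) = 2 powr (real ?m * t) * (2::real) powr (real k * (p - t))"
            using k by (simp add: of_nat_diff algebra_simps flip: powr_add)
          also have "\<dots> \<le> 2 powr (real ?m * p) * 2 powr 1"
          proof (intro mult_mono mt powr_mono)
            have "0 \<le> real k * (p - t)" using t by simp
            then show "real k * (p - t) \<le> 1" using t(3) by simp
          qed auto
          finally show ?thesis by simp
        qed
        have e2: "8 powr (real k * p) * 2 powr (- (real (3 * k - ?m) * t)) \<le> 2 powr (real ?m * p) * (2::real)"
        proof -
          have "(8::real) powr (real k * p) = 2 powr (3 * real k * p)"
          proof -
            have "(8::real) = 2 powr 3" by simp
            then show ?thesis by (simp only: powr_powr mult.assoc)
          qed
          then have "8 powr (real k * p) * 2 powr (- (real (3 * k - ?m) * t)) = 2 powr (real ?m * t) * (2::real) powr (3 * real k * (p - t))"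
            using k by (simp add: of_nat_diff algebra_simps flip: powr_add)
          also have "\<dots> \<le> 2 powr (real ?m * p) * 2 powr 1"
            using t(3) by (intro mult_mono mt powr_mono) auto
          finally show ?thesis by simp
        qed
        have "?b1 * 2 powr (- (real (k - ?m) * t)) + ?b2 * 2 powr (- (real (3 * k - ?m) * t)) =
            D ^ 14 / absorb_const * (2 powr (real k * p) * 2 powr (- (real (k - ?m) * t)) +
              8 powr (real k * p) * 2 powr (- (real (3 * k - ?m) * t)))"
          by (simp add: algebra_simps add_divide_distrib)
        also have "\<dots> \<le> D ^ 14 / absorb_const * (2 powr (real ?m * p) * 2 + 2 powr (real ?m * p) * 2)"
          using D_pos Q by (intro mult_left_mono add_mono e1 e2) auto
        also have "\<dots> = 1 / 2" using D_pos by (simp add: absorb_const_def)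
        finally show "?b1 * 2 powr (- (real (k - ?m) * t)) + ?b2 * 2 powr (- (real (3 * k - ?m) * t)) \<le> 1 / 2" .
      qed simp
      finally show ?thesis by (simp add: add_right_mono)
    qed
    have S_bound: "S \<le> ennreal (2 * C1) * I"
    proof (cases "I = \<infinity>")
      case True
      then show ?thesis using C1 by (simp add: ennreal_mult_top)
    next
      case False
      obtain i where i: "I = ennreal i" "0 \<le> i" using False by (cases I) auto
      obtain \<sigma> where \<sigma>: "S = ennreal \<sigma>" "0 \<le> \<sigma>" using S_fin by (cases S) auto
      have "ennreal x * ennreal \<sigma> + ennreal C1 * ennreal i = ennreal (x * \<sigma> + C1 * i)" if "0 \<le> x" for x
        using that i(2) \<sigma>(2) C1 by (simp add: ennreal_mult ennreal_plus)
      from this[of "1 / 2"] have "ennreal \<sigma> \<le> ennreal (1 / 2 * \<sigma> + C1 * i)"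
        using S_le unfolding i(1) \<sigma>(1) by (simp only:)
      then have "\<sigma> \<le> 1 / 2 * \<sigma> + C1 * i" by (subst (asm) ennreal_le_iff) (use \<sigma> i C1 in auto)
      then have "\<sigma> \<le> 2 * C1 * i" by simp
      then show ?thesis using i \<sigma> C1 by (simp add: ennreal_leI flip: ennreal_mult)
    qed
    define M where "M x = sharp_maximal \<nu> p (inner_balls ?B) u x" for x
    have M_le: "ennreal_powr (M x) t \<le> ennreal (128 powr t) * (\<Sum>i. w i * indicator (level_set ?B 2 u (\<Lambda> / 2 ^ i)) x)" for x
    proof (cases "M x = 0")
      case True
      then show ?thesis using t by (simp add: ennreal_powr_def)
    next
      case False
      \<comment> \<open>No level set at or beyond \<open>\<Lambda>\<close> has a point, so
        \<open>M x\<close> is finite and lies in the range of the dyadic levels.\<close>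
      have "M x \<le> ennreal (64 * \<Lambda>)"
        using sharp_maximal_level[OF u \<Lambda>(1), of ?B x] empty[of \<Lambda> 2] by (auto simp: M_def not_less[symmetric])
      then obtain m where m: "M x = ennreal m" "0 \<le> m" "m \<le> 64 * \<Lambda>"
        using \<Lambda>(1) by (cases "M x") (auto simp: top_unique)
      then have m0: "0 < m" using False by (cases "m = 0") auto
      then have "0 < m / 64 / \<Lambda>" using \<Lambda>(1) by simp
      then obtain n where "(1 / 2) ^ n < m / 64 / \<Lambda>" using real_arch_pow_inv[of "m / 64 / \<Lambda>" "1 / 2"] by auto
      then have ex: "\<exists>n. \<Lambda> / 2 ^ n < m / 64" using \<Lambda>(1) by (auto simp: field_simps power_divide intro!: exI[of _ n])
      define i where "i = (LEAST n. \<Lambda> / 2 ^ n < m / 64)"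
      have i: "\<Lambda> / 2 ^ i < m / 64" unfolding i_def by (rule LeastI_ex[OF ex])
      \<comment> \<open>Index 0 is excluded by the upper bound on \<open>m\<close>; the preceding
        level then exists and bounds \<open>m\<close> from above, with a loss of a factor 2.\<close>
      have "i \<noteq> 0" using i m(3) by (cases i) auto
      then obtain j where j: "i = Suc j" by (cases i) auto
      have "\<not> \<Lambda> / 2 ^ j < m / 64" using not_less_Least[of j "\<lambda>n. \<Lambda> / 2 ^ n < m / 64"] j by (simp add: i_def)
      then have "m \<le> 64 * (\<Lambda> / 2 ^ j)" by linarith
      then have m_up: "m \<le> 128 * (\<Lambda> / 2 ^ i)" by (simp add: j)
      have "64 * (\<Lambda> / 2 ^ i) < m" using i by linarith
      then have "ennreal (64 * (\<Lambda> / 2 ^ i)) < ennreal m"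
        by (rule ennreal_lessI[OF m0])
      then have "x \<in> level_set ?B 2 u (\<Lambda> / 2 ^ i)"
        using \<Lambda>(1) unfolding m(1)[symmetric] M_def by (intro sharp_maximal_level[OF u]) auto
      then have "w i = w i * indicator (level_set ?B 2 u (\<Lambda> / 2 ^ i)) x" by simp
      also have "\<dots> \<le> (\<Sum>i. w i * indicator (level_set ?B 2 u (\<Lambda> / 2 ^ i)) x)"
        by (rule ennreal_term_le_suminf)
      finally have wi: "w i \<le> (\<Sum>i. w i * indicator (level_set ?B 2 u (\<Lambda> / 2 ^ i)) x)" .
      have "ennreal_powr (M x) t \<le> ennreal ((128 * (\<Lambda> / 2 ^ i)) powr t)"
        using m m_up t by (simp add: ennreal_leI powr_mono2)
      also have "\<dots> = ennreal (128 powr t) * w i" by (simp only: w_def powr_mult ennreal_mult powr_ge_zero)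
      also have "\<dots> \<le> ennreal (128 powr t) * (\<Sum>i. w i * indicator (level_set ?B 2 u (\<Lambda> / 2 ^ i)) x)"
        by (intro mult_left_mono wi) simp
      finally show ?thesis .
    qed
    have "(\<integral>\<^sup>+x\<in>?B. ennreal_powr (M x) t \<partial>\<mu>) \<le>
        (\<integral>\<^sup>+x. ennreal (128 powr t) * (\<Sum>i. w i * indicator (level_set ?B 2 u (\<Lambda> / 2 ^ i)) x) \<partial>\<mu>)"
      using M_le by (intro nn_integral_mono) (auto split: split_indicator)
    also have "\<dots> = ennreal (128 powr t) * (\<integral>\<^sup>+x. (\<Sum>i. w i * indicator (level_set ?B 2 u (\<Lambda> / 2 ^ i)) x) \<partial>\<mu>)"
      by (rule nn_integral_cmult) measurable
    also have "(\<integral>\<^sup>+x. (\<Sum>i. w i * indicator (level_set ?B 2 u (\<Lambda> / 2 ^ i)) x) \<partial>\<mu>) =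
        (\<Sum>i. \<integral>\<^sup>+x. w i * indicator (level_set ?B 2 u (\<Lambda> / 2 ^ i)) x \<partial>\<mu>)"
      by (rule nn_integral_suminf) measurable
    also have "\<dots> = (\<Sum>i. w i * emeasure \<mu> (level_set ?B 2 u (\<Lambda> / 2 ^ i)))"
      by (simp add: nn_integral_cmult_indicator)
    also have "\<dots> \<le> (\<Sum>i. w i * (ennreal (D ^ 9) * a (\<Lambda> / 2 ^ i / 2 ^ ?m)))"
      unfolding a_def using \<Lambda>(1) by (intro suminf_le mult_left_mono level_set_compare_dyadic[OF u]) auto
    \<comment> \<open>The weights are moved by \<open>shift_exponent\<close> indices, to match the
      lowered levels with the terms of \<open>S\<close>.\<close>
    also have "\<dots> = (\<Sum>i. ennreal (D ^ 9 * 2 powr (real ?m * t)) * (w (i + ?m) * a (\<Lambda> / 2 ^ (i + ?m))))"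
    proof (rule suminf_cong)
      fix i
      have "ennreal (2 powr (real ?m * t)) * w (i + ?m) = w i"
      proof -
        have "ennreal (2 powr (real ?m * t)) * ennreal (2 powr (- (real ?m * t))) = 1"
          by (simp flip: ennreal_mult powr_add)
        then show ?thesis by (simp add: w_shift mult.assoc[symmetric])
      qed
      then show "w i * (ennreal (D ^ 9) * a (\<Lambda> / 2 ^ i / 2 ^ ?m)) =
          ennreal (D ^ 9 * 2 powr (real ?m * t)) * (w (i + ?m) * a (\<Lambda> / 2 ^ (i + ?m)))"
        using D_pos by (simp add: ennreal_mult power_add mult_ac flip: \<open>ennreal (2 powr (real ?m * t)) * w (i + ?m) = w i\<close>)
    qed
    also have "\<dots> = ennreal (D ^ 9 * 2 powr (real ?m * t)) * (\<Sum>i. w (i + ?m) * a (\<Lambda> / 2 ^ (i + ?m)))"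
      by (rule ennreal_suminf_cmult)
    also have "\<dots> \<le> ennreal (D ^ 9 * 2 powr (real ?m * t)) * S"
    proof (rule mult_left_mono)
      have "S = (\<Sum>i. w (i + ?m) * a (\<Lambda> / 2 ^ (i + ?m))) + (\<Sum>i<?m. w i * a (\<Lambda> / 2 ^ i))"
        unfolding S_def by (rule suminf_offset) simp
      then show "(\<Sum>i. w (i + ?m) * a (\<Lambda> / 2 ^ (i + ?m))) \<le> S" by simp
    qed simp
    also have "\<dots> \<le> ennreal (D ^ 9 * 2 powr (real ?m * t)) * (ennreal (2 * C1) * I)"
      by (intro mult_left_mono S_bound) simp
    also have "ennreal (128 powr t) * (ennreal (D ^ 9 * 2 powr (real ?m * t)) * (ennreal (2 * C1) * I)) = ennreal C * I"
      unfolding C_def using D_pos C1 by (simp add: ennreal_mult mult.assoc)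
    finally show "(\<integral>\<^sup>+x\<in>?B. ennreal_powr (sharp_maximal \<nu> p (inner_balls ?B) u x) t \<partial>\<mu>)
        \<le> ennreal C * (\<integral>\<^sup>+x\<in>?B. ennreal_powr (g x) t \<partial>\<mu>)"
      by (simp add: M_def I_def mult_left_mono)
  qed
qed

end

lemma doubling_space_mono:
  "doubling_space M D \<Longrightarrow> D \<le> D' \<Longrightarrow> doubling_space M D'"
  unfolding doubling_space_def by (meson dual_order.strict_trans1 mult_right_mono order_trans measure_nonneg)

theorem theorem6p1:
  fixes \<nu> \<mu> :: "'a::metric_space measure"
    and p \<tau> \<theta> K C\<^sub>b c \<delta> :: real
  assumes "1 < p"
    and "0 < \<tau>" "\<tau> < p - 1"
    and "0 < \<theta>" "\<theta> < p - 1"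
    and "geodesic_two_measure_space \<nu> \<mu>"
    and "0 < K" "poincare_inequality \<nu> \<mu> p p K"
    and "0 < C\<^sub>b" "balance_condition \<nu> \<mu> (p - \<tau>) C\<^sub>b"
    and "independence_property \<mu> (p - \<theta>)"
    and "0 < c" "0 < \<delta>" "A_infinity_weighted \<nu> \<mu> c \<delta>"
  shows "\<exists>\<epsilon>\<^sub>0. 0 < \<epsilon>\<^sub>0 \<and> \<epsilon>\<^sub>0 < p - 1 \<and>
           (\<forall>\<epsilon>. 0 \<le> \<epsilon> \<and> \<epsilon> \<le> \<epsilon>\<^sub>0 \<longrightarrow> maximal_poincare_inequality \<nu> \<mu> p (p - \<epsilon>))"
proof -
  have tms: "two_measure_space \<nu> \<mu>" using assms(6) by (simp add: geodesic_two_measure_space_def)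
  obtain D1 where D1: "doubling_space \<nu> D1"
    using tms unfolding two_measure_space_def doubling_measure_def doubling_space_def by blast
  obtain D2 where D2: "doubling_space \<mu> D2"
    using tms unfolding two_measure_space_def doubling_measure_def doubling_space_def by blast
  define D where "D = max D1 D2"
  interpret nu: doubling_space \<nu> D by (rule doubling_space_mono[OF D1]) (simp add: D_def)
  interpret mu: doubling_space \<mu> D by (rule doubling_space_mono[OF D2]) (simp add: D_def)
  interpret geodesic_space_pair \<nu> \<mu> D p \<tau> C\<^sub>b K
  proof
    show "\<exists>x y :: 'a. x \<noteq> y" using tms unfolding two_measure_space_def by blast
    show "\<exists>l \<gamma>. arc_length_curve l \<gamma> \<and> \<gamma> 0 = x \<and> \<gamma> l = y \<and> l = dist x y" if "x \<noteq> y" for x y :: 'a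
      using assms(6) that unfolding geodesic_two_measure_space_def by blast
  qed (use assms in auto)
  \<comment> \<open>\<open>absorb_const\<close> does not depend on \<open>k\<close>, so it may be
    taken as \<open>Q\<close>.\<close>
  obtain k\<^sub>0 where good: "\<And>k B\<^sub>0 u g z r lam. k\<^sub>0 \<le> k \<Longrightarrow> u \<in> Lip \<Longrightarrow> minimal_upper_gradient \<mu> p u g \<Longrightarrow>
    0 < lam \<Longrightarrow> 0 < r \<Longrightarrow> fits r \<Longrightarrow> ball z (40 * r) \<subseteq> B\<^sub>0 \<Longrightarrow> \<not> controlled u z r lam \<Longrightarrow>
    measure \<mu> (ball z r) \<le>
    2 powr (real k * p) / absorb_const * measure \<mu> (level_set B\<^sub>0 2 u (2 ^ k * lam) \<inter> ball z (4 * r)) +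
    8 powr (real k * p) / absorb_const * measure \<mu> (level_set B\<^sub>0 2 u (8 ^ k * lam) \<inter> ball z (4 * r)) +
    8 powr (real k * (p + 1)) * measure \<mu> ({x. ennreal (lam / 8 ^ k) < g x} \<inter> ball z (4 * r))"
    using good_lambda[OF absorb_const_ge_1] by blast
  define k where "k = max k\<^sub>0 shift_exponent"
  \<comment> \<open>The bound by \<open>\<theta>\<close> keeps the exponents in the range of the
    independence property; the other gives \<open>3 * real k * \<epsilon> \<le> 1\<close>, its added
    1 avoiding division by zero.\<close>
  define \<epsilon>\<^sub>0 where "\<epsilon>\<^sub>0 = min \<theta> (1 / (3 * real k + 1))"
  have \<epsilon>\<^sub>0: "0 < \<epsilon>\<^sub>0" "\<epsilon>\<^sub>0 \<le> \<theta>" "\<epsilon>\<^sub>0 < p - 1" using assms by (auto simp: \<epsilon>\<^sub>0_def)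
  have "maximal_poincare_inequality \<nu> \<mu> p (p - \<epsilon>)" if \<epsilon>: "0 \<le> \<epsilon>" "\<epsilon> \<le> \<epsilon>\<^sub>0" for \<epsilon>
  proof -
    have "3 * real k * \<epsilon> \<le> 1"
    proof -
      have "3 * real k * \<epsilon> \<le> (3 * real k + 1) * (1 / (3 * real k + 1))"
        using \<epsilon> by (intro mult_mono) (auto simp: \<epsilon>\<^sub>0_def)
      then show ?thesis by simp
    qed
    then have t: "1 \<le> p - \<epsilon>" "p - \<epsilon> \<le> p" "3 * real k * (p - (p - \<epsilon>)) \<le> 1" using \<epsilon> \<epsilon>\<^sub>0 by auto
    have t0: "0 < p - \<epsilon>" "0 < p" "0 < p - \<theta>" using t assms by auto
    have kk: "shift_exponent \<le> k" "k\<^sub>0 \<le> k" by (auto simp: k_def)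
    obtain C where C: "0 < C" "\<And>u g x\<^sub>0 r\<^sub>0. u \<in> Lip \<Longrightarrow> minimal_upper_gradient \<mu> p u g \<Longrightarrow>
      (\<integral>\<^sup>+x\<in>ball x\<^sub>0 r\<^sub>0. ennreal_powr (sharp_maximal \<nu> p (inner_balls (ball x\<^sub>0 r\<^sub>0)) u x) (p - \<epsilon>) \<partial>\<mu>)
        \<le> ennreal C * (\<integral>\<^sup>+x\<in>ball x\<^sub>0 r\<^sub>0. ennreal_powr (g x) (p - \<epsilon>) \<partial>\<mu>)"
      using maximal_estimate[OF kk(1) good[OF kk(2)] t] by blast
    show ?thesis
      unfolding maximal_poincare_inequality_def
    proof (intro exI[of _ C] conjI allI ballI impI C(1))
      fix x\<^sub>0 :: 'a and r\<^sub>0 :: real and u g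
      assume u: "u \<in> Lip" and g: "g \<in> upper_gradients \<mu> (p - \<epsilon>) u" and "0 < r\<^sub>0"
      obtain h where h: "minimal_upper_gradient \<mu> p u h"
        using mu.minimal_upper_gradient_exists[OF t0(2) u] by blast
      obtain h1 where h1: "minimal_upper_gradient \<mu> (p - \<epsilon>) u h1"
        using mu.minimal_upper_gradient_exists[OF t0(1) u] by blast
      obtain h2 where h2: "minimal_upper_gradient \<mu> (p - \<theta>) u h2"
        using mu.minimal_upper_gradient_exists[OF t0(3) u] by blast
      \<comment> \<open>The independence property compares with the exponent
        \<open>p - \<theta>\<close> only, so the minimal gradients for \<open>p\<close> and
        \<open>p - \<epsilon>\<close> are identified through \<open>h2\<close>.\<close>
      have ind: "AE x in \<mu>. f x = h2 x" if "p - \<theta> \<le> q" "minimal_upper_gradient \<mu> q u f" for q f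
        using assms(11) u that h2 unfolding independence_property_def by blast
      have "AE x in \<mu>. h x = h2 x" using assms(4) by (intro ind[OF _ h]) simp
      moreover have "AE x in \<mu>. h1 x = h2 x" using \<epsilon> \<epsilon>\<^sub>0 by (intro ind[OF _ h1]) simp
      moreover have "AE x in \<mu>. h1 x \<le> g x" using h1 g unfolding minimal_upper_gradient_def by blast
      ultimately have le: "AE x in \<mu>. h x \<le> g x" by eventually_elim simp
      have "(\<integral>\<^sup>+x\<in>ball x\<^sub>0 r\<^sub>0. ennreal_powr (h x) (p - \<epsilon>) \<partial>\<mu>) \<le> (\<integral>\<^sup>+x\<in>ball x\<^sub>0 r\<^sub>0. ennreal_powr (g x) (p - \<epsilon>) \<partial>\<mu>)"
      proof (rule nn_integral_mono_AE, rule eventually_mono[OF le])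
        fix x assume "h x \<le> g x"
        then show "ennreal_powr (h x) (p - \<epsilon>) * indicator (ball x\<^sub>0 r\<^sub>0) x \<le> ennreal_powr (g x) (p - \<epsilon>) * indicator (ball x\<^sub>0 r\<^sub>0) x"
          using t0(1) by (intro mult_right_mono ennreal_powr_mono) auto
      qed
      then have "ennreal C * (\<integral>\<^sup>+x\<in>ball x\<^sub>0 r\<^sub>0. ennreal_powr (h x) (p - \<epsilon>) \<partial>\<mu>) \<le>
          ennreal C * (\<integral>\<^sup>+x\<in>ball x\<^sub>0 r\<^sub>0. ennreal_powr (g x) (p - \<epsilon>) \<partial>\<mu>)" by (rule mult_left_mono) simp
      with C(2)[OF u h, of x\<^sub>0 r\<^sub>0]
      show "(\<integral>\<^sup>+x\<in>ball x\<^sub>0 r\<^sub>0. ennreal_powr (sharp_maximal \<nu> p (inner_balls (ball x\<^sub>0 r\<^sub>0)) u x) (p - \<epsilon>) \<partial>\<mu>)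
        \<le> ennreal C * (\<integral>\<^sup>+x\<in>ball x\<^sub>0 r\<^sub>0. ennreal_powr (g x) (p - \<epsilon>) \<partial>\<mu>)" by (rule order_trans)
    qed
  qed
  then show ?thesis using \<epsilon>\<^sub>0 by blast
qed

end
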